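(* Assume the setting below with Hölder exponent $\beta\in(1/2,1]$. Then for every $T>0$ there are constants $C_1(T),C_2(T)$ such that for every integer $M\ge1$, with $\Delta t=T/M$, $$\Big\|\mathcal U(T,0)-\prod_{k=0}^{M-1}e^{\Delta t\,\mathcal A(k\Delta t)}\Big\|_{L^2(\mathbb T^d)\to L^2(\mathbb T^d)}\le C_1(T)(\Delta t)^{\beta-\frac12},$$ and $$\Big\|\prod_{k=0}^{M-1}e^{\Delta t\,\mathcal A(k\Delta t)}-\prod_{k=0}^{M-1}e^{\Delta t\,\mathcal L(k\Delta t)}e^{\Delta t\,\mathcal C(k\Delta t)}\Big\|_{L^2(\mathbb T^d)\to L^2(\mathbb T^d)}\le C_2(T)(\Delta t)^{\frac12}.$$
   Context: $\mathbb T^d=\mathbb R^d/\mathbb Z^d$, $\kappa>0$. $\mathbf b:[0,\infty)\times\mathbb T^d\to\mathbb R^d$ and $c:[0,\infty)\times\mathbb T^d\to\mathbb R$ are smooth and bounded in $\mathbf x$ together with all $\mathbf x$-derivatives (uniformly in $t$), and uniformly Hölder in $t$: $\|\mathbf b(t,\mathbf x)-\mathbf b(s,\mathbf x)\|+|c(t,\mathbf x)-c(s,\mathbf x)|\le C|t-s|^\beta$. $\mathcal L(t)=\kappa\Delta+\mathbf b(t,\cdot)\cdot\nabla$, $\mathcal C(t)=$ multiplication by $c(t,\cdot)$, $\mathcal A(t)=\mathcal L(t)+\mathcal C(t)$ on $L^2(\mathbb T^d)$ with domain $H^2(\mathbb T^d)$; each of these generates a strongly continuous (for $\mathcal L,\mathcal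 A$: analytic) semigroup $e^{\tau\,\cdot}$. $\mathcal U(t,s)$, $t\ge s\ge0$, is the evolution family (solution operator) of $w_t=\mathcal A(t)w$: $\mathcal U(s,s)=\mathrm{Id}$, $\mathcal U(t,r)\mathcal U(r,s)=\mathcal U(t,s)$, $\frac{d}{dt}\mathcal U(t,s)w_0=\mathcal A(t)\mathcal U(t,s)w_0$. Products are ordered with later indices to the left: $\prod_{k=0}^{M-1}Q_k:=Q_{M-1}Q_{M-2}\cdots Q_0$. *)

theory Defs
  imports "HOL-Analysis.Analysis"
begin

text \<open>Real-valued functions on the torus R^d/Z^d are represented as Z^d-periodic
functions on real^'d; L^2(T^d) is the space of periodic, measurable functions that
are square integrable over the unit cell, with the L^2 seminorm (elements of L^2 are
identified when their difference has norm 0).\<close>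

type_synonym 'd fn = "real^'d \<Rightarrow> real"
type_synonym 'd op = "'d fn \<Rightarrow> 'd fn"

definition cell :: "(real^'d::finite) set" where
  "cell = cbox 0 One"

definition periodic_fn :: "('d::finite) fn \<Rightarrow> bool" where
  "periodic_fn f \<longleftrightarrow> (\<forall>x i. f (x + axis i 1) = f x)"

definition L2 :: "('d::finite) fn set" where
  "L2 = {f. periodic_fn f \<and> f \<in> borel_measurable (lebesgue_on cell)
           \<and> integrable (lebesgue_on cell) (\<lambda>x. (f x)\<^sup>2)}"

definition l2norm :: "('d::finite) fn \<Rightarrow> real" where
  "l2norm f = sqrt (integral\<^sup>L (lebesgue_on cell) (\<lambda>x. (f x)\<^sup>2))"

definition l2eq :: "('d::finite) fn \<Rightarrow> 'd fn \<Rightarrow> bool" where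
  "l2eq f g \<longleftrightarrow> l2norm (\<lambda>x. f x - g x) = 0"

text \<open>Bounded linear operators on L^2 (acting on representatives, compatible with
the identification of L^2 elements).\<close>
definition bounded_op :: "('d::finite) op \<Rightarrow> bool" where
  "bounded_op P \<longleftrightarrow> (\<forall>f\<in>L2. P f \<in> L2)
     \<and> (\<forall>f\<in>L2. \<forall>g\<in>L2. l2eq f g \<longrightarrow> l2eq (P f) (P g))
     \<and> (\<forall>f\<in>L2. \<forall>g\<in>L2. \<forall>a. l2eq (P (\<lambda>x. a * f x + g x)) (\<lambda>x. a * P f x + P g x))
     \<and> (\<exists>B. \<forall>f\<in>L2. l2norm (P f) \<le> B * l2norm f)"

definition opnorm :: "('d::finite) op \<Rightarrow> real" where
  "opnorm P = Sup {l2norm (P f) | f. f \<in> L2 \<and> l2norm f \<le> 1}"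

definition opdiff :: "('d::finite) op \<Rightarrow> 'd op \<Rightarrow> 'd op" where
  "opdiff P Q = (\<lambda>f x. P f x - Q f x)"

primrec opprod :: "(nat \<Rightarrow> 'a \<Rightarrow> 'a) \<Rightarrow> nat \<Rightarrow> 'a \<Rightarrow> 'a" where
  "opprod Q 0 = id"
| "opprod Q (Suc n) = Q n \<circ> opprod Q n"

definition pd :: "'d \<Rightarrow> ('d::finite) fn \<Rightarrow> 'd fn" where
  "pd i f x = deriv (\<lambda>h. f (x + h *\<^sub>R axis i 1)) 0"

primrec dlist :: "'d list \<Rightarrow> ('d::finite) fn \<Rightarrow> 'd fn" where
  "dlist [] f = f"
| "dlist (i # is) f = pd i (dlist is f)"

definition smooth_fn :: "('d::finite) fn \<Rightarrow> bool" where
  "smooth_fn f \<longleftrightarrow> (\<forall>is. continuous_on UNIV (dlist is f)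
      \<and> (\<forall>i x. (\<lambda>h. dlist is f (x + h *\<^sub>R axis i 1)) differentiable (at 0)))"

definition is_weak_deriv :: "'d list \<Rightarrow> ('d::finite) fn \<Rightarrow> 'd fn \<Rightarrow> bool" where
  "is_weak_deriv \<alpha> f g \<longleftrightarrow> g \<in> L2 \<and> (\<forall>\<phi>. smooth_fn \<phi> \<and> periodic_fn \<phi> \<longrightarrow>
      integral\<^sup>L (lebesgue_on cell) (\<lambda>x. f x * dlist \<alpha> \<phi> x)
        = (-1) ^ length \<alpha> * integral\<^sup>L (lebesgue_on cell) (\<lambda>x. g x * \<phi> x))"

definition H2 :: "('d::finite) fn set" where
  "H2 = {f \<in> L2. \<forall>\<alpha>. length \<alpha> \<le> 2 \<longrightarrow> (\<exists>g. is_weak_deriv \<alpha> f g)}"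

definition wd :: "'d list \<Rightarrow> ('d::finite) fn \<Rightarrow> 'd fn" where
  "wd \<alpha> f = (SOME g. is_weak_deriv \<alpha> f g)"

definition Lop :: "real \<Rightarrow> (real \<Rightarrow> real^'d \<Rightarrow> real^'d) \<Rightarrow> real \<Rightarrow> ('d::finite) op" where
  "Lop \<kappa> b t f = (\<lambda>x. \<kappa> * (\<Sum>i\<in>UNIV. wd [i, i] f x) + (\<Sum>i\<in>UNIV. b t x $ i * wd [i] f x))"

definition Cop :: "(real \<Rightarrow> real^'d \<Rightarrow> real) \<Rightarrow> real \<Rightarrow> ('d::finite) op" where
  "Cop c t f = (\<lambda>x. c t x * f x)"

definition Aop :: "real \<Rightarrow> (real \<Rightarrow> real^'d \<Rightarrow> real^'d) \<Rightarrow> (real \<Rightarrow> real^'d \<Rightarrow> real)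
    \<Rightarrow> real \<Rightarrow> ('d::finite) op" where
  "Aop \<kappa> b c t f = (\<lambda>x. Lop \<kappa> b t f x + Cop c t f x)"

definition generates :: "(real \<Rightarrow> ('d::finite) op) \<Rightarrow> 'd op \<Rightarrow> 'd fn set \<Rightarrow> bool" where
  "generates S G D \<longleftrightarrow>
     (\<forall>\<tau>\<ge>0. bounded_op (S \<tau>))
   \<and> (\<forall>f\<in>L2. l2eq (S 0 f) f)
   \<and> (\<forall>\<tau>\<ge>0. \<forall>\<sigma>\<ge>0. \<forall>f\<in>L2. l2eq (S (\<tau> + \<sigma>) f) (S \<tau> (S \<sigma> f)))
   \<and> (\<forall>f\<in>L2. ((\<lambda>\<tau>. l2norm (\<lambda>x. S \<tau> f x - f x)) \<longlongrightarrow> 0) (at_right 0))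
   \<and> D \<subseteq> L2
   \<and> (\<forall>f\<in>L2. f \<in> D \<longleftrightarrow>
        (\<exists>g\<in>L2. ((\<lambda>\<tau>. l2norm (\<lambda>x. (S \<tau> f x - f x) / \<tau> - g x)) \<longlongrightarrow> 0) (at_right 0)))
   \<and> (\<forall>f\<in>D. G f \<in> L2 \<and>
        ((\<lambda>\<tau>. l2norm (\<lambda>x. (S \<tau> f x - f x) / \<tau> - G f x)) \<longlongrightarrow> 0) (at_right 0))"

definition evolution_family :: "(real \<Rightarrow> real \<Rightarrow> ('d::finite) op) \<Rightarrow> (real \<Rightarrow> 'd op) \<Rightarrow> bool" where
  "evolution_family U A \<longleftrightarrow>
     (\<forall>t s. 0 \<le> s \<and> s \<le> t \<longrightarrow> bounded_op (U t s))
   \<and> (\<forall>s\<ge>0. \<forall>f\<in>L2. l2eq (U s s f) f)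
   \<and> (\<forall>s r t. 0 \<le> s \<and> s \<le> r \<and> r \<le> t \<longrightarrow> (\<forall>f\<in>L2. l2eq (U t r (U r s f)) (U t s f)))
   \<and> (\<forall>s\<ge>0. \<forall>f\<in>L2. ((\<lambda>t. l2norm (\<lambda>x. U t s f x - f x)) \<longlongrightarrow> 0) (at_right s))
   \<and> (\<forall>s t. 0 \<le> s \<and> s < t \<longrightarrow> (\<forall>f\<in>L2. U t s f \<in> H2 \<and>
        ((\<lambda>h. l2norm (\<lambda>x. (U (t + h) s f x - U t s f x) / h - A t (U t s f) x)) \<longlongrightarrow> 0) (at 0)))"

definition coeff_assms :: "real \<Rightarrow> (real \<Rightarrow> real^'d \<Rightarrow> real^'d) \<Rightarrow> (real \<Rightarrow> real^'d \<Rightarrow> real)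
    \<Rightarrow> ('d::finite) itself \<Rightarrow> bool" where
  "coeff_assms \<beta> b c _ \<longleftrightarrow>
     (\<forall>t\<ge>0. \<forall>j. periodic_fn (\<lambda>x. b t x $ j) \<and> smooth_fn (\<lambda>x. b t x $ j))
   \<and> (\<forall>t\<ge>0. periodic_fn (c t) \<and> smooth_fn (c t))
   \<and> (\<forall>is j. \<exists>B. \<forall>t\<ge>0. \<forall>x. \<bar>dlist is (\<lambda>y. b t y $ j) x\<bar> \<le> B)
   \<and> (\<forall>is. \<exists>B. \<forall>t\<ge>0. \<forall>x. \<bar>dlist is (c t) x\<bar> \<le> B)
   \<and> (\<exists>C. \<forall>t\<ge>0. \<forall>s\<ge>0. \<forall>x.
        norm (b t x - b s x) + \<bar>c t x - c s x\<bar> \<le> C * \<bar>t - s\<bar> powr \<beta>)"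

end

theory Submission
  imports Defs
begin

text \<open>Every comparison is an energy estimate in L2. On H2 the form of \<open>Lop\<close> is bounded above by
  \<open>KL * (l2norm f)^2\<close> minus a multiple of the squared gradient norm. For the frozen product the error
  solves the frozen equation with a source of size \<open>dt powr \<beta>\<close> times the gradient of the exact
  solution, which is absorbed by the dissipation of that solution; this gives the rate \<open>\<beta>\<close>, more than
  is claimed. For the splitting, \<open>u = exp (s A) u0\<close> is compared with
  \<open>exp (s L) (z + (s / dt) (exp (dt C) z - z))\<close>: the residual consists of increments
  \<open>exp (s L) f - f\<close>, which are of order \<open>sqrt s\<close> in the dual of H1, and is again absorbed by the
  dissipation. Integration by parts for weak derivatives is proved by mollification; uniform
  boundedness makes the given semigroups strongly continuous, so that energies may be
  differentiated from the right.\<close>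

section \<open>The space L2 of periodic functions\<close>

text \<open>\<open>generates\<close> and \<open>evolution_family\<close> give the operators only
  abstractly: no smoothing estimates, no bounds uniform in \<open>t\<close>, and for the semigroups
  derivatives only on the domain. Commutator expansions and Duhamel formulas are therefore replaced
  by energy inequalities, whose constants come from the coefficients alone; they are proved where
  orbits are differentiable and carried over by density. The exponent 1/2 of the splitting arises
  from summation: one step adds \<open>O(d^2)\<close> to the squared error, \<open>T/d\<close> steps
  add \<open>O(T * d)\<close>, and a square root is taken. The interpolant of the splitting joins
  \<open>z\<close> at time 0 to \<open>exp (d L) (exp (d C) z)\<close> at time \<open>d\<close>.
  That \<open>exp (d C) z\<close> lies in \<open>H2\<close> is not among the data, so the step is
  proved for an arbitrary \<open>y\<close> in \<open>H2\<close> in its place, and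
  \<open>exp (d C)\<close> enters only through norms that are continuous in
  \<open>L2\<close>.\<close>

abbreviation mcell :: "(real^'d::finite) measure" where
  "mcell \<equiv> lebesgue_on cell"

text \<open>Periodicity is left out: integrals only see the cell, and the approximants of a periodic
  function constructed below are not all periodic.\<close>

definition sq :: "('d::finite) fn \<Rightarrow> bool" where
  "sq f \<longleftrightarrow> f \<in> borel_measurable mcell \<and> integrable mcell (\<lambda>x. (f x)^2)"

abbreviation l2dist :: "('d::finite) fn \<Rightarrow> 'd fn \<Rightarrow> real" where
  "l2dist f g \<equiv> l2norm (\<lambda>x. f x - g x)"

definition ip :: "('d::finite) fn \<Rightarrow> 'd fn \<Rightarrow> real" where
  "ip f g = integral\<^sup>L mcell (\<lambda>x. f x * g x)"

lemma L2_iff: "f \<in> L2 \<longleftrightarrow> periodic_fn f \<and> sq f"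
  by (auto simp: L2_def sq_def)

lemma cell_sets [simp]: "cell \<in> sets lebesgue"
  by (simp add: cell_def)

lemma emeasure_mcell_space: "emeasure mcell (space mcell) = 1"
  by (simp add: emeasure_restrict_space cell_def emeasure_lborel_cbox_eq)

lemma finite_measure_mcell: "finite_measure mcell"
  by (rule finite_measureI) (simp only: emeasure_mcell_space, simp)

lemma measure_mcell_space: "measure mcell (space mcell) = 1"
  by (simp only: measure_def emeasure_mcell_space, simp)

lemma sq_integrable_mult:
  assumes "sq f" "sq g"
  shows "integrable mcell (\<lambda>x. f x * g x)"
proof (rule Bochner_Integration.integrable_bound)
  show "integrable mcell (\<lambda>x. (f x)^2 + (g x)^2)"
    using assms by (auto simp: sq_def)
  show "(\<lambda>x. f x * g x) \<in> borel_measurable mcell"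
    using assms by (auto simp: sq_def)
  show "AE x in mcell. norm (f x * g x) \<le> norm ((f x)^2 + (g x)^2)"
  proof (rule AE_I2)
    fix x
    have "2 * (\<bar>f x\<bar> * \<bar>g x\<bar>) \<le> (f x)^2 + (g x)^2"
      using sum_squares_bound[of "\<bar>f x\<bar>" "\<bar>g x\<bar>"] by (simp add: mult.assoc)
    moreover have "0 \<le> \<bar>f x\<bar> * \<bar>g x\<bar>" by simp
    ultimately show "norm (f x * g x) \<le> norm ((f x)^2 + (g x)^2)"
      unfolding real_norm_def abs_mult by linarith
  qed
qed

lemma sq_add [simp, intro]:
  assumes "sq f" "sq g" shows "sq (\<lambda>x. f x + g x)"
proof -
  have "integrable mcell (\<lambda>x. (f x)^2 + (g x)^2 + 2 * (f x * g x))"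
    using assms sq_integrable_mult[OF assms] by (auto simp: sq_def)
  then show ?thesis using assms by (auto simp: sq_def power2_sum mult.assoc)
qed

lemma sq_cmult [simp, intro]: "sq f \<Longrightarrow> sq (\<lambda>x. a * f x)"
  by (auto simp: sq_def power_mult_distrib)

lemma sq_divide [simp, intro]: "sq f \<Longrightarrow> sq (\<lambda>x. f x / a)"
  using sq_cmult[of f "inverse a"] by (simp add: field_simps)

lemma sq_minus [simp, intro]: "sq f \<Longrightarrow> sq (\<lambda>x. - f x)"
  by (auto simp: sq_def)

lemma sq_diff [simp, intro]: "sq f \<Longrightarrow> sq g \<Longrightarrow> sq (\<lambda>x. f x - g x)"
  using sq_add[of f "\<lambda>x. - g x"] by simp

lemma sq_const [simp, intro]: "sq (\<lambda>x. a)"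
  by (auto simp: sq_def finite_measure.integrable_const[OF finite_measure_mcell])

lemma sq_sum [simp, intro]: "(\<And>i. i \<in> I \<Longrightarrow> sq (f i)) \<Longrightarrow> sq (\<lambda>x. \<Sum>i\<in>I. f i x)"
  by (induction I rule: infinite_finite_induct) auto

lemma periodic_add [simp, intro]: "periodic_fn f \<Longrightarrow> periodic_fn g \<Longrightarrow> periodic_fn (\<lambda>x. f x + g x)"
  and periodic_diff [simp, intro]: "periodic_fn f \<Longrightarrow> periodic_fn g \<Longrightarrow> periodic_fn (\<lambda>x. f x - g x)"
  and periodic_mult [simp, intro]: "periodic_fn f \<Longrightarrow> periodic_fn g \<Longrightarrow> periodic_fn (\<lambda>x. f x * g x)"
  and periodic_minus [simp, intro]: "periodic_fn f \<Longrightarrow> periodic_fn (\<lambda>x. - f x)"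
  and periodic_divide [simp, intro]: "periodic_fn f \<Longrightarrow> periodic_fn (\<lambda>x. f x / a)"
  and periodic_const [simp, intro]: "periodic_fn (\<lambda>x. a)"
  by (auto simp: periodic_fn_def)

lemma periodic_sum [simp, intro]: "(\<And>i. i \<in> I \<Longrightarrow> periodic_fn (f i)) \<Longrightarrow> periodic_fn (\<lambda>x. \<Sum>i\<in>I. f i x)"
  by (auto simp: periodic_fn_def)

lemma L2_add [simp, intro]: "f \<in> L2 \<Longrightarrow> g \<in> L2 \<Longrightarrow> (\<lambda>x. f x + g x) \<in> L2"
  and L2_diff [simp, intro]: "f \<in> L2 \<Longrightarrow> g \<in> L2 \<Longrightarrow> (\<lambda>x. f x - g x) \<in> L2"
  and L2_minus [simp, intro]: "f \<in> L2 \<Longrightarrow> (\<lambda>x. - f x) \<in> L2"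
  and L2_cmult [simp, intro]: "f \<in> L2 \<Longrightarrow> (\<lambda>x. a * f x) \<in> L2"
  and L2_divide [simp, intro]: "f \<in> L2 \<Longrightarrow> (\<lambda>x. f x / a) \<in> L2"
  and L2_const [simp, intro]: "(\<lambda>x. a) \<in> L2"
  by (auto simp: L2_iff)

lemma L2_sum [simp, intro]: "(\<And>i. i \<in> I \<Longrightarrow> f i \<in> L2) \<Longrightarrow> (\<lambda>x. \<Sum>i\<in>I. f i x) \<in> L2"
  by (auto simp: L2_iff)

lemma L2_I: "periodic_fn f \<Longrightarrow> sq f \<Longrightarrow> f \<in> L2"
  by (simp add: L2_iff)

lemma L2_sq [simp, intro]: "f \<in> L2 \<Longrightarrow> sq f"
  and L2_periodic [simp, intro]: "f \<in> L2 \<Longrightarrow> periodic_fn f"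
  by (simp_all add: L2_iff)

lemma ip_commute: "ip f g = ip g f"
  by (simp add: ip_def mult.commute)

lemma ip_add_left: "sq f \<Longrightarrow> sq g \<Longrightarrow> sq h \<Longrightarrow> ip (\<lambda>x. f x + g x) h = ip f h + ip g h"
  by (simp add: ip_def distrib_right sq_integrable_mult)

lemma ip_diff_left: "sq f \<Longrightarrow> sq g \<Longrightarrow> sq h \<Longrightarrow> ip (\<lambda>x. f x - g x) h = ip f h - ip g h"
  by (simp add: ip_def left_diff_distrib sq_integrable_mult)

lemma ip_cmult_left: "ip (\<lambda>x. a * f x) h = a * ip f h"
  by (simp add: ip_def mult.assoc)

lemma ip_divide_left: "ip (\<lambda>x. f x / a) h = ip f h / a"
  using ip_cmult_left[of "inverse a" f h] by (simp add: field_simps)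

lemma ip_sum_left: "(\<And>i. i \<in> I \<Longrightarrow> sq (f i)) \<Longrightarrow> sq h \<Longrightarrow> ip (\<lambda>x. \<Sum>i\<in>I. f i x) h = (\<Sum>i\<in>I. ip (f i) h)"
  by (simp add: ip_def sum_distrib_right sq_integrable_mult)

lemma ip_add_right: "sq f \<Longrightarrow> sq g \<Longrightarrow> sq h \<Longrightarrow> ip h (\<lambda>x. f x + g x) = ip h f + ip h g"
  unfolding ip_commute[of h] by (rule ip_add_left)

lemma ip_diff_right: "sq f \<Longrightarrow> sq g \<Longrightarrow> sq h \<Longrightarrow> ip h (\<lambda>x. f x - g x) = ip h f - ip h g"
  unfolding ip_commute[of h] by (rule ip_diff_left)

lemma ip_cmult_right: "ip h (\<lambda>x. a * f x) = a * ip h f"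
  unfolding ip_commute[of h] by (rule ip_cmult_left)

lemma ip_nonneg: "0 \<le> ip f f"
  by (simp add: ip_def)

lemma l2norm_eq: "l2norm f = sqrt (ip f f)"
  by (simp add: l2norm_def ip_def power2_eq_square)

lemma l2norm_sq: "(l2norm f)^2 = ip f f"
  by (simp add: l2norm_eq ip_nonneg)

lemma l2norm_nonneg [simp]: "0 \<le> l2norm f"
  by (simp add: l2norm_eq ip_nonneg)

lemma l2norm_cmult: "l2norm (\<lambda>x. a * f x) = \<bar>a\<bar> * l2norm f"
  by (simp add: l2norm_eq ip_cmult_left ip_cmult_right real_sqrt_mult flip: power2_eq_square mult.assoc)

lemma l2norm_divide: "l2norm (\<lambda>x. f x / a) = l2norm f / \<bar>a\<bar>"
  using l2norm_cmult[of "inverse a" f] by (simp add: field_simps)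

lemma l2norm_minus: "l2norm (\<lambda>x. - f x) = l2norm f"
  using l2norm_cmult[of "-1" f] by simp

lemma l2norm_zero [simp]: "l2norm (\<lambda>x. 0) = 0"
  by (simp add: l2norm_def)

lemma l2norm_diff_commute: "l2dist f g = l2dist g f"
  using l2norm_minus[of "\<lambda>x. f x - g x", symmetric] unfolding minus_diff_eq .

lemma ip_Cauchy_Schwarz:
  assumes "sq f" "sq g" shows "\<bar>ip f g\<bar> \<le> l2norm f * l2norm g"
proof -
  let ?a = "ip f f" let ?b = "ip f g" let ?c = "ip g g"
  have q: "0 \<le> ?a - 2 * t * ?b + t^2 * ?c" for t
  proof -
    have "0 \<le> ip (\<lambda>x. f x - t * g x) (\<lambda>x. f x - t * g x)" by (rule ip_nonneg)
    also have "\<dots> = ?a - 2 * t * ?b + t^2 * ?c"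
      using assms by (simp add: ip_diff_left ip_diff_right ip_cmult_left ip_cmult_right
          ip_commute[of g f] algebra_simps power2_eq_square)
    finally show ?thesis .
  qed
  have "?b^2 \<le> ?a * ?c"
  proof (cases "?c = 0")
    case True
    have "?b = 0"
    proof (rule ccontr)
      assume "?b \<noteq> 0"
      \<comment> \<open>For \<open>?c = 0\<close> the quadratic is the affine function
        \<open>?a - 2 * t * ?b\<close>, which equals -1 at this \<open>t\<close>.\<close>
      with q[of "(?a + 1) / (2 * ?b)"] True show False by (simp add: field_simps)
    qed
    with True show ?thesis by simp
  next
    case False
    then have c: "?c > 0" using ip_nonneg[of g] by simp
    from q[of "?b / ?c"] c have "0 \<le> ?a - ?b^2 / ?c"
      by (simp add: power2_eq_square field_simps)
    with c show ?thesis by (simp add: field_simps)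
  qed
  then have "sqrt (?b^2) \<le> sqrt (?a * ?c)" by (rule real_sqrt_le_mono)
  then show ?thesis by (simp add: l2norm_eq real_sqrt_mult)
qed

lemma ip_le: "sq f \<Longrightarrow> sq g \<Longrightarrow> ip f g \<le> l2norm f * l2norm g"
  using ip_Cauchy_Schwarz[of f g] by linarith

lemma l2norm_triangle:
  assumes "sq f" "sq g" shows "l2norm (\<lambda>x. f x + g x) \<le> l2norm f + l2norm g"
proof (rule power2_le_imp_le)
  show "(l2norm (\<lambda>x. f x + g x))^2 \<le> (l2norm f + l2norm g)^2"
    using assms ip_le[OF assms]
    by (simp add: l2norm_sq power2_sum ip_add_left ip_add_right ip_commute[of g f] mult.assoc)
qed simp

lemma l2norm_triangle_diff:
  assumes "sq f" "sq g" shows "l2dist f g \<le> l2norm f + l2norm g"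
  using l2norm_triangle[of f "\<lambda>x. - g x"] assms by (simp add: l2norm_minus)

lemma l2norm_triangle3:
  assumes "sq f" "sq g" "sq h"
  shows "l2dist f h \<le> l2dist f g + l2dist g h"
  using l2norm_triangle[of "\<lambda>x. f x - g x" "\<lambda>x. g x - h x"] assms by simp

lemma l2norm_diff_ge:
  assumes "sq f" "sq g" shows "\<bar>l2norm f - l2norm g\<bar> \<le> l2dist f g"
  using l2norm_triangle[of "\<lambda>x. f x - g x" g] l2norm_triangle[of "\<lambda>x. g x - f x" f] assms
  by (simp add: l2norm_diff_commute[of g f])

lemma l2eq_refl [simp]: "l2eq f f"
  by (simp add: l2eq_def)

lemma l2eq_sym: "l2eq f g \<Longrightarrow> l2eq g f"
  unfolding l2eq_def by (subst l2norm_diff_commute)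

lemma l2eq_trans: "l2eq f g \<Longrightarrow> l2eq g h \<Longrightarrow> sq f \<Longrightarrow> sq g \<Longrightarrow> sq h \<Longrightarrow> l2eq f h"
  using l2norm_triangle3[of f g h] l2norm_nonneg[of "\<lambda>x. f x - h x"] unfolding l2eq_def by linarith

lemma l2eq_norm: "l2eq f g \<Longrightarrow> sq f \<Longrightarrow> sq g \<Longrightarrow> l2norm f = l2norm g"
  using l2norm_diff_ge[of f g] by (simp add: l2eq_def)

lemma l2eq_add: "l2eq f f' \<Longrightarrow> l2eq g g' \<Longrightarrow> sq f \<Longrightarrow> sq f' \<Longrightarrow> sq g \<Longrightarrow> sq g' \<Longrightarrow>
   l2eq (\<lambda>x. f x + g x) (\<lambda>x. f' x + g' x)"
  using l2norm_triangle[of "\<lambda>x. f x - f' x" "\<lambda>x. g x - g' x"]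
    l2norm_nonneg[of "\<lambda>x. f x + g x - (f' x + g' x)"]
  unfolding l2eq_def by (simp add: algebra_simps)

lemma l2eq_cmult: "l2eq f f' \<Longrightarrow> l2eq (\<lambda>x. a * f x) (\<lambda>x. a * f' x)"
  using l2norm_cmult[of a "\<lambda>x. f x - f' x"] by (simp add: l2eq_def algebra_simps)

lemma l2eq_diff: "l2eq f f' \<Longrightarrow> l2eq g g' \<Longrightarrow> sq f \<Longrightarrow> sq f' \<Longrightarrow> sq g \<Longrightarrow> sq g' \<Longrightarrow>
   l2eq (\<lambda>x. f x - g x) (\<lambda>x. f' x - g' x)"
  using l2eq_add[of f f' "\<lambda>x. -1 * g x" "\<lambda>x. -1 * g' x"] l2eq_cmult[of g g' "-1"] by simp

lemma continuous_measurable_mcell: "continuous_on UNIV g \<Longrightarrow> g \<in> borel_measurable mcell"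
  for g :: "real^'d::finite \<Rightarrow> real"
  by (rule continuous_imp_measurable_on_sets_lebesgue) (auto intro: continuous_on_subset)

lemma continuous_bounded_cell:
  fixes g :: "real^'d::finite \<Rightarrow> real"
  assumes "continuous_on UNIV g" shows "\<exists>B. \<forall>x\<in>cell. \<bar>g x\<bar> \<le> B"
proof -
  have "compact (g ` cell)"
    using assms by (intro compact_continuous_image) (auto simp: cell_def intro: continuous_on_subset)
  then show ?thesis by (auto dest!: compact_imp_bounded simp: bounded_iff)
qed

lemma AE_mcell_I: "(\<And>x. x \<in> cell \<Longrightarrow> P x) \<Longrightarrow> AE x in mcell. P x"
  by (rule AE_I2) simp

lemma sq_mult_bounded:
  assumes g: "g \<in> borel_measurable mcell" and B: "\<forall>x\<in>cell. \<bar>g x\<bar> \<le> B" and f: "sq f"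
  shows "sq (\<lambda>x. g x * f x)" "l2norm (\<lambda>x. g x * f x) \<le> B * l2norm f"
proof -
  have B0: "0 \<le> B" using B[rule_format, of 0] by (auto simp: cell_def mem_box)
  have le: "(g x * f x)^2 \<le> B^2 * (f x)^2" if "x \<in> cell" for x
  proof -
    have "(g x)^2 \<le> B^2" using B that B0 by (simp add: abs_le_square_iff[symmetric])
    then show ?thesis by (simp add: power_mult_distrib mult_right_mono)
  qed
  have i: "integrable mcell (\<lambda>x. B^2 * (f x)^2)" using f by (simp add: sq_def)
  have m: "(\<lambda>x. g x * f x) \<in> borel_measurable mcell" using f g by (auto simp: sq_def)
  have i2: "integrable mcell (\<lambda>x. (g x * f x)^2)"
    by (rule Bochner_Integration.integrable_bound[OF i]) (use m le in \<open>auto intro!: AE_mcell_I\<close>)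
  then show "sq (\<lambda>x. g x * f x)" using m by (auto simp: sq_def)
  have "(l2norm (\<lambda>x. g x * f x))^2 \<le> (B * l2norm f)^2"
    unfolding l2norm_sq power_mult_distrib ip_def power2_eq_square[symmetric]
    using integral_mono_AE[OF i2 i] le by (auto intro!: AE_mcell_I simp: power_mult_distrib)
  then show "l2norm (\<lambda>x. g x * f x) \<le> B * l2norm f"
    by (rule power2_le_imp_le) (use B0 in simp)
qed

lemma sq_mult_continuous:
  assumes "continuous_on UNIV g" "sq f" shows "sq (\<lambda>x. g x * f x)"
  using continuous_bounded_cell[OF assms(1)] sq_mult_bounded(1)[OF continuous_measurable_mcell[OF assms(1)]] assms(2)
  by blast

lemma sq_continuous: "continuous_on UNIV g \<Longrightarrow> sq g"
  using sq_mult_continuous[of g "\<lambda>_. 1"] by simp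

lemma integrable_sq: "sq f \<Longrightarrow> integrable mcell f"
  using sq_integrable_mult[of f "\<lambda>_. 1"] by simp

section \<open>Completeness and uniform boundedness\<close>

lemma integral_le_l2norm:
  fixes f :: "('d::finite) fn"
  assumes "sq f" shows "integral\<^sup>L mcell f \<le> l2norm f"
proof -
  have "ip f (\<lambda>_. 1) \<le> l2norm f * l2norm (\<lambda>_::real^'d. 1)" using assms by (intro ip_le) auto
  moreover have "l2norm (\<lambda>_::real^'d. 1) = 1"
    using measure_mcell_space by (simp add: l2norm_def)
  ultimately show ?thesis by (simp add: ip_def)
qed

lemma sq_abs [simp, intro]: "sq f \<Longrightarrow> sq (\<lambda>x. \<bar>f x\<bar>)"
  by (auto simp: sq_def)

lemma l2norm_abs [simp]: "l2norm (\<lambda>x. \<bar>f x\<bar>) = l2norm f"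
  by (simp add: l2norm_def)

text \<open>On a cell of measure 1 the L1 norm is at most the L2 norm, so by monotone convergence
  the sum of the \<open>\<bar>d j\<bar>\<close> has a finite integral and is finite almost
  everywhere.\<close>

lemma AE_summable_increments:
  assumes d: "\<And>j. sq (d j)" and le: "\<And>j. l2norm (d j) \<le> a j" and a: "summable a"
  shows "AE t in mcell. summable (\<lambda>j. \<bar>d j t\<bar>)"
proof -
  have m: "\<And>j. d j \<in> borel_measurable mcell" using d by (auto simp: sq_def)
  have a0: "0 \<le> a j" for j using le[of j] l2norm_nonneg[of "d j"] by linarith
  have "(\<integral>\<^sup>+t. (\<Sum>j. ennreal \<bar>d j t\<bar>) \<partial>mcell) = (\<Sum>j. \<integral>\<^sup>+t. ennreal \<bar>d j t\<bar> \<partial>mcell)"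
    by (rule nn_integral_suminf) (use m in measurable)
  also have "\<dots> = (\<Sum>j. ennreal (integral\<^sup>L mcell (\<lambda>t. \<bar>d j t\<bar>)))"
    using d by (intro suminf_cong nn_integral_eq_integral integrable_sq) auto
  also have "\<dots> \<le> (\<Sum>j. ennreal (a j))"
  proof (intro suminf_le ennreal_leI allI)
    fix j show "integral\<^sup>L mcell (\<lambda>t. \<bar>d j t\<bar>) \<le> a j"
      using integral_le_l2norm[of "\<lambda>t. \<bar>d j t\<bar>"] d[of j] le[of j] by simp
  qed auto
  also have "\<dots> = ennreal (\<Sum>j. a j)" using a a0 by (intro suminf_ennreal2) auto
  finally have "(\<integral>\<^sup>+t. (\<Sum>j. ennreal \<bar>d j t\<bar>) \<partial>mcell) \<noteq> \<infinity>"
    by (auto simp: top_unique)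
  then have "AE t in mcell. (\<Sum>j. ennreal \<bar>d j t\<bar>) \<noteq> \<infinity>"
    by (intro nn_integral_PInf_AE) (use m in measurable)
  then show ?thesis
    by eventually_elim (auto intro: summable_suminf_not_top)
qed

lemma L2_complete:
  assumes x: "\<And>n. x n \<in> L2" and inc: "\<And>n. l2dist (x (Suc n)) (x n) \<le> a n"
    and a: "summable a"
  shows "\<exists>y\<in>L2. \<forall>n. l2dist (x n) y \<le> (\<Sum>k. a (k + n))"
proof -
  \<comment> \<open>\<open>lim\<close> is total, so \<open>y\<close> is periodic at every point,
    including those where the sequence diverges, and not merely almost everywhere.\<close>
  define y where "y t = lim (\<lambda>n. x n t)" for t
  have sx: "sq (x n)" for n using x by auto
  have mx [measurable]: "x n \<in> borel_measurable mcell" for n using sx[of n] by (simp add: sq_def)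
  have my [measurable]: "y \<in> borel_measurable mcell"
    unfolding y_def by (rule borel_measurable_lim_metric) simp
  have py: "periodic_fn y"
    using x by (simp add: periodic_fn_def y_def L2_iff)
  have a0: "0 \<le> a j" for j using inc[of j] l2norm_nonneg order_trans by blast
  have "AE t in mcell. summable (\<lambda>j. \<bar>x (Suc j) t - x j t\<bar>)"
    using sx inc a by (intro AE_summable_increments[where a = a]) auto
  then have conv: "AE t in mcell. (\<lambda>n. x n t) \<longlonglongrightarrow> y t"
  proof eventually_elim
    fix t assume "summable (\<lambda>j. \<bar>x (Suc j) t - x j t\<bar>)"
    then have "summable (\<lambda>j. x (Suc j) t - x j t)" by (rule summable_rabs_cancel)
    then have "convergent (\<lambda>n. \<Sum>j<n. x (Suc j) t - x j t)"
      by (simp add: summable_iff_convergent)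
    then have "convergent (\<lambda>n. x n t - x 0 t)" using sum_lessThan_telescope[of "\<lambda>n. x n t"] by simp
    then have "convergent (\<lambda>n. (x n t - x 0 t) + x 0 t)" by (intro convergent_add convergent_const)
    then show "(\<lambda>n. x n t) \<longlonglongrightarrow> y t" by (simp add: y_def convergent_LIMSEQ_iff)
  qed
  have fin: "l2dist (x n) (x (n + m)) \<le> (\<Sum>k<m. a (k + n))" for n m
  proof (induction m)
    case (Suc m)
    have "l2dist (x n) (x (n + Suc m)) \<le> l2dist (x n) (x (n + m)) +
        l2dist (x (n + m)) (x (n + Suc m))" using sx by (intro l2norm_triangle3)
    with Suc inc[of "n + m"] show ?case
      by (simp add: l2norm_diff_commute[of "x (m + n)"] add.commute)
  qed simp
  \<comment> \<open>Fatou's lemma: the distance of \<open>x n\<close> to the limit is at most the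
    lower limit of its distances to \<open>x (n + m)\<close>, which \<open>fin\<close> bounds by the
    tail sum. The integral is the nonnegative one because square integrability of \<open>y\<close>
    is a consequence.\<close>
  have nn: "(\<integral>\<^sup>+t. ennreal ((x n t - y t)^2) \<partial>mcell) \<le> ennreal ((\<Sum>k. a (k + n))^2)" for n
  proof -
    define R where "R = (\<Sum>k. a (k + n))"
    have sa: "summable (\<lambda>k. a (k + n))" using a by (simp add: summable_iff_shift)
    have R: "l2dist (x n) (x (n + m)) \<le> R" for m
      using fin[of n m] sum_le_suminf[OF sa, of "{..<m}"] a0 unfolding R_def by force
    have "(\<integral>\<^sup>+t. ennreal ((x n t - y t)^2) \<partial>mcell)
       = (\<integral>\<^sup>+t. liminf (\<lambda>m. ennreal ((x n t - x (n + m) t)^2)) \<partial>mcell)"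
    proof (rule nn_integral_cong_AE, use conv in eventually_elim)
      fix t assume "(\<lambda>n. x n t) \<longlonglongrightarrow> y t"
      then have "(\<lambda>m. x (n + m) t) \<longlonglongrightarrow> y t"
        by (subst add.commute) (rule LIMSEQ_ignore_initial_segment)
      then have "(\<lambda>m. ennreal ((x n t - x (n + m) t)^2)) \<longlonglongrightarrow> ennreal ((x n t - y t)^2)"
        by (intro tendsto_intros)
      then show "ennreal ((x n t - y t)^2) = liminf (\<lambda>m. ennreal ((x n t - x (n + m) t)^2))"
        by (intro lim_imp_Liminf[symmetric]) auto
    qed
    also have "\<dots> \<le> liminf (\<lambda>m. \<integral>\<^sup>+t. ennreal ((x n t - x (n + m) t)^2) \<partial>mcell)"
      by (rule nn_integral_liminf) simp
    also have "\<dots> \<le> ennreal (R^2)"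
    proof (rule Liminf_le)
      show "\<forall>\<^sub>F m in sequentially. (\<integral>\<^sup>+t. ennreal ((x n t - x (n + m) t)^2) \<partial>mcell) \<le> ennreal (R^2)"
      proof (intro always_eventually allI)
        fix m
        have s: "sq (\<lambda>t. x n t - x (n + m) t)" using sx by auto
        have "(l2dist (x n) (x (n + m)))^2 \<le> R^2" using R by (intro power_mono) auto
        moreover have "(\<integral>\<^sup>+t. ennreal ((x n t - x (n + m) t)^2) \<partial>mcell) =
          ennreal ((l2dist (x n) (x (n + m)))^2)"
          unfolding l2norm_sq ip_def power2_eq_square[symmetric]
          using s by (intro nn_integral_eq_integral) (auto simp: sq_def)
        ultimately show "(\<integral>\<^sup>+t. ennreal ((x n t - x (n + m) t)^2) \<partial>mcell) \<le> ennreal (R^2)"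
          by (simp add: ennreal_leI)
      qed
    qed simp
    finally show ?thesis by (simp add: R_def)
  qed
  have i: "integrable mcell (\<lambda>t. (x n t - y t)^2)" for n
    by (rule integrableI_bounded) (use nn[of n] in \<open>auto simp: le_less_trans\<close>)
  then have s: "sq (\<lambda>t. x n t - y t)" for n by (simp add: sq_def)
  have "sq y" using sq_diff[OF sx[of 0] s[of 0]] by (simp del: sq_diff)
  then have "y \<in> L2" using py by (intro L2_I)
  moreover have "l2dist (x n) y \<le> (\<Sum>k. a (k + n))" for n
  proof (rule power2_le_imp_le)
    have "ennreal ((l2dist (x n) y)^2) \<le> ennreal ((\<Sum>k. a (k + n))^2)"
      using nn[of n] unfolding l2norm_sq ip_def power2_eq_square[symmetric]
      by (subst (asm) nn_integral_eq_integral[OF i]) auto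
    then show "(l2dist (x n) y)^2 \<le> (\<Sum>k. a (k + n))^2"
      by (simp add: ennreal_le_iff)
    show "0 \<le> (\<Sum>k. a (k + n))" using a a0 by (intro suminf_nonneg) (auto simp: summable_iff_shift)
  qed
  ultimately show ?thesis by blast
qed

section \<open>Bounded operators up to null sets, and the operator norm\<close>

lemma bounded_opD:
  assumes "bounded_op P"
  shows bounded_op_L2: "f \<in> L2 \<Longrightarrow> P f \<in> L2"
    and bounded_op_l2eq: "f \<in> L2 \<Longrightarrow> g \<in> L2 \<Longrightarrow> l2eq f g \<Longrightarrow> l2eq (P f) (P g)"
    and bounded_op_lin: "f \<in> L2 \<Longrightarrow> g \<in> L2 \<Longrightarrow> l2eq (P (\<lambda>x. a * f x + g x)) (\<lambda>x. a * P f x + P g x)"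
  using assms by (auto simp: bounded_op_def)

lemma bounded_op_diff:
  assumes "bounded_op P" "f \<in> L2" "g \<in> L2" shows "l2eq (P (\<lambda>x. f x - g x)) (\<lambda>x. P f x - P g x)"
  using bounded_op_lin[OF assms(1,3,2), of "-1"] by (simp add: algebra_simps)

lemma bounded_op_zero:
  assumes "bounded_op P" shows "l2norm (P (\<lambda>x. 0)) = 0"
proof -
  obtain B where "\<forall>f\<in>L2. l2norm (P f) \<le> B * l2norm f" using assms by (auto simp: bounded_op_def)
  from this[rule_format, of "\<lambda>_. 0"] show ?thesis
    using l2norm_nonneg[of "P (\<lambda>x. 0)"] by (simp add: order_antisym)
qed

lemma bounded_op_cmult:
  assumes "bounded_op P" "f \<in> L2" shows "l2eq (P (\<lambda>x. a * f x)) (\<lambda>x. a * P f x)"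
proof -
  have m: "P (\<lambda>x. a * f x) \<in> L2" "P f \<in> L2" "P (\<lambda>x. 0) \<in> L2"
    using assms by (auto intro: bounded_op_L2)
  have "l2eq (P (\<lambda>x. a * f x + 0)) (\<lambda>x. a * P f x + P (\<lambda>x. 0) x)"
    using assms by (intro bounded_op_lin) auto
  moreover have "l2eq (\<lambda>x. a * P f x + P (\<lambda>x. 0) x) (\<lambda>x. a * P f x + 0)"
    using m bounded_op_zero[OF assms(1)] by (intro l2eq_add) (auto simp: l2eq_def)
  ultimately show ?thesis using m by (auto intro: l2eq_trans)
qed

lemma bounded_op_norm_cmult:
  assumes "bounded_op P" "f \<in> L2" shows "l2norm (P (\<lambda>x. a * f x)) = \<bar>a\<bar> * l2norm (P f)"
proof -
  have "P (\<lambda>x. a * f x) \<in> L2" "P f \<in> L2" using assms by (auto intro: bounded_op_L2)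
  then show ?thesis using l2eq_norm[OF bounded_op_cmult[OF assms, of a]] by (auto simp: l2norm_cmult)
qed

lemma bounded_op_norm_diff:
  assumes "bounded_op P" "f \<in> L2" "g \<in> L2"
  shows "l2dist (P f) (P g) = l2norm (P (\<lambda>x. f x - g x))"
  using l2eq_norm[OF bounded_op_diff[OF assms]] assms bounded_op_L2[OF assms(1)] by auto

lemma opnorm_set:
  assumes "bounded_op P"
  shows "bdd_above {l2norm (P f) | f. f \<in> L2 \<and> l2norm f \<le> 1}"
    and "{l2norm (P f) | f. f \<in> L2 \<and> l2norm f \<le> 1} \<noteq> {}"
proof -
  obtain B where B: "\<forall>f\<in>L2. l2norm (P f) \<le> B * l2norm f" using assms by (auto simp: bounded_op_def)
  have "l2norm (P f) \<le> \<bar>B\<bar>" if "f \<in> L2" "l2norm f \<le> 1" for f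
  proof -
    have "B * l2norm f \<le> \<bar>B\<bar> * 1" using that(2) by (intro mult_mono) auto
    with B that(1) show ?thesis by force
  qed
  then show "bdd_above {l2norm (P f) | f. f \<in> L2 \<and> l2norm f \<le> 1}" by (auto intro!: bdd_aboveI)
  have "(\<lambda>_. 0) \<in> L2" "l2norm (\<lambda>_::real^'a. 0) \<le> 1" by auto
  then show "{l2norm (P f) | f. f \<in> L2 \<and> l2norm f \<le> 1} \<noteq> {}" by blast
qed

lemma opnorm_nonneg: assumes "bounded_op P" shows "0 \<le> opnorm P"
proof -
  have "l2norm (P (\<lambda>_. 0)) \<le> opnorm P" unfolding opnorm_def
    by (rule cSup_upper[OF _ opnorm_set(1)[OF assms]]) (auto intro!: exI[of _ "\<lambda>_. 0"])
  then show ?thesis using l2norm_nonneg[of "P (\<lambda>_. 0)"] by linarith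
qed

lemma opnorm_bound:
  assumes P: "bounded_op P" and f: "f \<in> L2" shows "l2norm (P f) \<le> opnorm P * l2norm f"
proof (cases "l2norm f = 0")
  case True
  \<comment> \<open>A function of norm 0 need not vanish pointwise, so this case rests on the
    compatibility of \<open>P\<close> with \<open>l2eq\<close>.\<close>
  have "l2eq (P f) (P (\<lambda>_. 0))" by (rule bounded_op_l2eq[OF P f L2_const]) (use True in \<open>simp add: l2eq_def\<close>)
  then have "l2norm (P f) = l2norm (P (\<lambda>_. 0))"
    by (rule l2eq_norm) (use f in \<open>auto intro: bounded_op_L2[OF P]\<close>)
  then have "l2norm (P f) = 0" using bounded_op_zero[OF P] by simp
  with True show ?thesis by simp
next
  case False
  then have pos: "l2norm f > 0" using l2norm_nonneg[of f] by linarith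
  let ?g = "\<lambda>x. (1 / l2norm f) * f x"
  have "l2norm (P ?g) \<le> opnorm P" unfolding opnorm_def
  proof (rule cSup_upper[OF _ opnorm_set(1)[OF P]])
    have "?g \<in> L2" "l2norm ?g \<le> 1" using f pos by (simp_all only: L2_cmult l2norm_cmult) simp
    then show "l2norm (P ?g) \<in> {l2norm (P f) |f. f \<in> L2 \<and> l2norm f \<le> 1}" by blast
  qed
  then have "l2norm (P f) / l2norm f \<le> opnorm P"
    using bounded_op_norm_cmult[OF P f, of "1 / l2norm f"] pos by simp
  then show ?thesis using pos by (simp add: pos_divide_le_eq)
qed

lemma opnorm_le:
  assumes "\<And>f. f \<in> L2 \<Longrightarrow> l2norm f \<le> 1 \<Longrightarrow> l2norm (P f) \<le> C" shows "opnorm P \<le> C"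
  unfolding opnorm_def
proof (rule cSup_least)
  have "(\<lambda>_. 0) \<in> L2" "l2norm (\<lambda>_::real^'a. 0) \<le> 1" by auto
  then show "{l2norm (P f) | f. f \<in> L2 \<and> l2norm f \<le> 1} \<noteq> {}" by blast
qed (use assms in auto)

text \<open>Since \<open>2 * r * P f\<close> is the difference of the values of \<open>P\<close> at
  \<open>x + r f\<close> and \<open>x - r f\<close>, one of these values has norm at least
  \<open>r * l2norm (P f)\<close>; \<open>f\<close> is a unit vector that nearly attains the norm.
  The factor 2/3 leaves room for the supremum not being attained.\<close>

lemma exists_large_near:
  assumes P: "bounded_op P" and x: "x \<in> L2" and r: "r > 0"
  shows "\<exists>y\<in>L2. l2dist y x \<le> r \<and> r * (2/3 * opnorm P) \<le> l2norm (P y)"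
proof (cases "opnorm P = 0")
  case True
  then show ?thesis using x r by (intro bexI[of _ x]) auto
next
  case False
  then have "2/3 * opnorm P < opnorm P" using opnorm_nonneg[OF P] by simp
  then obtain f where f: "f \<in> L2" "l2norm f \<le> 1" "2/3 * opnorm P < l2norm (P f)"
    using less_cSup_iff[OF opnorm_set(2,1)[OF P], of "2/3 * opnorm P"]
    unfolding opnorm_def[symmetric] by auto
  let ?u = "\<lambda>t. r * f t + x t" and ?v = "\<lambda>t. (-r) * f t + x t"
  have L: "?u \<in> L2" "?v \<in> L2" "P ?u \<in> L2" "P ?v \<in> L2" "P f \<in> L2"
    using f x by (auto intro!: bounded_op_L2[OF P])
  have "2 * r * l2norm (P f) = l2norm (P (\<lambda>t. (2 * r) * f t))"
    using bounded_op_norm_cmult[OF P f(1), of "2 * r"] r by simp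
  also have "(\<lambda>t. (2 * r) * f t) = (\<lambda>t. ?u t - ?v t)" by auto
  also have "l2norm (P \<dots>) = l2dist (P ?u) (P ?v)"
    using bounded_op_norm_diff[OF P L(1,2)] by simp
  also have "\<dots> \<le> l2norm (P ?u) + l2norm (P ?v)"
    using L by (intro l2norm_triangle_diff) auto
  finally have "r * l2norm (P f) \<le> l2norm (P ?u) \<or> r * l2norm (P f) \<le> l2norm (P ?v)" by linarith
  moreover have "l2dist ?u x \<le> r" "l2dist ?v x \<le> r"
    using f(2) r l2norm_cmult[of r f] l2norm_cmult[of "-r" f] by (auto simp: mult_left_le)
  moreover have "r * (2/3 * opnorm P) \<le> r * l2norm (P f)" using f(3) r by (intro mult_left_mono) auto
  ultimately have "(l2dist ?u x \<le> r \<and> r * (2/3 * opnorm P) \<le> l2norm (P ?u)) \<or>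
      (l2dist ?v x \<le> r \<and> r * (2/3 * opnorm P) \<le> l2norm (P ?v))" by linarith
  then show ?thesis
    by (elim disjE) (rule bexI[OF _ L(1)], assumption, rule bexI[OF _ L(2)], assumption)
qed

text \<open>The gliding hump of Sokal's proof: $x_{k+1}$ is chosen within $3^{-k}$ of $x_k$ so that the
  $k$-th operator, of norm at least $4^k$, is large there; the tail of the sequence moves the limit
  by at most $\frac12 3^{-k}$.\<close>

lemma uniform_boundedness:
  assumes P: "\<And>n::nat. bounded_op (P n)" and pw: "\<And>f. f \<in> L2 \<Longrightarrow> \<exists>B. \<forall>n. l2norm (P n f) \<le> B"
  shows "\<exists>B. \<forall>n. opnorm (P n) \<le> B"
proof (rule ccontr)
  assume "\<not> ?thesis"
  then have "\<forall>k::nat. \<exists>n. 4 ^ k \<le> opnorm (P n)" by (meson less_eq_real_def linorder_not_le)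
  then obtain N where N: "\<And>k::nat. 4 ^ k \<le> opnorm (P (N k))" by metis
  define r :: "nat \<Rightarrow> real" where "r k = (1/3) ^ k" for k
  have "\<exists>F. \<forall>k x. x \<in> L2 \<longrightarrow> F k x \<in> L2 \<and> l2dist (F k x) x \<le> r k \<and>
      r k * (2/3 * opnorm (P (N k))) \<le> l2norm (P (N k) (F k x))"
  proof (intro choice allI)
    fix k x
    show "\<exists>y. x \<in> L2 \<longrightarrow> y \<in> L2 \<and> l2dist y x \<le> r k \<and>
      r k * (2/3 * opnorm (P (N k))) \<le> l2norm (P (N k) y)"
      using exists_large_near[OF P[of "N k"], of x "r k"] by (auto simp: r_def)
  qed
  then obtain F where F: "\<And>k x. x \<in> L2 \<Longrightarrow> F k x \<in> L2"
    "\<And>k x. x \<in> L2 \<Longrightarrow> l2dist (F k x) x \<le> r k"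
    "\<And>k x. x \<in> L2 \<Longrightarrow> r k * (2/3 * opnorm (P (N k))) \<le> l2norm (P (N k) (F k x))" by blast
  define X where "X = rec_nat (\<lambda>_. 0) F"
  have X: "X n \<in> L2" for n by (induction n) (auto simp: X_def F(1))
  have XS: "X (Suc k) = F k (X k)" for k by (simp add: X_def)
  have sr: "summable r" unfolding r_def by (rule summable_geometric) simp
  obtain y where y: "y \<in> L2" "\<And>n. l2dist (X n) y \<le> (\<Sum>k. r (k + n))"
    using L2_complete[where x = X and a = r, OF X] F(2)[OF X] sr by (auto simp: XS)
  have tail: "(\<Sum>k. r (k + Suc n)) = r n / 2" for n
  proof -
    have "(\<lambda>k. (1/3) ^ k * (1/3 * r n)) sums (1 / (1 - 1/3) * (1/3 * r n))"
      by (intro sums_mult2 geometric_sums) simp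
    moreover have "(\<lambda>k. (1/3) ^ k * (1/3 * r n)) = (\<lambda>k. r (k + Suc n))"
      by (auto simp: r_def power_add)
    ultimately show ?thesis by (simp add: sums_iff)
  qed
  obtain B where B: "\<And>n. l2norm (P n y) \<le> B" using pw[OF y(1)] by auto
  \<comment> \<open>The value at \<open>X (Suc k)\<close> is at least 2/3 of
    \<open>r k * opnorm\<close>, and passing to the limit costs at most 1/2 of it; the remaining 1/6
    is the origin of the factor 6.\<close>
  have "(4/3) ^ k \<le> 6 * B" for k
  proof -
    let ?Q = "P (N k)" let ?O = "opnorm (P (N k))"
    have L: "?Q (X (Suc k)) \<in> L2" "?Q y \<in> L2" using X y(1) by (auto intro!: bounded_op_L2[OF P])
    have "r k * (2/3 * ?O) \<le> l2norm (?Q (X (Suc k)))" using F(3)[OF X[of k], of k] by (simp add: XS)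
    also have "\<dots> \<le> l2dist (?Q (X (Suc k))) (?Q y) + l2norm (?Q y)"
      using l2norm_triangle[of "\<lambda>t. ?Q (X (Suc k)) t - ?Q y t" "?Q y"] L by auto
    also have "l2dist (?Q (X (Suc k))) (?Q y) \<le> ?O * l2dist (X (Suc k)) y"
      unfolding bounded_op_norm_diff[OF P X y(1)] using X y(1) by (intro opnorm_bound P) auto
    also have "\<dots> \<le> ?O * (r k / 2)"
      using y(2)[of "Suc k", unfolded tail] by (intro mult_left_mono opnorm_nonneg[OF P])
    finally have "r k * ?O \<le> 6 * B" using B[of "N k"] by (simp add: field_simps)
    moreover have "r k * 4 ^ k \<le> r k * ?O" using N by (intro mult_left_mono) (auto simp: r_def)
    ultimately show ?thesis by (simp add: r_def power_divide)
  qed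
  moreover obtain k where "6 * B < (4/3) ^ k" using real_arch_pow[of "4/3" "6 * B"] by auto
  ultimately show False by (meson linorder_not_le)
qed

section \<open>Gronwall with right derivatives\<close>

text \<open>Generators are seen only through right difference quotients, so the mean value theorem
  does not apply. Instead, the last point at which \<open>f\<close> lies below a line of slope
  \<open>e > 0\<close> must be \<open>b\<close>, because a right derivative below \<open>e\<close>
  would carry the property further.\<close>

lemma right_derivative_nonpos_le:
  fixes f :: "real \<Rightarrow> real"
  assumes ab: "a \<le> b" and cont: "continuous_on {a..b} f"
    and der: "\<And>x. a < x \<Longrightarrow> x < b \<Longrightarrow> \<exists>D\<le>0. (f has_real_derivative D) (at_right x)"
  shows "f b \<le> f a"
proof (cases "a = b")
  case False
  with ab have ab: "a < b" by simp
  have claim: "f b \<le> f a' + e * (b - a')" if a': "a < a'" "a' < b" and e: "e > 0" for a' e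
  proof (rule ccontr)
    assume neg: "\<not> ?thesis"
    \<comment> \<open>The line starts at an interior point \<open>a'\<close> because derivatives are
      assumed only in the open interval; \<open>a'\<close> tends to \<open>a\<close> at the end.
      This is what evolution families need, being differentiable only after the initial
      time.\<close>
    define S where "S = {x \<in> {a'..b}. f x - e * x \<le> f a' - e * a'}"
    have "continuous_on {a'..b} (\<lambda>x. f x - e * x)"
      using cont a' by (intro continuous_intros) (auto intro: continuous_on_subset)
    then have "closed S" unfolding S_def by (intro continuous_on_closed_Collect_le) auto
    moreover have "bounded S" unfolding S_def by (rule bounded_subset[of "{a'..b}"]) auto
    ultimately have "compact S" by (simp add: compact_eq_bounded_closed)
    moreover have "a' \<in> S" using a' by (auto simp: S_def)
    ultimately obtain m where m: "m \<in> S" "\<And>x. x \<in> S \<Longrightarrow> x \<le> m"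
      using compact_attains_sup[of S] by auto
    have mb: "m < b" using m(1) neg by (auto simp: S_def algebra_simps order.order_iff_strict)
    have am: "a < m" using m(1) a' by (auto simp: S_def)
    obtain D where D: "D \<le> 0" "(f has_real_derivative D) (at_right m)" using der[OF am mb] by auto
    then have "((\<lambda>y. (f y - f m) / (y - m)) \<longlongrightarrow> D) (at_right m)"
      by (simp add: has_field_derivative_iff)
    then have "\<forall>\<^sub>F y in at_right m. (f y - f m) / (y - m) < e"
      using D e by (intro order_tendstoD(2)[where y = D]) auto
    moreover have "\<forall>\<^sub>F y in at_right m. y < b" using eventually_at_right_real[OF mb] by eventually_elim auto
    moreover have "\<forall>\<^sub>F y in at_right m. m < y" by (rule eventually_at_right_less)
    ultimately have "\<forall>\<^sub>F y in at_right m. y \<in> S \<and> m < y"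
    proof eventually_elim
      case (elim y)
      then have "f y - f m < e * (y - m)" by (simp add: field_simps)
      then show ?case using elim m(1) by (auto simp: S_def algebra_simps)
    qed
    then obtain y where "y \<in> S" "m < y" using eventually_happens' trivial_limit_at_right_real by blast
    with m(2) show False by force
  qed
  have claim2: "f b \<le> f a'" if a': "a < a'" "a' < b" for a'
  proof (rule field_le_epsilon)
    fix e :: real assume "e > 0"
    then show "f b \<le> f a' + e" using claim[OF a', of "e / (b - a')"] a' by simp
  qed
  have "(f \<longlongrightarrow> f a) (at_right a)"
    using cont ab by (simp add: continuous_on_Icc_at_rightD)
  moreover have "\<forall>\<^sub>F y in at_right a. f b \<le> f y"
    using ab claim2 by (auto simp: eventually_at_right_field)
  ultimately show ?thesis by (intro tendsto_lowerbound[OF _ _ trivial_limit_at_right_real])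
qed simp

lemma gronwall_right:
  fixes f :: "real \<Rightarrow> real"
  assumes ab: "a \<le> b" and cont: "continuous_on {a..b} f" and K: "0 \<le> K" and M: "0 \<le> M"
    and der: "\<And>x. a < x \<Longrightarrow> x < b \<Longrightarrow>
      \<exists>D. (f has_real_derivative D) (at_right x) \<and> D \<le> K * f x + M"
  shows "f b \<le> exp (K * (b - a)) * (f a + M * (b - a))"
proof -
  \<comment> \<open>The integrating factor removes \<open>K * f\<close>. It is at most 1 to the
    right of \<open>a\<close>, so the source it multiplies is still bounded by \<open>M\<close> and
    is compensated by the linear term.\<close>
  define g where "g x = exp (- K * (x - a)) * f x - M * (x - a)" for x
  have "g b \<le> g a"
  proof (rule right_derivative_nonpos_le[OF ab])
    show "continuous_on {a..b} g" unfolding g_def using cont by (intro continuous_intros)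
    fix x assume x: "a < x" "x < b"
    then obtain D where D: "(f has_real_derivative D) (at_right x)" "D \<le> K * f x + M"
      using der by blast
    let ?E = "exp (- K * (x - a))"
    have "(g has_real_derivative (- K * ?E * f x + ?E * D - M)) (at_right x)"
      unfolding g_def by (rule derivative_eq_intros D refl | simp)+
    moreover have "- K * ?E * f x + ?E * D - M \<le> 0"
    proof -
      have "?E * (D - K * f x) \<le> ?E * M" using D(2) by (intro mult_left_mono) auto
      also have "\<dots> \<le> 1 * M" using M K x by (intro mult_right_mono) auto
      finally have "?E * (D - K * f x) \<le> M" by simp
      then show ?thesis by (simp add: algebra_simps)
    qed
    ultimately show "\<exists>D\<le>0. (g has_real_derivative D) (at_right x)" by blast
  qed
  then have "exp (- K * (b - a)) * f b \<le> f a + M * (b - a)" by (simp add: g_def)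
  then have "exp (K * (b - a)) * (exp (- K * (b - a)) * f b) \<le> exp (K * (b - a)) * (f a + M * (b - a))"
    by (intro mult_left_mono) auto
  then show ?thesis by (simp only: mult.assoc[symmetric] exp_add[symmetric]) simp
qed

section \<open>Smooth periodic functions\<close>

text \<open>\<open>pd\<close> has a value whether or not the derivative exists; the calculus rules
  are proved for this relation, which includes existence, and transferred by
  \<open>has_pd_pd\<close>.\<close>

definition has_pd :: "'d \<Rightarrow> ('d::finite) fn \<Rightarrow> real^'d \<Rightarrow> real \<Rightarrow> bool" where
  "has_pd i f x D \<longleftrightarrow> ((\<lambda>h. f (x + h *\<^sub>R axis i 1)) has_real_derivative D) (at 0)"

lemma has_pd_pd: "has_pd i f x D \<Longrightarrow> pd i f x = D"
  by (simp add: has_pd_def pd_def DERIV_imp_deriv)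

lemma has_pd_add: "has_pd i f x D \<Longrightarrow> has_pd i g x E \<Longrightarrow> has_pd i (\<lambda>x. f x + g x) x (D + E)"
  unfolding has_pd_def by (rule DERIV_add)

lemma has_pd_mult:
  "has_pd i f x D \<Longrightarrow> has_pd i g x E \<Longrightarrow> has_pd i (\<lambda>x. f x * g x) x (D * g x + E * f x)"
  unfolding has_pd_def by (drule (1) DERIV_mult) simp

lemma dlist_snoc: "dlist (is @ [i]) f = dlist is (pd i f)"
  by (induction "is") auto

lemma smooth_has_pd: "smooth_fn f \<Longrightarrow> has_pd i f x (pd i f x)"
  unfolding smooth_fn_def has_pd_def pd_def
  by (metis DERIV_deriv_iff_real_differentiable dlist.simps(1))

lemma smooth_continuous: "smooth_fn f \<Longrightarrow> continuous_on UNIV f"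
  unfolding smooth_fn_def by (metis dlist.simps(1))

lemma smooth_pd: "smooth_fn f \<Longrightarrow> smooth_fn (pd i f)"
  unfolding smooth_fn_def dlist_snoc[symmetric] by blast

text \<open>\<open>smooth_fn\<close> is the greatest class of continuous functions that have all
  partial derivatives and is closed under taking them. Exhibiting a closed class \<open>Q\<close>
  replaces a formula for iterated derivatives.\<close>

lemma smooth_coinduct:
  assumes "Q f"
    and step: "\<And>f. Q f \<Longrightarrow> continuous_on UNIV f \<and> (\<forall>i x. \<exists>D. has_pd i f x D) \<and> (\<forall>i. Q (pd i f))"
  shows "smooth_fn f"
proof -
  have Q: "Q (dlist is f)" for "is" by (induction "is") (use assms in auto)
  show ?thesis unfolding smooth_fn_def
    using step[OF Q] by (auto simp: has_pd_def real_differentiable_def)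
qed

text \<open>The derivative of a product is a sum of products, so products of smooth functions do not
  form a closed class for \<open>smooth_coinduct\<close>; the algebra generated by the smooth
  functions does.\<close>

inductive smooth_alg :: "('d::finite) fn \<Rightarrow> bool" where
  base: "smooth_fn f \<Longrightarrow> smooth_alg f"
| add: "smooth_alg f \<Longrightarrow> smooth_alg g \<Longrightarrow> smooth_alg (\<lambda>x. f x + g x)"
| mult: "smooth_alg f \<Longrightarrow> smooth_alg g \<Longrightarrow> smooth_alg (\<lambda>x. f x * g x)"

lemma smooth_alg_step:
  "smooth_alg f \<Longrightarrow> continuous_on UNIV f \<and> (\<forall>i x. has_pd i f x (pd i f x)) \<and> (\<forall>i. smooth_alg (pd i f))"
proof (induction rule: smooth_alg.induct)
  case (base f)
  then show ?case by (auto simp: smooth_continuous smooth_has_pd smooth_pd intro: smooth_alg.base)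
next
  case (add f g)
  have d: "has_pd i (\<lambda>x. f x + g x) x (pd i f x + pd i g x)" for i x
    using add by (auto intro: has_pd_add)
  then have "pd i (\<lambda>x. f x + g x) = (\<lambda>x. pd i f x + pd i g x)" for i by (auto simp: has_pd_pd)
  with d add show ?case by (auto intro: continuous_intros smooth_alg.add)
next
  case (mult f g)
  have d: "has_pd i (\<lambda>x. f x * g x) x (pd i f x * g x + pd i g x * f x)" for i x
    using mult by (auto intro: has_pd_mult)
  then have "pd i (\<lambda>x. f x * g x) = (\<lambda>x. pd i f x * g x + pd i g x * f x)" for i by (auto simp: has_pd_pd)
  moreover have "smooth_alg (\<lambda>x. pd i f x * g x + pd i g x * f x)" for i
    using mult by (intro smooth_alg.add smooth_alg.mult) auto
  ultimately show ?case using d mult by (auto intro: continuous_intros)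
qed

lemma smooth_alg_smooth: "smooth_alg f \<Longrightarrow> smooth_fn f"
  by (rule smooth_coinduct[where Q = smooth_alg]) (use smooth_alg_step in blast)+

lemma smooth_add: "smooth_fn f \<Longrightarrow> smooth_fn g \<Longrightarrow> smooth_fn (\<lambda>x. f x + g x)"
  and smooth_mult: "smooth_fn f \<Longrightarrow> smooth_fn g \<Longrightarrow> smooth_fn (\<lambda>x. f x * g x)"
  by (auto intro!: smooth_alg_smooth intro: smooth_alg.intros)

lemma pd_add: "smooth_fn f \<Longrightarrow> smooth_fn g \<Longrightarrow> pd i (\<lambda>x. f x + g x) = (\<lambda>x. pd i f x + pd i g x)"
  and pd_mult: "smooth_fn f \<Longrightarrow> smooth_fn g \<Longrightarrow> pd i (\<lambda>x. f x * g x) = (\<lambda>x. pd i f x * g x + pd i g x * f x)"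
  by (auto intro!: has_pd_pd has_pd_add has_pd_mult simp: smooth_has_pd)

lemma smooth_const: "smooth_fn (\<lambda>x. a)"
proof (rule smooth_coinduct[where Q = "\<lambda>f. \<exists>a. f = (\<lambda>x. a)"])
  fix f :: "'a fn" assume "\<exists>a. f = (\<lambda>x. a)"
  then obtain a where f: "f = (\<lambda>x. a)" by blast
  have d: "has_pd i f x 0" for i x by (simp add: f has_pd_def)
  then have "pd i f = (\<lambda>x. 0)" for i by (auto simp: has_pd_pd)
  with d show "continuous_on UNIV f \<and> (\<forall>i x. \<exists>D. has_pd i f x D) \<and> (\<forall>i. \<exists>a. pd i f = (\<lambda>x. a))"
    by (auto simp: f)
qed blast

lemma pd_cmult: "smooth_fn f \<Longrightarrow> pd i (\<lambda>x. a * f x) = (\<lambda>x. a * pd i f x)"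
proof -
  assume "smooth_fn f"
  moreover have "pd i (\<lambda>x. a) = (\<lambda>x. 0)" by (auto intro!: has_pd_pd simp: has_pd_def)
  ultimately show ?thesis by (simp add: pd_mult smooth_const mult.commute)
qed

text \<open>Cosine and sine are treated together because their span is closed under differentiation;
  a derivative in a direction other than \<open>j\<close> is the member with zero
  coefficients.\<close>

lemma smooth_trig:
  fixes j :: "'d::finite"
  shows "smooth_fn (\<lambda>x::real^'d. a * cos (2 * pi * x $ j) + b * sin (2 * pi * x $ j))"
proof -
  define t where "t = (\<lambda>a b (x::real^'d). a * cos (2 * pi * x $ j) + b * sin (2 * pi * x $ j))"
  have "smooth_fn (t a b)"
  proof (rule smooth_coinduct[where Q = "\<lambda>f. \<exists>a b. f = t a b"])
    fix f assume "\<exists>a b. f = t a b"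
    then obtain a b where f: "f = t a b" by blast
    define a' where "a' = (\<lambda>i. if i = j then 2 * pi * b else 0)"
    define b' where "b' = (\<lambda>i. if i = j then - 2 * pi * a else 0)"
    have d: "has_pd i f x (t (a' i) (b' i) x)" for i x
    proof -
      define k :: real where "k = (if i = j then 1 else 0)"
      have e: "(x + h *\<^sub>R axis i 1) $ j = x $ j + h * k" for h by (auto simp: axis_def k_def)
      have "((\<lambda>h. a * cos (2 * pi * (x $ j + h * k)) + b * sin (2 * pi * (x $ j + h * k)))
        has_real_derivative (a * (- sin (2 * pi * x $ j) * (2 * pi * k)) + b * (cos (2 * pi * x $ j) * (2 * pi * k)))) (at 0)"
        by (rule derivative_eq_intros refl | simp)+
      then show ?thesis unfolding has_pd_def f t_def e
        by (rule back_subst[where P = "\<lambda>D. (_ has_real_derivative D) _"])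
          (auto simp: a'_def b'_def k_def)
    qed
    then have "pd i f = t (a' i) (b' i)" for i by (auto simp: has_pd_pd)
    moreover have "continuous_on UNIV f" unfolding f t_def by (intro continuous_intros)
    ultimately show "continuous_on UNIV f \<and> (\<forall>i x. \<exists>D. has_pd i f x D) \<and> (\<forall>i. \<exists>a b. pd i f = t a b)"
      using d by blast
  qed blast
  then show ?thesis by (simp add: t_def)
qed

lemma periodic_trig: "periodic_fn (\<lambda>x::real^'d::finite. a * cos (2 * pi * x $ j) + b * sin (2 * pi * x $ j))"
  by (auto simp: periodic_fn_def axis_def distrib_left cos_add sin_add)

lemma periodic_pd: assumes "periodic_fn f" shows "periodic_fn (pd i f)"
proof -
  have "f (x + axis j 1 + h *\<^sub>R axis i 1) = f (x + h *\<^sub>R axis i 1)" for x j h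
    using assms[unfolded periodic_fn_def, rule_format, of "x + h *\<^sub>R axis i 1" j] by (simp add: algebra_simps)
  then show ?thesis by (simp add: periodic_fn_def pd_def)
qed

lemma smooth_periodic_L2: "smooth_fn f \<Longrightarrow> periodic_fn f \<Longrightarrow> f \<in> L2"
  by (intro L2_I sq_continuous smooth_continuous)

lemma integrable_continuous_mcell: "continuous_on UNIV g \<Longrightarrow> integrable mcell g" for g :: "('d::finite) fn"
  by (intro integrable_sq sq_continuous)

lemma integral_mcell_eq: "continuous_on UNIV g \<Longrightarrow> integral\<^sup>L mcell g = integral cell g" for g :: "('d::finite) fn"
  by (intro lebesgue_integral_eq_integral integrable_continuous_mcell) auto

section \<open>Translation invariance of the integral over a period cell\<close>

lemma One_component: "(One::real^'d::finite) $ j = 1"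
proof -
  have "(axis j 1 :: real^'d) \<in> Basis" by (auto simp: Basis_vec_def)
  then have "One \<bullet> (axis j 1 :: real^'d) = 1" by (simp add: inner_sum_left inner_Basis)
  then show ?thesis by (simp add: cart_eq_inner_axis)
qed

lemma mem_cell: "x \<in> cell \<longleftrightarrow> (\<forall>j. 0 \<le> x $ j \<and> x $ j \<le> 1)"
  unfolding cell_def mem_box_cart One_component by simp

lemma cbox_slice_le:
  fixes a b :: "real^'d::finite"
  assumes "c \<le> b $ i"
  shows "cbox a b \<inter> {x. x $ i \<le> c} = cbox a (\<chi> j. if j = i then c else b $ j)"
proof (rule set_eqI)
  fix x
  have "(x $ i \<le> c \<and> (a $ j \<le> x $ j \<and> x $ j \<le> b $ j)) \<longleftrightarrow>
      (x $ i \<le> c \<and> (a $ j \<le> x $ j \<and> x $ j \<le> (if j = i then c else b $ j)))" for j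
    using assms by auto
  moreover have "x \<in> cbox a (\<chi> j. if j = i then c else b $ j) \<Longrightarrow> x $ i \<le> c"
    unfolding mem_box_cart by (drule spec[of _ i]) simp
  ultimately show "x \<in> cbox a b \<inter> {x. x $ i \<le> c} \<longleftrightarrow> x \<in> cbox a (\<chi> j. if j = i then c else b $ j)"
    unfolding mem_box_cart Int_iff mem_Collect_eq vec_lambda_beta by blast
qed

lemma cbox_slice_ge:
  fixes a b :: "real^'d::finite"
  assumes "a $ i \<le> c"
  shows "cbox a b \<inter> {x. x $ i \<ge> c} = cbox (\<chi> j. if j = i then c else a $ j) b"
proof (rule set_eqI)
  fix x
  have "(c \<le> x $ i \<and> (a $ j \<le> x $ j \<and> x $ j \<le> b $ j)) \<longleftrightarrow>
      (c \<le> x $ i \<and> ((if j = i then c else a $ j) \<le> x $ j \<and> x $ j \<le> b $ j))" for j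
    using assms by auto
  moreover have "x \<in> cbox (\<chi> j. if j = i then c else a $ j) b \<Longrightarrow> c \<le> x $ i"
    unfolding mem_box_cart by (drule spec[of _ i]) simp
  ultimately show "x \<in> cbox a b \<inter> {x. x $ i \<ge> c} \<longleftrightarrow> x \<in> cbox (\<chi> j. if j = i then c else a $ j) b"
    unfolding mem_box_cart Int_iff mem_Collect_eq vec_lambda_beta by blast
qed

text \<open>Cut the cell at height \<open>h\<close> in direction \<open>i\<close> and move the lower
  slab up by one period: by periodicity its integral is unchanged, and the two slabs now form the
  shifted cell.\<close>

lemma integral_shift_axis:
  fixes g :: "('d::finite) fn"
  assumes g: "continuous_on UNIV g" and p: "periodic_fn g" and h: "0 \<le> h" "h \<le> 1"
  shows "integral\<^sup>L mcell (\<lambda>x. g (x + h *\<^sub>R axis i 1)) = integral\<^sup>L mcell g"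
proof -
  have shift: "integral (cbox a b) (\<lambda>x. g (x + v)) = integral (cbox (a + v) (b + v)) g" for a b v
  proof -
    have "g integrable_on cbox (a + v) (b + v)"
      by (intro integrable_continuous continuous_on_subset[OF g]) auto
    from has_integral_affinity[OF integrable_integral[OF this], of 1 v]
    have "((\<lambda>x. g (x + v)) has_integral integral (cbox (a + v) (b + v)) g)
        ((\<lambda>x. x - v) ` cbox (a + v) (b + v))" by simp
    also have "(\<lambda>x. x - v) ` cbox (a + v) (b + v) = cbox a b"
      using cbox_translation[of "-v" "a + v" "b + v"] by (simp add: image_def)
    finally show ?thesis by (simp add: integral_unique)
  qed
  define e :: "real^'d" where "e = axis i 1"
  define u :: "real^'d" where "u = (\<chi> j. if j = i then h else 0)"
  define w :: "real^'d" where "w = (\<chi> j. if j = i then h else 1)"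
  have he: "h *\<^sub>R e = u" by (auto simp: vec_eq_iff e_def u_def axis_def)
  have int: "g integrable_on cbox a b" for a b
    by (intro integrable_continuous continuous_on_subset[OF g]) auto
  have eB: "e \<in> Basis" by (auto simp: e_def Basis_vec_def)
  have xe: "x \<bullet> e = x $ i" for x by (simp add: e_def cart_eq_inner_axis)
  define one :: "real^'d" where "one = One"
  have one: "one $ j = 1" for j unfolding one_def by (rule One_component)
  have e: "e $ j = (if j = i then 1 else 0)" for j by (simp add: e_def axis_def)
  have cell: "cell = cbox 0 one" by (simp add: cell_def one_def)
  have cell1: "cbox 0 one \<inter> {x. x \<bullet> e \<le> h} = cbox 0 w"
    using cbox_slice_le[of h one i 0] h unfolding xe w_def one by simp
  have cell2: "cbox 0 one \<inter> {x. x \<bullet> e \<ge> h} = cbox u one"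
    using cbox_slice_ge[of 0 i h one] h unfolding xe u_def by (simp cong: if_cong)
  have oi: "1 \<le> (one + u) $ i" "u $ i \<le> 1" using h by (simp_all add: one u_def)
  have "(\<chi> j. if j = i then 1 else (one + u) $ j) = one" by (auto simp: vec_eq_iff one u_def)
  then have cell3: "cbox u (one + u) \<inter> {x. x \<bullet> e \<le> 1} = cbox u one"
    using cbox_slice_le[OF oi(1), of u] unfolding xe by simp
  have "(\<chi> j. if j = i then 1 else u $ j) = 0 + e" "one + u = w + e"
    by (auto simp: vec_eq_iff one u_def w_def e)
  then have cell4: "cbox u (one + u) \<inter> {x. x \<bullet> e \<ge> 1} = cbox (0 + e) (w + e)"
    using cbox_slice_ge[OF oi(2), of "one + u"] unfolding xe by simp
  have "integral cell g = integral (cbox 0 w) g + integral (cbox u one) g"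
    using integral_split[OF int[of 0 one] eB, of h] unfolding cell cell1 cell2 .
  also have "integral (cbox 0 w) g = integral (cbox (0 + e) (w + e)) g"
    using shift[of 0 w e] p by (simp add: e_def periodic_fn_def)
  also have "\<dots> + integral (cbox u one) g = integral (cbox (0 + u) (one + u)) g"
    using integral_split[OF int[of u "one + u"] eB, of 1] unfolding cell3 cell4 by simp
  also have "\<dots> = integral cell (\<lambda>x. g (x + h *\<^sub>R e))"
    using shift[of 0 one u] unfolding cell he by simp
  finally have "integral cell (\<lambda>x. g (x + h *\<^sub>R e)) = integral cell g" ..
  moreover have "continuous_on UNIV (\<lambda>x. g (x + h *\<^sub>R e))"
    by (intro continuous_on_compose2[OF g] continuous_intros) auto
  ultimately show ?thesis using g by (simp add: integral_mcell_eq e_def)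
qed

text \<open>The admissible shifts form a group that contains all short multiples of the coordinate
  vectors, hence every vector.\<close>

lemma integral_translate:
  fixes g :: "('d::finite) fn"
  assumes g: "continuous_on UNIV g" and p: "periodic_fn g"
  shows "integral\<^sup>L mcell (\<lambda>x. g (x + a)) = integral\<^sup>L mcell g"
proof -
  \<comment> \<open>The quantifier over all functions makes \<open>I\<close> closed under addition:
    a second shift is applied to a function that is already shifted.\<close>
  define I where "I a \<longleftrightarrow> (\<forall>g::'d fn. continuous_on UNIV g \<longrightarrow> periodic_fn g \<longrightarrow>
      integral\<^sup>L mcell (\<lambda>x. g (x + a)) = integral\<^sup>L mcell g)" for a
  have c: "continuous_on UNIV (\<lambda>x. g (x + a))" if "continuous_on UNIV g" for g :: "'d fn" and a
    by (intro continuous_on_compose2[OF that] continuous_intros) auto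
  have pp: "periodic_fn (\<lambda>x. g (x + a))" if "periodic_fn g" for g :: "'d fn" and a
    using that by (simp add: periodic_fn_def add.assoc add.commute[of _ a]) (simp flip: add.assoc)
  have add: "I (a + b)" if "I a" "I b" for a b
    unfolding I_def
  proof (intro allI impI)
    fix g :: "'d fn" assume "continuous_on UNIV g" "periodic_fn g"
    then show "integral\<^sup>L mcell (\<lambda>x. g (x + (a + b))) = integral\<^sup>L mcell g"
      using that(1)[unfolded I_def, rule_format, OF c[of g b] pp[of g b]] that(2)
      by (simp add: I_def add.assoc)
  qed
  have uminus: "I (- a)" if "I a" for a
    unfolding I_def
  proof (intro allI impI)
    fix g :: "'d fn" assume "continuous_on UNIV g" "periodic_fn g"
    then show "integral\<^sup>L mcell (\<lambda>x. g (x + - a)) = integral\<^sup>L mcell g"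
      using that[unfolded I_def, rule_format, OF c[of g "-a"] pp[of g "-a"]] by simp
  qed
  have zero: "I 0" by (simp add: I_def)
  have small: "I (h *\<^sub>R axis i 1)" if "0 \<le> h" "h \<le> 1" for h i
    using that by (simp add: I_def integral_shift_axis)
  have "I (real n *\<^sub>R v)" if "I v" for n v
    by (induction n) (auto simp: zero add that scaleR_add_left)
  then have pos: "I (h *\<^sub>R axis i 1)" if "0 \<le> h" for h i
  proof -
    define n where "n = Suc (nat \<lceil>h\<rceil>)"
    have n: "real n > 0" "h \<le> real n" unfolding n_def by linarith+
    have "I ((h / real n) *\<^sub>R axis i 1)" using n that by (intro small) (auto simp: divide_simps)
    then have "I (real n *\<^sub>R ((h / real n) *\<^sub>R axis i 1))" by fact
    then show ?thesis using n by simp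
  qed
  have all: "I (h *\<^sub>R axis i 1)" for h i
    using pos[of h i] uminus[OF pos[of "-h" i]] by (cases "h \<ge> 0") auto
  have "I (\<Sum>i\<in>J. (a $ i) *\<^sub>R axis i 1)" for J
    by (induction J rule: infinite_finite_induct) (auto simp: zero add all)
  from this[of UNIV] have "I a" by (subst (asm) basis_expansion[of a, unfolded scalar_mult_eq_scaleR])
  then show ?thesis using g p by (simp add: I_def)
qed

text \<open>Difference quotients have integral zero by translation invariance, and they converge
  boundedly to the derivative.\<close>

lemma integral_pd_zero:
  fixes f :: "('d::finite) fn"
  assumes f: "smooth_fn f" "periodic_fn f"
  shows "integral\<^sup>L mcell (pd i f) = 0"
proof -
  define e :: "real^'d" where "e = axis i 1"
  define q where "q n x = (f (x + (1 / real (Suc n)) *\<^sub>R e) - f x) * real (Suc n)" for n x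
  have cf: "continuous_on UNIV f" using f by (simp add: smooth_continuous)
  have cft: "continuous_on UNIV (\<lambda>x. f (x + a))" for a
    by (intro continuous_on_compose2[OF cf] continuous_intros) auto
  have cpd: "continuous_on UNIV (pd i f)" using f by (simp add: smooth_continuous smooth_pd)
  \<comment> \<open>A point of the cell moved by a step of length at most 1 stays in the box of side
    2, so the mean value theorem bounds all quotients by the maximum over this box.\<close>
  have "compact (pd i f ` cbox (0::real^'d) (\<chi> j. 2))"
    by (intro compact_continuous_image continuous_on_subset[OF cpd]) auto
  then have "bounded (pd i f ` cbox (0::real^'d) (\<chi> j. 2))" by (rule compact_imp_bounded)
  then obtain B where B: "\<And>x. x \<in> cbox 0 (\<chi> j. 2) \<Longrightarrow> \<bar>pd i f x\<bar> \<le> B"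
    unfolding bounded_iff by auto
  have line: "((\<lambda>h. f (x + h *\<^sub>R e)) has_real_derivative pd i f (x + h *\<^sub>R e)) (at h)" for x h
  proof -
    have "((\<lambda>k. f ((x + h *\<^sub>R e) + k *\<^sub>R e)) has_real_derivative pd i f (x + h *\<^sub>R e)) (at 0)"
      using smooth_has_pd[OF f(1), of i "x + h *\<^sub>R e"] by (simp add: has_pd_def e_def)
    then have "((\<lambda>k. f (x + (k + h) *\<^sub>R e)) has_real_derivative pd i f (x + h *\<^sub>R e)) (at 0)"
      by (simp add: algebra_simps)
    then show ?thesis using DERIV_shift[of "\<lambda>k. f (x + k *\<^sub>R e)" _ 0 h] by simp
  qed
  have bound: "\<bar>q n x\<bar> \<le> B" if x: "x \<in> cell" for n x
  proof -
    let ?h = "1 / real (Suc n)"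
    obtain z where z: "0 < z" "z < ?h" "f (x + ?h *\<^sub>R e) - f (x + 0 *\<^sub>R e) = (?h - 0) * pd i f (x + z *\<^sub>R e)"
      using MVT2[of 0 ?h "\<lambda>h. f (x + h *\<^sub>R e)" "\<lambda>h. pd i f (x + h *\<^sub>R e)"] line by auto
    have "z \<le> 1" using z(2) by (rule order.trans[OF less_imp_le]) simp
    then have "x + z *\<^sub>R e \<in> cbox 0 (\<chi> j. 2)"
      unfolding mem_box_cart
    proof (intro allI)
      fix j
      have "0 \<le> x $ j" "x $ j \<le> 1" using x by (auto simp: mem_cell)
      then show "0 $ j \<le> (x + z *\<^sub>R e) $ j \<and> (x + z *\<^sub>R e) $ j \<le> (\<chi> j. 2) $ j"
        using z(1) \<open>z \<le> 1\<close> by (auto simp: e_def axis_def)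
    qed
    then have "\<bar>pd i f (x + z *\<^sub>R e)\<bar> \<le> B" by (rule B)
    moreover have "q n x = pd i f (x + z *\<^sub>R e)" using z(3) by (simp add: q_def field_simps)
    ultimately show ?thesis by simp
  qed
  have lim: "(\<lambda>n. q n x) \<longlonglongrightarrow> pd i f x" for x
  proof -
    have "((\<lambda>h. (f (x + h *\<^sub>R e) - f x) / h) \<longlongrightarrow> pd i f x) (at 0)"
      using line[of x 0] by (simp add: has_field_derivative_iff)
    moreover have "filterlim (\<lambda>n. 1 / real (Suc n)) (at 0) sequentially"
      using LIMSEQ_Suc[OF lim_1_over_n] by (auto simp: filterlim_at)
    ultimately have "(\<lambda>n. (f (x + (1 / real (Suc n)) *\<^sub>R e) - f x) / (1 / real (Suc n))) \<longlonglongrightarrow> pd i f x"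
      by (rule filterlim_compose)
    then show ?thesis by (simp add: q_def)
  qed
  have "(\<lambda>n. integral\<^sup>L mcell (q n)) \<longlonglongrightarrow> integral\<^sup>L mcell (pd i f)"
  proof (rule integral_dominated_convergence[where w = "\<lambda>_. B"])
    show "q n \<in> borel_measurable mcell" for n
      unfolding q_def by (intro continuous_measurable_mcell continuous_intros cft cf)
    show "pd i f \<in> borel_measurable mcell" using cpd by (rule continuous_measurable_mcell)
    show "integrable mcell (\<lambda>_. B)" by (intro integrable_continuous_mcell continuous_intros)
  qed (use lim bound in \<open>auto intro!: AE_mcell_I\<close>)
  moreover have "integral\<^sup>L mcell (q n) = 0" for n
    using integral_translate[OF cf f(2)] integrable_continuous_mcell[OF cft] integrable_continuous_mcell[OF cf]
    unfolding q_def by simp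
  ultimately show ?thesis by (simp add: LIMSEQ_const_iff)
qed

section \<open>Integration by parts; classical derivatives are weak derivatives\<close>

lemma integral_pd_mult:
  assumes "smooth_fn f" "periodic_fn f" "smooth_fn g" "periodic_fn g"
  shows "integral\<^sup>L mcell (\<lambda>x. f x * pd i g x) = - integral\<^sup>L mcell (\<lambda>x. pd i f x * g x)"
proof -
  have "integral\<^sup>L mcell (\<lambda>x. pd i f x * g x + pd i g x * f x) = 0"
    using integral_pd_zero[of "\<lambda>x. f x * g x" i] assms by (simp add: smooth_mult pd_mult)
  moreover have "integrable mcell (\<lambda>x. pd i f x * g x)" "integrable mcell (\<lambda>x. pd i g x * f x)"
    using assms by (auto intro!: integrable_continuous_mcell smooth_continuous smooth_mult smooth_pd)
  ultimately show ?thesis by (simp add: mult.commute)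
qed

lemma smooth_dlist: "smooth_fn f \<Longrightarrow> smooth_fn (dlist is f)"
  by (induction "is") (auto simp: smooth_pd)

text \<open>\<open>dlist [i, j]\<close> applies \<open>pd i\<close> last, and the outermost
  derivative is moved off the test function first. This reverses the order in the mixed case, and no
  symmetry of second derivatives has to be proved.\<close>

lemma smooth_weak_deriv:
  assumes f: "smooth_fn f" "periodic_fn f"
  shows "is_weak_deriv [i] f (pd i f)" "is_weak_deriv [i, j] f (pd j (pd i f))" "is_weak_deriv [] f f"
proof -
  note s = smooth_pd periodic_pd
  show "is_weak_deriv [] f f" using f by (auto simp: is_weak_deriv_def smooth_periodic_L2)
  show "is_weak_deriv [i] f (pd i f)"
    using f by (auto simp: is_weak_deriv_def smooth_periodic_L2 s integral_pd_mult)
  show "is_weak_deriv [i, j] f (pd j (pd i f))"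
    using f by (auto simp: is_weak_deriv_def smooth_periodic_L2 s integral_pd_mult)
qed

lemma smooth_H2: assumes "smooth_fn f" "periodic_fn f" shows "f \<in> H2"
proof -
  have "\<exists>g. is_weak_deriv \<alpha> f g" if "length \<alpha> \<le> 2" for \<alpha>
  proof -
    consider "\<alpha> = []" | i where "\<alpha> = [i]" | i j where "\<alpha> = [i, j]"
      using \<open>length \<alpha> \<le> 2\<close>
      by (cases \<alpha>; cases "tl \<alpha>") (auto simp: numeral_2_eq_2 neq_Nil_conv)
    then show ?thesis using smooth_weak_deriv[OF assms] by cases blast+
  qed
  then show ?thesis using assms by (auto simp: H2_def smooth_periodic_L2)
qed

section \<open>Mollification by trigonometric kernels\<close>

text \<open>Kernels of finite rank: integrating \<open>f\<close> against one gives a finite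
  combination of smooth functions of \<open>x\<close>. Smoothness, differentiation under the
  integral and exchange of integrals then follow by induction on the sum, from linearity
  alone.\<close>

inductive separable_kernel :: "(real^'d::finite \<Rightarrow> real^'d \<Rightarrow> real) \<Rightarrow> bool" where
  prod: "smooth_fn u \<Longrightarrow> periodic_fn u \<Longrightarrow> smooth_fn w \<Longrightarrow> periodic_fn w \<Longrightarrow>
    separable_kernel (\<lambda>x y. u x * w y)"
| add: "separable_kernel k \<Longrightarrow> separable_kernel l \<Longrightarrow> separable_kernel (\<lambda>x y. k x y + l x y)"

definition kernel_op :: "(real^'d::finite \<Rightarrow> real^'d \<Rightarrow> real) \<Rightarrow> 'd op" where
  "kernel_op k f x = integral\<^sup>L mcell (\<lambda>y. f y * k x y)"

lemma separable_kernel_mult: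
  "separable_kernel k \<Longrightarrow> separable_kernel l \<Longrightarrow> separable_kernel (\<lambda>x y. k x y * l x y)"
proof (induction rule: separable_kernel.induct)
  case (prod u w)
  from prod(5) show ?case
  proof (induction rule: separable_kernel.induct)
    case p: (prod u' w')
    have "separable_kernel (\<lambda>x y. (u x * u' x) * (w y * w' y))"
      using p prod(1-4) by (intro separable_kernel.prod smooth_mult periodic_mult)
    then show ?case by (simp add: mult.assoc mult.left_commute)
  next
    case (add k l)
    from separable_kernel.add[OF add.IH] show ?case by (simp add: distrib_left)
  qed
next
  case (add k k')
  from separable_kernel.add[OF add.IH] add.prems show ?case by (simp add: distrib_right)
qed

lemma separable_kernel_const: "separable_kernel (\<lambda>x y. a)"
  using separable_kernel.prod[of "\<lambda>_. a" "\<lambda>_. 1"] by (simp add: smooth_const)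

lemma separable_kernel_power: "separable_kernel k \<Longrightarrow> separable_kernel (\<lambda>x y. k x y ^ n)"
  by (induction n) (auto intro: separable_kernel_const separable_kernel_mult)

lemma separable_kernel_prod:
  "(\<And>i. i \<in> I \<Longrightarrow> separable_kernel (k i)) \<Longrightarrow> separable_kernel (\<lambda>x y. \<Prod>i\<in>I. k i x y)"
  by (induction I rule: infinite_finite_induct) (auto intro: separable_kernel_const separable_kernel_mult)

lemma separable_kernel_cos:
  "separable_kernel (\<lambda>x y. cos (2 * pi * (y $ i - x $ i)))" for i :: "'d::finite"
proof -
  have c: "smooth_fn (\<lambda>x::real^'d. cos (2 * pi * x $ i))" "periodic_fn (\<lambda>x::real^'d. cos (2 * pi * x $ i))"
    using smooth_trig[of 1 i 0] periodic_trig[of 1 i 0] by auto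
  have s: "smooth_fn (\<lambda>x::real^'d. sin (2 * pi * x $ i))" "periodic_fn (\<lambda>x::real^'d. sin (2 * pi * x $ i))"
    using smooth_trig[of 0 i 1] periodic_trig[of 0 i 1] by auto
  from separable_kernel.add[OF separable_kernel.prod[OF c c] separable_kernel.prod[OF s s]]
  show ?thesis by (simp add: right_diff_distrib cos_diff mult.commute)
qed

lemma separable_kernel_smooth:
  "separable_kernel k \<Longrightarrow> smooth_fn (k x) \<and> periodic_fn (k x) \<and> smooth_fn (\<lambda>x. k x y) \<and> periodic_fn (\<lambda>x. k x y)"
  by (induction rule: separable_kernel.induct) (auto intro: smooth_mult smooth_add smooth_const)

lemma integrable_mult_continuous:
  fixes g :: "('d::finite) fn"
  assumes f: "integrable mcell f" and g: "continuous_on UNIV g"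
  shows "integrable mcell (\<lambda>x. f x * g x)"
proof -
  obtain B where B: "\<forall>x\<in>cell. \<bar>g x\<bar> \<le> B" using continuous_bounded_cell[OF g] by blast
  show ?thesis
  proof (rule Bochner_Integration.integrable_bound)
    show "integrable mcell (\<lambda>x. B * f x)" using f by simp
    show "(\<lambda>x. f x * g x) \<in> borel_measurable mcell"
      using f continuous_measurable_mcell[OF g] by measurable
    show "AE x in mcell. norm (f x * g x) \<le> norm (B * f x)"
    proof (rule AE_mcell_I)
      fix x :: "real^'d" assume "x \<in> cell"
      then have "\<bar>g x\<bar> \<le> \<bar>B\<bar>" using B by force
      then show "norm (f x * g x) \<le> norm (B * f x)"
        by (simp add: abs_mult mult.commute[of "\<bar>f x\<bar>"] mult_right_mono)
    qed
  qed
qed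

lemma separable_kernel_integrable:
  assumes "separable_kernel k" "integrable mcell f" shows "integrable mcell (\<lambda>y. f y * k x y)"
  using assms separable_kernel_smooth[OF assms(1)] by (auto intro!: integrable_mult_continuous smooth_continuous)

lemma kernel_op_add:
  assumes "separable_kernel k" "separable_kernel l" "integrable mcell f"
  shows "kernel_op (\<lambda>x y. k x y + l x y) f = (\<lambda>x. kernel_op k f x + kernel_op l f x)"
  using assms by (auto simp: kernel_op_def distrib_left separable_kernel_integrable)

lemma kernel_op_prod: "kernel_op (\<lambda>x y. u x * w y) f = (\<lambda>x. integral\<^sup>L mcell (\<lambda>y. f y * w y) * u x)"
  by (auto simp: kernel_op_def mult.left_commute[of _ "u _"] mult.commute)

lemma kernel_op_smooth:
  assumes "separable_kernel k" "integrable mcell f"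
  shows "smooth_fn (kernel_op k f) \<and> periodic_fn (kernel_op k f)"
  using assms
proof (induction rule: separable_kernel.induct)
  case (prod u w)
  then show ?case unfolding kernel_op_prod by (auto intro!: smooth_mult smooth_const)
next
  case (add k l)
  then show ?case using kernel_op_add[of k l f] by (auto intro!: smooth_add)
qed

lemma pd_kernel_op:
  assumes "separable_kernel k" "integrable mcell f"
  shows "separable_kernel (\<lambda>x y. pd i (\<lambda>x. k x y) x) \<and>
    pd i (kernel_op k f) = kernel_op (\<lambda>x y. pd i (\<lambda>x. k x y) x) f"
  using assms
proof (induction rule: separable_kernel.induct)
  case (prod u w)
  have e: "(\<lambda>x y. pd i (\<lambda>x. u x * w y) x) = (\<lambda>x y. pd i u x * w y)"
    using pd_cmult[OF prod(1), of i] by (auto simp: mult.commute[of "u _"] mult.commute[of _ "w _"])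
  show ?case unfolding e kernel_op_prod
    using prod pd_cmult[OF prod(1), of i] by (auto intro!: separable_kernel.prod smooth_pd periodic_pd)
next
  case (add k l)
  have e: "(\<lambda>x y. pd i (\<lambda>x. k x y + l x y) x) = (\<lambda>x y. pd i (\<lambda>x. k x y) x + pd i (\<lambda>x. l x y) x)"
    using separable_kernel_smooth[OF add(1)] separable_kernel_smooth[OF add(2)] by (auto simp: pd_add)
  show ?case unfolding e using add kernel_op_smooth[of k f] kernel_op_smooth[of l f]
    by (auto intro!: separable_kernel.add simp: kernel_op_add pd_add)
qed

text \<open>The form of Fubini's theorem that makes mollification preserve integrals; for a product
  kernel both sides factor.\<close>

lemma integral_kernel_op:
  assumes "separable_kernel k" "integrable mcell f"
  shows "integral\<^sup>L mcell (kernel_op k f) = integral\<^sup>L mcell (\<lambda>y. f y * integral\<^sup>L mcell (\<lambda>x. k x y))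
    \<and> integrable mcell (\<lambda>y. f y * integral\<^sup>L mcell (\<lambda>x. k x y))"
  using assms
proof (induction rule: separable_kernel.induct)
  case (prod u w)
  have "integrable mcell (\<lambda>y. f y * w y)"
    using prod by (intro integrable_mult_continuous smooth_continuous)
  then have "integrable mcell (\<lambda>y. f y * w y * integral\<^sup>L mcell u)" by simp
  moreover have "(\<lambda>y. f y * w y * integral\<^sup>L mcell u) = (\<lambda>y. f y * integral\<^sup>L mcell (\<lambda>x. u x * w y))"
    by (simp add: mult_ac)
  moreover have "integral\<^sup>L mcell (\<lambda>y. f y * w y * integral\<^sup>L mcell u) =
      integral\<^sup>L mcell (\<lambda>y. f y * w y) * integral\<^sup>L mcell u" by (rule integral_mult_left_zero)
  ultimately show ?case unfolding kernel_op_prod by simp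
next
  case (add k l)
  have i: "integrable mcell (\<lambda>x. k x y)" "integrable mcell (\<lambda>x. l x y)" for y
    using separable_kernel_smooth[OF add(1)] separable_kernel_smooth[OF add(2)]
    by (auto intro!: integrable_continuous_mcell smooth_continuous)
  have "integrable mcell (kernel_op k f)" "integrable mcell (kernel_op l f)"
    using add kernel_op_smooth by (auto intro!: integrable_continuous_mcell smooth_continuous)
  then show ?case using add by (simp add: kernel_op_add i distrib_left)
qed

text \<open>Each factor is the square of \<open>cos (pi * z $ i)\<close>, so the normalised powers
  are de la Vallee Poussin kernels: nonnegative trigonometric polynomials, hence separable, that
  concentrate at the lattice points.\<close>

definition bump :: "(real^'d::finite) \<Rightarrow> real" where
  "bump z = (\<Prod>i\<in>UNIV. (1 + cos (2 * pi * z $ i)) / 2)"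

definition bump_mass :: "'d::finite itself \<Rightarrow> nat \<Rightarrow> real" where
  "bump_mass _ n = integral\<^sup>L mcell (\<lambda>y::real^'d. bump y ^ n)"

definition moll_kernel :: "nat \<Rightarrow> (real^'d::finite) \<Rightarrow> real^'d \<Rightarrow> real" where
  "moll_kernel n x y = bump (y - x) ^ n / bump_mass TYPE('d) n"

definition mollify :: "nat \<Rightarrow> ('d::finite) op" where
  "mollify n = kernel_op (moll_kernel n)"

lemma bump_factor:
  fixes t :: real shows "0 \<le> (1 + cos t) / 2" "(1 + cos t) / 2 \<le> 1"
proof -
  show "0 \<le> (1 + cos t) / 2" 
    using diff_ge_0_iff_ge[of "cos t" "-1"] by simp
  show "(1 + cos t) / 2 \<le> 1" using add_left_mono[OF cos_le_one[of t], of 1] by simp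
qed

lemma bump_range: "0 \<le> bump z" "bump z \<le> 1"
  unfolding bump_def by (intro prod_nonneg prod_le_1 conjI ballI bump_factor)+

lemma continuous_bump: "continuous_on S bump"
  unfolding bump_def by (intro continuous_intros) auto

lemma bump_sym: "bump (y - x) = bump (x - y)"
  unfolding bump_def by (simp add: right_diff_distrib cos_diff mult.commute)

lemma separable_bump: "separable_kernel (\<lambda>x y. bump (y - x))"
proof -
  have "separable_kernel (\<lambda>x y. (1 / 2) * (1 + cos (2 * pi * (y $ i - x $ i))))" for i :: 'a
    by (intro separable_kernel_mult separable_kernel_const separable_kernel.add separable_kernel_cos)
  then show ?thesis unfolding bump_def by (intro separable_kernel_prod) simp
qed

lemma separable_moll_kernel: "separable_kernel (moll_kernel n)"
proof -
  have "separable_kernel (\<lambda>x y. bump (y - x) ^ n * (1 / bump_mass TYPE('a) n))"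
    by (intro separable_kernel_mult separable_kernel_power separable_bump separable_kernel_const)
  then show ?thesis by (simp add: moll_kernel_def[abs_def])
qed

lemma periodic_bump: "periodic_fn (\<lambda>z. bump z ^ n)"
proof -
  have "periodic_fn (\<lambda>y. bump (y - 0) ^ n)"
    using separable_kernel_smooth[OF separable_kernel_power[OF separable_bump, of n]] by blast
  then show ?thesis by simp
qed

lemma integral_bump_translate: "integral\<^sup>L mcell (\<lambda>y::real^'d::finite. bump (y - x) ^ n) = bump_mass TYPE('d) n"
  using integral_translate[OF _ periodic_bump, of n "-x"] by (simp add: bump_mass_def continuous_bump continuous_intros)

text \<open>The mass decays more slowly than any geometric sequence, since \<open>bump\<close>
  exceeds \<open>s\<close> on a set of positive measure near its maximum. This beats the decay
  \<open>r ^ n\<close> of the kernel away from its centre.\<close>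

lemma bump_mass_lower:
  assumes s: "0 < s" "s < 1" shows "\<exists>m>0. \<forall>n. m * s ^ n \<le> bump_mass TYPE('d::finite) n"
proof -
  have "isCont bump (0::real^'d)"
    using continuous_bump[of UNIV] continuous_on_eq_continuous_at[of UNIV bump] by auto
  then have "(bump \<longlongrightarrow> bump (0::real^'d)) (nhds (0::real^'d))" by (simp add: isCont_def tendsto_at_iff_tendsto_nhds)
  moreover have "bump (0::real^'d) = 1" by (simp add: bump_def)
  ultimately have "\<forall>\<^sub>F z in nhds (0::real^'d). s < bump z"
    using s(2) by (intro order_tendstoD(1)[where y = 1]) auto
  then obtain d where d: "d > 0" "\<And>z::real^'d. dist z 0 < d \<Longrightarrow> s < bump z"
    unfolding eventually_nhds_metric by auto
  \<comment> \<open>The origin is a corner of the cell, so only the part of the ball inside the open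
    cell counts; it is nonempty because the origin lies in the closure of that cell.\<close>
  define S where "S = ball (0::real^'d) d \<inter> box 0 One"
  have So: "open S" unfolding S_def by (intro open_Int open_ball open_box)
  have "box (0::real^'d) One \<noteq> {}" by (simp add: box_ne_empty)
  then have "(0::real^'d) \<in> closure (box 0 One)" by (subst closure_box) (auto simp: mem_box)
  then obtain z :: "real^'d" where "z \<in> box 0 One" "dist z 0 < d"
    using d(1) unfolding closure_approachable by blast
  then have "z \<in> S" by (simp add: S_def dist_commute)
  then have "\<not> negligible S" using So open_not_negligible by blast
  moreover have Sl: "S \<in> lmeasurable" using So by (intro lmeasurable_open) (auto simp: S_def)
  ultimately have m: "measure lebesgue S > 0"
    by (simp add: negligible_iff_measure0 order.strict_iff_order)
  have Sc: "S \<subseteq> cell" unfolding S_def cell_def using box_subset_cbox by blast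
  have Sm: "S \<in> sets mcell" using Sl Sc by (simp add: sets_restrict_space_iff fmeasurableD)
  have mS: "measure mcell S = measure lebesgue S"
    using Sc by (simp add: measure_restrict_space)
  have "measure lebesgue S * s ^ n \<le> bump_mass TYPE('d) n" for n
  proof -
    have "measure lebesgue S * s ^ n = integral\<^sup>L mcell (\<lambda>y. s ^ n * indicator S y)"
      using Sc by (simp add: mS[symmetric] Int_absorb2)
    also have "\<dots> \<le> bump_mass TYPE('d) n" unfolding bump_mass_def
    proof (rule integral_mono)
      show "integrable mcell (\<lambda>y. s ^ n * indicator S y)"
        using Sm finite_measure.emeasure_finite[OF finite_measure_mcell, of S]
        by (auto intro!: integrable_real_indicator simp: less_top[symmetric])
      show "integrable mcell (\<lambda>y. bump y ^ n)"
        by (intro integrable_continuous_mcell continuous_intros continuous_bump)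
      show "s ^ n * indicator S y \<le> bump y ^ n" for y
        using d(2)[of y] s bump_range(1)[of y]
        by (auto simp: S_def indicator_def dist_commute intro!: power_mono)
    qed
    finally show ?thesis .
  qed
  then show ?thesis using m by blast
qed

lemma bump_mass_pos: "0 < bump_mass TYPE('d::finite) n"
proof -
  obtain m where m: "0 < m" "m * (1/2) ^ n \<le> bump_mass TYPE('d) n"
    using bump_mass_lower[of "1/2", where 'd = 'd] by auto
  then show ?thesis by (smt (verit) zero_less_mult_iff zero_less_power half_gt_zero)
qed

lemma moll_kernel_nonneg: "0 \<le> moll_kernel n x y"
  by (simp add: moll_kernel_def bump_range less_imp_le[OF bump_mass_pos])

lemma integral_moll_kernel:
  fixes x y :: "real^'a::finite"
  shows "integral\<^sup>L mcell (moll_kernel n x) = 1" "integral\<^sup>L mcell (\<lambda>x. moll_kernel n x y) = 1"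
proof -
  have *: "integral\<^sup>L mcell (moll_kernel n x) = 1" for x :: "real^'a"
    using bump_mass_pos[of n, where 'd = 'a] by (simp add: moll_kernel_def[abs_def] integral_bump_translate)
  then show "integral\<^sup>L mcell (moll_kernel n x) = 1" .
  have "(\<lambda>x. moll_kernel n x y) = moll_kernel n y"
    by (auto simp: moll_kernel_def bump_sym[of y])
  then show "integral\<^sup>L mcell (\<lambda>x. moll_kernel n x y) = 1" using * by simp
qed

lemma continuous_moll_kernel: "continuous_on UNIV (moll_kernel n x)"
  using separable_kernel_smooth[OF separable_moll_kernel] smooth_continuous by blast

lemma integrable_moll:
  assumes "integrable mcell f" shows "integrable mcell (\<lambda>y. f y * moll_kernel n x y)"
  using assms separable_kernel_integrable separable_moll_kernel by blast

lemma mollify_smooth: "sq f \<Longrightarrow> smooth_fn (mollify n f)" "sq f \<Longrightarrow> periodic_fn (mollify n f)"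
  using kernel_op_smooth[OF separable_moll_kernel integrable_sq] by (auto simp: mollify_def)

lemma sq_mollify: "sq f \<Longrightarrow> sq (mollify n f)"
  by (simp add: mollify_smooth smooth_periodic_L2)

lemma mollify_diff: "sq f \<Longrightarrow> sq g \<Longrightarrow> mollify n (\<lambda>x. f x - g x) = (\<lambda>x. mollify n f x - mollify n g x)"
  by (auto simp: mollify_def kernel_op_def left_diff_distrib integrable_moll integrable_sq)

text \<open>Jensen's inequality for the probability density \<^term>\<open>moll_kernel n x\<close>, in the form
  $\int (f(y) - m)^2 K(x,y)\,dy \ge 0$ with $m$ the mean.\<close>

lemma mollify_norm_le:
  assumes f: "sq f" shows "l2norm (mollify n f) \<le> l2norm f"
proof -
  have f2: "integrable mcell (\<lambda>y. (f y)^2)" using f by (simp add: sq_def)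
  have jensen: "(mollify n f x)^2 \<le> mollify n (\<lambda>y. (f y)^2) x" for x
  proof -
    define m where "m = mollify n f x"
    have i1: "integrable mcell (\<lambda>y. (f y)^2 * moll_kernel n x y)" by (rule integrable_moll[OF f2])
    have i2: "integrable mcell (\<lambda>y. (2 * m) * (f y * moll_kernel n x y))"
      using integrable_moll[OF integrable_sq[OF f]] by simp
    have i3: "integrable mcell (\<lambda>y. m^2 * moll_kernel n x y)"
      by (intro integrable_mult_right integrable_continuous_mcell continuous_moll_kernel)
    have "0 \<le> integral\<^sup>L mcell (\<lambda>y. (f y - m)^2 * moll_kernel n x y)"
      by (simp add: moll_kernel_nonneg)
    also have "(\<lambda>y. (f y - m)^2 * moll_kernel n x y) = (\<lambda>y. (f y)^2 * moll_kernel n x y -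
        (2 * m) * (f y * moll_kernel n x y) + m^2 * moll_kernel n x y)"
      by (auto simp: power2_diff algebra_simps)
    also have "integral\<^sup>L mcell \<dots> = mollify n (\<lambda>y. (f y)^2) x - 2 * m * m + m^2 * 1"
      using i1 i2 i3 integral_moll_kernel(1)[of n x]
      by (simp add: mollify_def kernel_op_def m_def)
    finally show ?thesis by (simp add: m_def power2_eq_square)
  qed
  have "(l2norm (mollify n f))^2 = integral\<^sup>L mcell (\<lambda>x. (mollify n f x)^2)"
    by (simp add: l2norm_sq ip_def flip: power2_eq_square)
  also have "\<dots> \<le> integral\<^sup>L mcell (mollify n (\<lambda>y. (f y)^2))"
  proof (rule integral_mono)
    show "integrable mcell (\<lambda>x. (mollify n f x)^2)" using sq_mollify[OF f, of n] by (simp add: sq_def)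
    show "integrable mcell (mollify n (\<lambda>y. (f y)^2))"
      using kernel_op_smooth[OF separable_moll_kernel f2, of n]
      by (auto simp: mollify_def intro!: integrable_continuous_mcell smooth_continuous)
  qed (rule jensen)
  also have "\<dots> = integral\<^sup>L mcell (\<lambda>y. (f y)^2)"
    using integral_kernel_op[OF separable_moll_kernel f2, of n] by (simp add: mollify_def integral_moll_kernel)
  also have "\<dots> = (l2norm f)^2" by (simp add: l2norm_sq ip_def flip: power2_eq_square)
  finally show ?thesis by (rule power2_le_imp_le) simp
qed

text \<open>The value 1 is attained exactly at lattice points, and the bound on the coordinates
  leaves only the origin.\<close>

lemma bump_eq_1: "bump z = 1 \<Longrightarrow> (\<And>i. \<bar>z $ i\<bar> < 1) \<Longrightarrow> z = 0" for z :: "real^'d::finite"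
proof -
  assume b: "bump z = 1" and z: "\<And>i. \<bar>z $ i\<bar> < 1"
  have "z $ i = 0" for i
  proof -
    let ?f = "\<lambda>i. (1 + cos (2 * pi * z $ i)) / 2"
    have "bump z = ?f i * (\<Prod>j\<in>UNIV - {i}. ?f j)"
      unfolding bump_def by (subst prod.remove[of _ i]) auto
    also have "\<dots> \<le> ?f i * 1"
      by (intro mult_left_mono prod_le_1 conjI ballI bump_factor)
    finally have "cos (2 * pi * z $ i) = 1"
      using b cos_le_one[of "2 * pi * z $ i"] by simp
    then obtain k :: int where "2 * pi * z $ i = of_int k * 2 * pi" by (auto simp: cos_one_2pi_int)
    then have "z $ i = of_int k" by simp
    with z[of i] show ?thesis by simp
  qed
  then show "z = 0" by (simp add: vec_eq_iff)
qed

text \<open>\<open>g\<close> is merely continuous on the cell and may differ on opposite faces. For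
  \<open>x\<close> on a face the kernel would also concentrate at the opposite face; an interior
  \<open>x\<close> is the only point of the cell with full kernel weight.\<close>

lemma mollify_pointwise:
  fixes g :: "('d::finite) fn"
  assumes g: "continuous_on UNIV g" and x: "x \<in> box 0 One"
  shows "(\<lambda>n. mollify n g x) \<longlonglongrightarrow> g x"
proof (rule LIMSEQ_I)
  fix e :: real assume e: "e > 0"
  obtain B where B: "\<And>y. y \<in> cell \<Longrightarrow> \<bar>g y\<bar> \<le> B" using continuous_bounded_cell[OF g] by blast
  have xc: "x \<in> cell" using x box_subset_cbox unfolding cell_def by blast
  have B0: "0 \<le> B" using B[OF xc] by linarith
  obtain d where d: "d > 0" "\<And>y. dist y x < d \<Longrightarrow> \<bar>g y - g x\<bar> < e / 2"
    using g e unfolding continuous_on_iff dist_real_def by (meson UNIV_I half_gt_zero)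
  define F where "F = cell - ball x d"
  have F: "compact F" unfolding F_def cell_def by (intro compact_diff) auto
  obtain r where r: "0 < r" "r < 1" "\<And>y. y \<in> F \<Longrightarrow> bump (y - x) \<le> r"
  proof (cases "F = {}")
    case True
    then show ?thesis using that[of "1/2"] by auto
  next
    case False
    have "continuous_on F (\<lambda>y. bump (y - x))"
      by (intro continuous_on_compose2[OF continuous_bump[of UNIV]] continuous_intros) auto
    then obtain y where y: "y \<in> F" "\<And>z. z \<in> F \<Longrightarrow> bump (z - x) \<le> bump (y - x)"
      using continuous_attains_sup[OF F False] by blast
    have "\<bar>(y - x) $ i\<bar> < 1" for i
    proof -
      have "0 \<le> y $ i" "y $ i \<le> 1" using y(1) by (auto simp: F_def mem_cell)
      moreover have "0 < x $ i" "x $ i < 1" using x unfolding mem_box_cart One_component by auto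
      ultimately show ?thesis by simp
    qed
    then have "bump (y - x) \<noteq> 1" using bump_eq_1[of "y - x"] y(1) d(1) by (auto simp: F_def)
    then have "bump (y - x) < 1" using bump_range(2)[of "y - x"] by simp
    then show ?thesis using that[of "max (1/2) (bump (y - x))"] y(2) by (force simp: le_max_iff_disj)
  qed
  \<comment> \<open>Any number strictly between \<open>r\<close> and 1 serves: away from
    \<open>x\<close> the normalised kernel is at most a multiple of
    \<open>(r / s) ^ n\<close>.\<close>
  define s where "s = (1 + r) / 2"
  have s: "0 < s" "s < 1" "r < s" using r by (auto simp: s_def)
  obtain m where m: "m > 0" "\<And>n. m * s ^ n \<le> bump_mass TYPE('d) n"
    using bump_mass_lower[OF s(1,2), where 'd = 'd] by blast
  have "(\<lambda>n. 2 * B / m * (r / s) ^ n) \<longlonglongrightarrow> 2 * B / m * 0"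
    using r s by (intro tendsto_mult tendsto_const LIMSEQ_power_zero) auto
  then have "\<forall>\<^sub>F n in sequentially. 2 * B / m * (r / s) ^ n < e / 2"
    using e by (intro order_tendstoD(2)[where y = 0]) auto
  then obtain N where N: "\<And>n. n \<ge> N \<Longrightarrow> 2 * B / m * (r / s) ^ n < e / 2"
    unfolding eventually_sequentially by blast
  have "\<bar>mollify n g x - g x\<bar> < e" if n: "n \<ge> N" for n
  proof -
    let ?K = "moll_kernel n x"
    let ?b = "2 * B / m * (r / s) ^ n"
    have iK: "integrable mcell ?K" by (intro integrable_continuous_mcell continuous_moll_kernel)
    have ig: "integrable mcell (\<lambda>y. g y * ?K y)" by (intro integrable_moll integrable_continuous_mcell g)
    have ie: "integrable mcell (\<lambda>y. e / 2 * ?K y)" using iK by (rule integrable_mult_right)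
    have ib: "integrable mcell (\<lambda>y::real^'d. ?b)" by (intro integrable_continuous_mcell continuous_on_const)
    have far: "\<bar>g y - g x\<bar> * ?K y \<le> ?b" if "y \<in> F" for y
    proof -
      have "?K y \<le> r ^ n / (m * s ^ n)" unfolding moll_kernel_def
        using r that m s bump_range(1)[of "y - x"] by (intro frac_le power_mono) auto
      moreover have "\<bar>g y - g x\<bar> \<le> 2 * B" using B[OF xc] B[of y] that by (auto simp: F_def)
      ultimately have "\<bar>g y - g x\<bar> * ?K y \<le> (2 * B) * (r ^ n / (m * s ^ n))"
        using moll_kernel_nonneg B0 by (intro mult_mono) auto
      then show ?thesis by (simp add: power_divide)
    qed
    have b0: "0 \<le> ?b" using B0 m s r by simp
    have pw: "\<bar>g y - g x\<bar> * ?K y \<le> e / 2 * ?K y + ?b" if "y \<in> cell" for y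
    proof (cases "y \<in> F")
      case True
      then show ?thesis using far[OF True] e moll_kernel_nonneg[of n x y]
        by (smt (verit) half_gt_zero mult_nonneg_nonneg)
    next
      case False
      then have "\<bar>g y - g x\<bar> \<le> e / 2" using d(2)[of y] that by (auto simp: F_def dist_commute)
      then have "\<bar>g y - g x\<bar> * ?K y \<le> e / 2 * ?K y" by (intro mult_right_mono moll_kernel_nonneg)
      then show ?thesis using b0 by linarith
    qed
    have "mollify n g x - g x = integral\<^sup>L mcell (\<lambda>y. g y * ?K y) - g x * integral\<^sup>L mcell ?K"
      by (simp add: mollify_def kernel_op_def integral_moll_kernel)
    also have "\<dots> = integral\<^sup>L mcell (\<lambda>y. (g y - g x) * ?K y)"
      using ig iK by (simp add: left_diff_distrib)
    finally have "\<bar>mollify n g x - g x\<bar> \<le> integral\<^sup>L mcell (\<lambda>y. \<bar>(g y - g x) * ?K y\<bar>)" by simp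
    also have "\<dots> \<le> integral\<^sup>L mcell (\<lambda>y. e / 2 * ?K y + ?b)"
    proof (rule integral_mono_AE)
      show "integrable mcell (\<lambda>y. \<bar>(g y - g x) * ?K y\<bar>)"
        using ig iK by (intro integrable_abs) (simp add: left_diff_distrib)
      show "integrable mcell (\<lambda>y. e / 2 * ?K y + ?b)" using ie ib by (rule Bochner_Integration.integrable_add)
      show "AE y in mcell. \<bar>(g y - g x) * ?K y\<bar> \<le> e / 2 * ?K y + ?b"
        using pw by (intro AE_mcell_I) (simp add: abs_mult moll_kernel_nonneg)
    qed
    also have "\<dots> = e / 2 + ?b"
      using measure_mcell_space[where ?'a = 'd] Bochner_Integration.integral_add[OF ie ib]
      by (simp add: integral_moll_kernel)
    finally show ?thesis using N[OF n] by linarith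
  qed
  then show "\<exists>N. \<forall>n\<ge>N. norm (mollify n g x - g x) < e" by auto
qed

lemma AE_interior_cell: "AE x in mcell. x \<in> box 0 (One::real^'d::finite)"
proof -
  have "negligible (cbox 0 (One::real^'d) - box 0 One)" by (rule negligible_frontier_interval)
  then have "AE x in lebesgue. x \<notin> cbox 0 (One::real^'d) - box 0 One"
    unfolding negligible_iff_null_sets by (rule AE_not_in)
  then have "AE x in lebesgue. x \<in> cbox 0 (One::real^'d) \<longrightarrow> x \<in> box 0 One"
    by (rule eventually_mono) blast
  then show ?thesis using AE_restrict_space_iff[of "cbox 0 (One::real^'d)" lebesgue] unfolding cell_def by simp
qed

section \<open>Convergence of mollifications in L2\<close>

lemma l2norm_tendsto_zeroI:
  fixes s :: "nat \<Rightarrow> ('d::finite) fn"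
  assumes s: "\<And>n. sq (s n)" and w: "integrable mcell w"
    and le: "\<And>n. AE x in mcell. (s n x)^2 \<le> w x" and lim: "AE x in mcell. (\<lambda>n. s n x) \<longlonglongrightarrow> 0"
  shows "(\<lambda>n. l2norm (s n)) \<longlonglongrightarrow> 0"
proof -
  have "(\<lambda>n. integral\<^sup>L mcell (\<lambda>x. (s n x)^2)) \<longlonglongrightarrow> integral\<^sup>L mcell (\<lambda>x::real^'d. 0)"
  proof (rule integral_dominated_convergence[where w = w])
    show "AE x in mcell. (\<lambda>n. (s n x)^2) \<longlonglongrightarrow> 0"
      using lim by eventually_elim (auto intro: tendsto_eq_intros)
    show "(\<lambda>x. (s n x)^2) \<in> borel_measurable mcell" for n using s[of n] by (auto simp: sq_def)
  qed (use le w in auto)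
  then have "(\<lambda>n. sqrt (integral\<^sup>L mcell (\<lambda>x. (s n x)^2))) \<longlonglongrightarrow> sqrt 0"
    by (intro tendsto_real_sqrt) simp
  then show ?thesis by (simp add: l2norm_def)
qed

lemma mollify_continuous:
  fixes g :: "('d::finite) fn"
  assumes g: "continuous_on UNIV g"
  shows "(\<lambda>n. l2dist (mollify n g) g) \<longlonglongrightarrow> 0"
proof -
  obtain B where B: "\<And>y. y \<in> cell \<Longrightarrow> \<bar>g y\<bar> \<le> B" using continuous_bounded_cell[OF g] by blast
  have sg: "sq g" using g by (rule sq_continuous)
  have mb: "\<bar>mollify n g x\<bar> \<le> B" for n x
  proof -
    have iK: "integrable mcell (moll_kernel n x)" by (intro integrable_continuous_mcell continuous_moll_kernel)
    have "\<bar>mollify n g x\<bar> \<le> integral\<^sup>L mcell (\<lambda>y. \<bar>g y * moll_kernel n x y\<bar>)"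
      by (simp add: mollify_def kernel_op_def)
    also have "\<dots> \<le> integral\<^sup>L mcell (\<lambda>y. B * moll_kernel n x y)"
    proof (rule integral_mono_AE)
      show "integrable mcell (\<lambda>y. \<bar>g y * moll_kernel n x y\<bar>)"
        using integrable_moll[OF integrable_sq[OF sg]] by (rule integrable_abs)
      show "integrable mcell (\<lambda>y. B * moll_kernel n x y)" using iK by simp
      show "AE y in mcell. \<bar>g y * moll_kernel n x y\<bar> \<le> B * moll_kernel n x y"
        using B by (intro AE_mcell_I) (simp add: abs_mult moll_kernel_nonneg mult_right_mono)
    qed
    also have "\<dots> = B" by (simp add: integral_moll_kernel)
    finally show ?thesis .
  qed
  show ?thesis
  proof (rule l2norm_tendsto_zeroI[where w = "\<lambda>_. (2 * B)^2"])
    show "sq (\<lambda>x. mollify n g x - g x)" for n using sg sq_mollify by auto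
    show "AE x in mcell. (mollify n g x - g x)^2 \<le> (2 * B)^2" for n
    proof (rule AE_mcell_I)
      fix x :: "real^'d" assume "x \<in> cell"
      then have "\<bar>mollify n g x - g x\<bar> \<le> 2 * B" using B[of x] mb[of n x] by linarith
      then show "(mollify n g x - g x)^2 \<le> (2 * B)^2" by (metis abs_ge_zero power2_abs power_mono)
    qed
    show "AE x in mcell. (\<lambda>n. mollify n g x - g x) \<longlonglongrightarrow> 0"
      using AE_interior_cell by eventually_elim (auto simp: LIM_zero_iff intro: mollify_pointwise[OF g])
    show "integrable mcell (\<lambda>_::real^'d. (2 * B)^2)" by (intro integrable_continuous_mcell continuous_on_const)
  qed
qed

definition clamp_abs :: "real \<Rightarrow> real \<Rightarrow> real" where
  "clamp_abs m t = max (- m) (min m t)"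

lemma clamp_abs_le: "0 \<le> m \<Longrightarrow> \<bar>clamp_abs m t\<bar> \<le> m"
  by (auto simp: clamp_abs_def)

text \<open>Truncation of \<open>f\<close> comes first because measurability supplies continuous
  approximants that converge only pointwise; clamping these at the same level gives the bound needed
  for dominated convergence.\<close>

lemma continuous_dense:
  fixes f :: "('d::finite) fn"
  assumes f: "sq f" and e: "e > 0"
  shows "\<exists>g. continuous_on UNIV g \<and> l2dist f g < e"
proof -
  have mf: "f \<in> borel_measurable mcell" using f by (simp add: sq_def)
  have ci: "integrable mcell (\<lambda>x::real^'d. a)" for a :: real by (intro integrable_continuous_mcell continuous_on_const)
  have mt: "(\<lambda>x. clamp_abs m (f x)) \<in> borel_measurable mcell" for m
    unfolding clamp_abs_def using mf by measurable
  have st: "sq (\<lambda>x. clamp_abs (real m) (f x))" for m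
    unfolding sq_def
  proof (intro conjI mt Bochner_Integration.integrable_bound[OF ci[of "(real m)^2"]] AE_I2)
    show "(\<lambda>x. (clamp_abs (real m) (f x))^2) \<in> borel_measurable mcell" using mt by measurable
    show "norm ((clamp_abs (real m) (f x))^2) \<le> norm ((real m)^2)" for x
      using clamp_abs_le[of "real m" "f x"] by (simp add: abs_le_square_iff[symmetric])
  qed
  have "(\<lambda>m. l2norm (\<lambda>x. f x - clamp_abs (real m) (f x))) \<longlonglongrightarrow> 0"
  proof (rule l2norm_tendsto_zeroI[where w = "\<lambda>x. (f x)^2"])
    show "sq (\<lambda>x. f x - clamp_abs (real m) (f x))" for m using f st by auto
    show "AE x in mcell. (f x - clamp_abs (real m) (f x))^2 \<le> (f x)^2" for m
      by (intro AE_I2) (auto simp: clamp_abs_def abs_le_square_iff[symmetric])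
    show "AE x in mcell. (\<lambda>m. f x - clamp_abs (real m) (f x)) \<longlonglongrightarrow> 0"
    proof (intro AE_I2 tendsto_eventually)
      fix x
      show "\<forall>\<^sub>F m in sequentially. f x - clamp_abs (real m) (f x) = 0"
        using eventually_ge_at_top[of "nat \<lceil>\<bar>f x\<bar>\<rceil>"]
      proof eventually_elim
        case (elim m)
        then have "\<bar>f x\<bar> \<le> real m" by linarith
        then show ?case by (auto simp: clamp_abs_def)
      qed
    qed
  qed (use f in \<open>simp add: sq_def\<close>)
  then have "\<forall>\<^sub>F m in sequentially. l2norm (\<lambda>x. f x - clamp_abs (real m) (f x)) < e / 2"
    using e by (intro order_tendstoD(2)[where y = 0]) auto
  then obtain m :: nat where m: "l2norm (\<lambda>x. f x - clamp_abs (real m) (f x)) < e / 2"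
    by (auto dest: eventually_happens)
  let ?F = "\<lambda>x. clamp_abs (real m) (f x)"
  have "?F measurable_on cell" using mt by (simp add: measurable_on_iff_borel_measurable)
  then obtain N G where N: "negligible N" and G: "\<And>n. continuous_on UNIV (G n)"
    and lim: "\<And>x. x \<notin> N \<Longrightarrow> (\<lambda>n. G n x) \<longlonglongrightarrow> (if x \<in> cell then ?F x else 0)"
    unfolding measurable_on_def by blast
  define g where "g n x = clamp_abs (real m) (G n x)" for n :: nat and x
  have cg: "continuous_on UNIV (g n)" for n
    unfolding g_def clamp_abs_def by (intro continuous_intros G)
  have "(\<lambda>n. l2dist ?F (g n)) \<longlonglongrightarrow> 0"
  proof (rule l2norm_tendsto_zeroI[where w = "\<lambda>x. (2 * real m)^2"])
    show "sq (\<lambda>x. ?F x - g n x)" for n using st sq_continuous[OF cg] by auto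
    show "AE x in mcell. (?F x - g n x)^2 \<le> (2 * real m)^2" for n
    proof (rule AE_I2)
      fix x
      have "\<bar>?F x - g n x\<bar> \<le> 2 * real m"
        using clamp_abs_le[of "real m" "f x"] clamp_abs_le[of "real m" "G n x"] unfolding g_def by linarith
      then show "(?F x - g n x)^2 \<le> (2 * real m)^2" by (metis abs_ge_zero power2_abs power_mono)
    qed
    have "AE x in mcell. x \<notin> N"
    proof -
      have "AE x in lebesgue. x \<notin> N" using N unfolding negligible_iff_null_sets by (rule AE_not_in)
      then show ?thesis by (auto simp: AE_restrict_space_iff)
    qed
    then show "AE x in mcell. (\<lambda>n. ?F x - g n x) \<longlonglongrightarrow> 0"
      using AE_space[of mcell]
    proof eventually_elim
      case (elim x)
      then have "(\<lambda>n. G n x) \<longlonglongrightarrow> ?F x" using lim[of x] by simp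
      then have "(\<lambda>n. g n x) \<longlonglongrightarrow> clamp_abs (real m) (?F x)"
        unfolding g_def clamp_abs_def by (intro tendsto_intros)
      also have "clamp_abs (real m) (?F x) = ?F x" by (auto simp: clamp_abs_def)
      finally show ?case by (auto intro: tendsto_eq_intros)
    qed
  qed (rule ci)
  then have "\<forall>\<^sub>F n in sequentially. l2dist ?F (g n) < e / 2"
    using e by (intro order_tendstoD(2)[where y = 0]) auto
  then obtain n where n: "l2dist ?F (g n) < e / 2" by (auto dest: eventually_happens)
  have "l2dist f (g n) < e"
    using l2norm_triangle3[OF f st sq_continuous[OF cg[of n]], of m] m n by linarith
  then show ?thesis using cg by blast
qed

text \<open>Mollifiers are contractions by \<open>mollify_norm_le\<close>, so convergence on the
  dense set of continuous functions suffices.\<close>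

lemma mollify_tendsto:
  assumes f: "sq f" shows "(\<lambda>n. l2dist (mollify n f) f) \<longlonglongrightarrow> 0"
proof (rule LIMSEQ_I)
  fix e :: real assume e: "e > 0"
  obtain g where g: "continuous_on UNIV g" "l2dist f g < e / 3"
    using continuous_dense[OF f, of "e / 3"] e by auto
  have sg: "sq g" using g(1) by (rule sq_continuous)
  obtain N where N: "\<And>n. n \<ge> N \<Longrightarrow> l2dist (mollify n g) g < e / 3"
    using LIMSEQ_D[OF mollify_continuous[OF g(1)], of "e / 3"] e by auto
  have "l2dist (mollify n f) f < e" if "n \<ge> N" for n
  proof -
    have "l2dist (mollify n f) (mollify n g) \<le> l2dist f g"
      using mollify_norm_le[of "\<lambda>x. f x - g x" n] f sg by (simp add: mollify_diff)
    then show ?thesis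
      using l2norm_triangle3[OF sq_mollify[OF f, of n] sq_mollify[OF sg, of n] f]
        l2norm_triangle3[OF sq_mollify[OF sg, of n] sg f] N[OF that] g(2)
      by (simp add: l2norm_diff_commute[of g f])
  qed
  then show "\<exists>N. \<forall>n\<ge>N. norm (l2dist (mollify n f) f - 0) < e" by auto
qed

lemma has_pd_reflect:
  assumes "has_pd i q (y - x) D" shows "has_pd i (\<lambda>x. q (y - x)) x (- D)"
proof -
  have "((\<lambda>h. q (y - x + (- h) *\<^sub>R axis i 1)) has_real_derivative - D) (at 0)"
    by (rule iffD1[OF DERIV_mirror]) (use assms in \<open>simp add: has_pd_def\<close>)
  then show ?thesis by (simp add: has_pd_def algebra_simps)
qed

lemma has_pd_translate: "has_pd i q (y - x) D \<Longrightarrow> has_pd i (\<lambda>y. q (y - x)) y D"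
  by (simp add: has_pd_def algebra_simps)

text \<open>The kernel depends only on \<open>y - x\<close>, so its \<open>x\<close>-derivative is
  minus its \<open>y\<close>-derivative; as a function of \<open>y\<close> it is a periodic smooth
  test function, and the definition of the weak derivative moves the derivative to
  \<open>f\<close>.\<close>

lemma pd_mollify:
  assumes f: "sq f" and g: "is_weak_deriv [i] f g"
  shows "pd i (mollify n f) = mollify n g"
proof
  fix x
  define q where "q = moll_kernel n (0::real^'a)"
  have "has_pd i q (y - x) (pd i q (y - x))" for y
    unfolding q_def using separable_kernel_smooth[OF separable_moll_kernel] by (intro smooth_has_pd) blast
  then have q: "has_pd i (\<lambda>x. q (y - x)) x (- pd i q (y - x))"
    "has_pd i (\<lambda>y. q (y - x)) y (pd i q (y - x))" for y
    by (auto intro: has_pd_reflect has_pd_translate)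
  have k: "moll_kernel n = (\<lambda>x y. q (y - x))" by (intro ext) (simp add: moll_kernel_def q_def)
  have e: "pd i (\<lambda>x. moll_kernel n x y) x = - pd i (moll_kernel n x) y" for y
    unfolding k by (simp add: has_pd_pd[OF q(1)] has_pd_pd[OF q(2)])
  have "pd i (mollify n f) x = integral\<^sup>L mcell (\<lambda>y. f y * pd i (\<lambda>x. moll_kernel n x y) x)"
    using pd_kernel_op[OF separable_moll_kernel integrable_sq[OF f], of i n] by (simp add: mollify_def kernel_op_def)
  also have "\<dots> = - integral\<^sup>L mcell (\<lambda>y. f y * dlist [i] (moll_kernel n x) y)" by (simp add: e)
  also have "\<dots> = mollify n g x"
    using g separable_kernel_smooth[OF separable_moll_kernel, of n x]
    by (simp add: is_weak_deriv_def mollify_def kernel_op_def)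
  finally show "pd i (mollify n f) x = mollify n g x" .
qed

section \<open>Weak derivatives and calculus in L2\<close>

lemma ip_divide_right: "ip h (\<lambda>x. f x / a) = ip h f / a"
  unfolding ip_commute[of h] by (rule ip_divide_left)

lemma ip_tendsto:
  assumes F: "F \<noteq> bot" and sq: "\<forall>\<^sub>F h in F. sq (f h) \<and> sq (g h)" "sq f0" "sq g0"
    and f: "((\<lambda>h. l2dist (f h) f0) \<longlongrightarrow> 0) F"
    and g: "((\<lambda>h. l2dist (g h) g0) \<longlongrightarrow> 0) F"
  shows "((\<lambda>h. ip (f h) (g h)) \<longlongrightarrow> ip f0 g0) F"
proof -
  let ?a = "\<lambda>h. l2dist (f h) f0" and ?b = "\<lambda>h. l2dist (g h) g0"
  have "((\<lambda>h. ?a h * ?b h + ?a h * l2norm g0 + l2norm f0 * ?b h) \<longlongrightarrow> 0 * 0 + 0 * l2norm g0 + l2norm f0 * 0) F"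
    by (intro tendsto_intros f g)
  then have "((\<lambda>h. ?a h * ?b h + ?a h * l2norm g0 + l2norm f0 * ?b h) \<longlongrightarrow> 0) F" by simp
  then have "((\<lambda>h. ip (f h) (g h) - ip f0 g0) \<longlongrightarrow> 0) F"
  proof (rule Lim_null_comparison[rotated])
    show "\<forall>\<^sub>F h in F. norm (ip (f h) (g h) - ip f0 g0) \<le> ?a h * ?b h + ?a h * l2norm g0 + l2norm f0 * ?b h"
      using sq(1)
    proof eventually_elim
      case (elim h)
      then have "ip (f h) (g h) - ip f0 g0 = ip (\<lambda>x. f h x - f0 x) (\<lambda>x. g h x - g0 x) +
          ip (\<lambda>x. f h x - f0 x) g0 + ip f0 (\<lambda>x. g h x - g0 x)"
        using sq by (simp add: ip_diff_left ip_diff_right)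
      moreover have "\<bar>ip (\<lambda>x. f h x - f0 x) (\<lambda>x. g h x - g0 x)\<bar> \<le> ?a h * ?b h"
        "\<bar>ip (\<lambda>x. f h x - f0 x) g0\<bar> \<le> ?a h * l2norm g0" "\<bar>ip f0 (\<lambda>x. g h x - g0 x)\<bar> \<le> l2norm f0 * ?b h"
        using elim sq by (auto intro!: ip_Cauchy_Schwarz)
      ultimately show ?case by simp
    qed
  qed
  then show ?thesis by (rule LIM_zero_cancel)
qed

lemma l2norm_tendsto:
  assumes "F \<noteq> bot" "\<forall>\<^sub>F h in F. sq (f h)" "sq f0" "((\<lambda>h. l2dist (f h) f0) \<longlongrightarrow> 0) F"
  shows "((\<lambda>h. l2norm (f h)) \<longlongrightarrow> l2norm f0) F"
  unfolding l2norm_eq using assms by (intro tendsto_real_sqrt ip_tendsto) (auto elim: eventually_mono)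

lemma is_weak_deriv_iff:
  "is_weak_deriv \<alpha> f g \<longleftrightarrow> g \<in> L2 \<and>
     (\<forall>\<phi>. smooth_fn \<phi> \<longrightarrow> periodic_fn \<phi> \<longrightarrow> ip f (dlist \<alpha> \<phi>) = (-1) ^ length \<alpha> * ip g \<phi>)"
  by (auto simp: is_weak_deriv_def ip_def)

lemma is_weak_derivD:
  assumes "is_weak_deriv \<alpha> f g" shows "g \<in> L2"
    "smooth_fn \<phi> \<Longrightarrow> periodic_fn \<phi> \<Longrightarrow> ip f (dlist \<alpha> \<phi>) = (-1) ^ length \<alpha> * ip g \<phi>"
  using assms by (auto simp: is_weak_deriv_iff)

lemma sq_dlist: "smooth_fn \<phi> \<Longrightarrow> sq (dlist \<alpha> \<phi>)"
  by (intro sq_continuous smooth_continuous smooth_dlist)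

lemma is_weak_deriv_add:
  assumes "is_weak_deriv \<alpha> f g" "is_weak_deriv \<alpha> f' g'" "sq f" "sq f'"
  shows "is_weak_deriv \<alpha> (\<lambda>x. f x + f' x) (\<lambda>x. g x + g' x)"
  unfolding is_weak_deriv_iff
proof (intro conjI allI impI)
  show "(\<lambda>x. g x + g' x) \<in> L2" using assms is_weak_derivD(1) by auto
  fix \<phi> :: "'a fn" assume \<phi>: "smooth_fn \<phi>" "periodic_fn \<phi>"
  have "sq \<phi>" "sq (dlist \<alpha> \<phi>)" using \<phi> sq_dlist[of \<phi> "[]"] sq_dlist by auto
  then show "ip (\<lambda>x. f x + f' x) (dlist \<alpha> \<phi>) = (- 1) ^ length \<alpha> * ip (\<lambda>x. g x + g' x) \<phi>"
    using assms is_weak_derivD(1)[OF assms(1)] is_weak_derivD(1)[OF assms(2)] \<phi>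
    by (simp add: ip_add_left is_weak_derivD(2)[OF assms(1) \<phi>] is_weak_derivD(2)[OF assms(2) \<phi>] distrib_left)
qed

lemma is_weak_deriv_cmult:
  assumes "is_weak_deriv \<alpha> f g" shows "is_weak_deriv \<alpha> (\<lambda>x. a * f x) (\<lambda>x. a * g x)"
  using assms by (auto simp: is_weak_deriv_iff ip_cmult_left)

lemma is_weak_deriv_diff:
  assumes "is_weak_deriv \<alpha> f g" "is_weak_deriv \<alpha> f' g'" "sq f" "sq f'"
  shows "is_weak_deriv \<alpha> (\<lambda>x. f x - f' x) (\<lambda>x. g x - g' x)"
  using is_weak_deriv_add[OF assms(1) is_weak_deriv_cmult[OF assms(2), of "-1"] assms(3)] assms(4) by simp

text \<open>Use \<open>c * \<phi>\<close> as test function for \<open>f\<close> and expand its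
  derivative by the product rule.\<close>

lemma is_weak_deriv_smooth_mult:
  assumes c: "smooth_fn c" "periodic_fn c" and f: "f \<in> L2" and g: "is_weak_deriv [i] f g"
  shows "is_weak_deriv [i] (\<lambda>x. c x * f x) (\<lambda>x. c x * g x + pd i c x * f x)"
  unfolding is_weak_deriv_iff
proof (intro conjI allI impI)
  have gL: "g \<in> L2" using g by (rule is_weak_derivD)
  have cs: "continuous_on UNIV c" "continuous_on UNIV (pd i c)" using c by (auto intro: smooth_continuous smooth_pd)
  have s: "sq (\<lambda>x. c x * g x)" "sq (\<lambda>x. pd i c x * f x)" using cs f gL by (auto intro: sq_mult_continuous)
  then show "(\<lambda>x. c x * g x + pd i c x * f x) \<in> L2"
    using c f gL by (intro L2_I sq_add periodic_add periodic_mult periodic_pd) auto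
  fix \<phi> :: "'a fn" assume \<phi>: "smooth_fn \<phi>" "periodic_fn \<phi>"
  have sp: "sq \<phi>" using \<phi> sq_dlist[of \<phi> "[]"] by simp
  have "ip f (dlist [i] (\<lambda>x. c x * \<phi> x)) = - ip g (\<lambda>x. c x * \<phi> x)"
    using is_weak_derivD(2)[OF g, of "\<lambda>x. c x * \<phi> x"] c \<phi> by (simp add: smooth_mult)
  also have "dlist [i] (\<lambda>x. c x * \<phi> x) = (\<lambda>x. pd i c x * \<phi> x + c x * pd i \<phi> x)"
    using c \<phi> by (simp add: pd_mult mult.commute add.commute)
  also have "ip f \<dots> = ip f (\<lambda>x. pd i c x * \<phi> x) + ip f (\<lambda>x. c x * pd i \<phi> x)"
    using f c \<phi> by (intro ip_add_right) (auto intro!: sq_continuous smooth_continuous smooth_mult smooth_pd)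
  finally have "ip (\<lambda>x. c x * f x) (pd i \<phi>) = - (ip (\<lambda>x. c x * g x) \<phi> + ip (\<lambda>x. pd i c x * f x) \<phi>)"
    by (simp add: ip_def mult_ac)
  then show "ip (\<lambda>x. c x * f x) (dlist [i] \<phi>) = (- 1) ^ length [i] * ip (\<lambda>x. c x * g x + pd i c x * f x) \<phi>"
    using s sp by (simp add: ip_add_left)
qed

text \<open>For smooth \<open>g\<close> both sides equal the pairing of \<open>w\<close> with the
  second derivative of \<open>g\<close>. Mollifying \<open>g\<close>, and leaving \<open>w\<close>
  alone, provides admissible test functions whose derivatives converge by
  \<open>pd_mollify\<close>.\<close>

lemma weak_integration_by_parts:
  assumes w: "is_weak_deriv [i] w w1" "is_weak_deriv [i, i] w w2"
    and g: "sq g" "is_weak_deriv [i] g g1"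
  shows "ip w2 g = - ip w1 g1"
proof -
  have L: "sq w1" "sq w2" "sq g1" using w g is_weak_derivD(1) by blast+
  have "ip w2 (mollify n g) = - ip w1 (mollify n g1)" for n
  proof -
    have s: "smooth_fn (mollify n g)" "periodic_fn (mollify n g)"
      "smooth_fn (pd i (mollify n g))" "periodic_fn (pd i (mollify n g))"
      using mollify_smooth[OF g(1)] by (auto intro: smooth_pd periodic_pd)
    show ?thesis
      using is_weak_derivD(2)[OF w(2) s(1,2)] is_weak_derivD(2)[OF w(1) s(3,4)]
      by (simp add: pd_mollify[OF g])
  qed
  moreover have "(\<lambda>n. ip w2 (mollify n g)) \<longlonglongrightarrow> ip w2 g"
    using L g by (intro ip_tendsto mollify_tendsto) (simp_all add: sq_mollify)
  moreover have "(\<lambda>n. ip w1 (mollify n g1)) \<longlonglongrightarrow> ip w1 g1"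
    using L g by (intro ip_tendsto mollify_tendsto) (simp_all add: sq_mollify)
  then have "(\<lambda>n. - ip w1 (mollify n g1)) \<longlonglongrightarrow> - ip w1 g1" by (rule tendsto_minus)
  ultimately show ?thesis using LIMSEQ_unique by auto
qed

lemma mollify_H2: "f \<in> L2 \<Longrightarrow> mollify n f \<in> H2"
  by (intro smooth_H2 mollify_smooth) auto

text \<open>\<open>wd\<close> is a choice of representative, so the chosen derivatives of a
  difference need not be the difference of the chosen ones. Carrying the derivatives as explicit
  data makes them linear on the nose.\<close>

definition has_grad :: "('d::finite) fn \<Rightarrow> ('d \<Rightarrow> 'd fn) \<Rightarrow> bool" where
  "has_grad f D \<longleftrightarrow> f \<in> L2 \<and> (\<forall>i. is_weak_deriv [i] f (D i))"

definition has_grad2 :: "('d::finite) fn \<Rightarrow> ('d \<Rightarrow> 'd fn) \<Rightarrow> ('d \<Rightarrow> 'd fn) \<Rightarrow> bool" where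
  "has_grad2 f D E \<longleftrightarrow> has_grad f D \<and> (\<forall>i. is_weak_deriv [i, i] f (E i))"

lemma has_grad_L2: "has_grad f D \<Longrightarrow> f \<in> L2" "has_grad f D \<Longrightarrow> D i \<in> L2"
  unfolding has_grad_def using is_weak_derivD(1) by blast+

lemma has_grad2_L2: "has_grad2 f D E \<Longrightarrow> has_grad f D" "has_grad2 f D E \<Longrightarrow> E i \<in> L2"
  unfolding has_grad2_def using is_weak_derivD(1) by blast+

lemma H2_has_grad2: assumes "f \<in> H2" shows "has_grad2 f (\<lambda>i. wd [i] f) (\<lambda>i. wd [i, i] f)"
proof -
  have *: "is_weak_deriv \<alpha> f (wd \<alpha> f)" if "length \<alpha> \<le> 2" for \<alpha>
  proof -
    have "\<exists>g. is_weak_deriv \<alpha> f g" using assms that by (simp add: H2_def)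
    then show ?thesis unfolding wd_def by (rule someI_ex)
  qed
  have "is_weak_deriv [i] f (wd [i] f)" "is_weak_deriv [i, i] f (wd [i, i] f)" for i by (rule *, simp)+
  then show ?thesis using assms by (simp add: has_grad2_def has_grad_def H2_def)
qed

lemma has_grad2_cmult: "has_grad2 f D E \<Longrightarrow> has_grad2 (\<lambda>x. a * f x) (\<lambda>i x. a * D i x) (\<lambda>i x. a * E i x)"
  by (auto simp: has_grad2_def has_grad_def intro: is_weak_deriv_cmult)

lemma has_grad2_diff:
  "has_grad2 f D E \<Longrightarrow> has_grad2 f' D' E' \<Longrightarrow>
    has_grad2 (\<lambda>x. f x - f' x) (\<lambda>i x. D i x - D' i x) (\<lambda>i x. E i x - E' i x)"
  by (auto simp: has_grad2_def has_grad_def intro: is_weak_deriv_diff)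

section \<open>Right derivatives and continuity of curves in L2\<close>

definition rderiv :: "(real \<Rightarrow> ('d::finite) fn) \<Rightarrow> real \<Rightarrow> 'd fn \<Rightarrow> bool" where
  "rderiv u t g \<longleftrightarrow> ((\<lambda>h. l2norm (\<lambda>x. (u (t + h) x - u t x) / h - g x)) \<longlongrightarrow> 0) (at_right 0)"

definition l2cont :: "(real \<Rightarrow> ('d::finite) fn) \<Rightarrow> real \<Rightarrow> real \<Rightarrow> bool" where
  "l2cont u a b \<longleftrightarrow> (\<forall>t\<in>{a..b}. u t \<in> L2 \<and>
     ((\<lambda>s. l2dist (u s) (u t)) \<longlongrightarrow> 0) (at t within {a..b}))"

lemma eventually_at_right_pos: "\<forall>\<^sub>F h in at_right (0::real). 0 < h"
  by (rule eventually_at_right_less)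

lemma rderiv_diff:
  assumes u: "rderiv u t g" and v: "rderiv v t k"
    and L: "\<And>s. s \<ge> t \<Longrightarrow> u s \<in> L2" "\<And>s. s \<ge> t \<Longrightarrow> v s \<in> L2" "g \<in> L2" "k \<in> L2"
  shows "rderiv (\<lambda>s x. u s x - v s x) t (\<lambda>x. g x - k x)"
  unfolding rderiv_def
proof (rule tendsto_0_le[OF _ , of _ _ _ 1])
  show "((\<lambda>h. l2norm (\<lambda>x. (u (t + h) x - u t x) / h - g x) + l2norm (\<lambda>x. (v (t + h) x - v t x) / h - k x)) \<longlongrightarrow> 0) (at_right 0)"
    using tendsto_add[OF u[unfolded rderiv_def] v[unfolded rderiv_def]] by simp
  show "\<forall>\<^sub>F h in at_right 0. norm (l2norm (\<lambda>x. (u (t + h) x - v (t + h) x - (u t x - v t x)) / h - (g x - k x)))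
    \<le> norm (l2norm (\<lambda>x. (u (t + h) x - u t x) / h - g x) + l2norm (\<lambda>x. (v (t + h) x - v t x) / h - k x)) * 1"
    using eventually_at_right_pos
  proof eventually_elim
    case (elim h)
    have "(\<lambda>x. (u (t + h) x - v (t + h) x - (u t x - v t x)) / h - (g x - k x)) =
      (\<lambda>x. ((u (t + h) x - u t x) / h - g x) - ((v (t + h) x - v t x) / h - k x))"
      by (auto simp: diff_divide_distrib)
    moreover have "sq (\<lambda>x. (u (t + h) x - u t x) / h - g x)" "sq (\<lambda>x. (v (t + h) x - v t x) / h - k x)"
      using L elim by auto
    ultimately show ?case using l2norm_triangle_diff by simp
  qed
qed

text \<open>The affine factor is the weight \<open>s / d\<close> of the splitting interpolant and
  the linear Taylor term in \<open>SC_remainder\<close>.\<close>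

lemma rderiv_affine_mult:
  assumes u: "rderiv u t g" and L: "\<And>s. s \<ge> t \<Longrightarrow> u s \<in> L2" "g \<in> L2"
  shows "rderiv (\<lambda>s x. (a + b * s) * u s x) t (\<lambda>x. (a + b * t) * g x + b * u t x)"
  unfolding rderiv_def
proof (rule tendsto_0_le[OF _ , of _ _ _ 1])
  let ?d = "\<lambda>h. l2norm (\<lambda>x. (u (t + h) x - u t x) / h - g x)"
  have "((\<lambda>h. \<bar>a + b * (t + h)\<bar> * ?d h + \<bar>b * h\<bar> * l2norm g) \<longlongrightarrow> \<bar>a + b * (t + 0)\<bar> * 0 + \<bar>b * 0\<bar> * l2norm g) (at_right 0)"
    by (intro tendsto_intros u[unfolded rderiv_def])
  then show "((\<lambda>h. \<bar>a + b * (t + h)\<bar> * ?d h + \<bar>b * h\<bar> * l2norm g) \<longlongrightarrow> 0) (at_right 0)" by simp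
  show "\<forall>\<^sub>F h in at_right 0. norm (l2norm (\<lambda>x. ((a + b * (t + h)) * u (t + h) x - (a + b * t) * u t x) / h
      - ((a + b * t) * g x + b * u t x)))
    \<le> norm (\<bar>a + b * (t + h)\<bar> * ?d h + \<bar>b * h\<bar> * l2norm g) * 1"
    using eventually_at_right_pos
  proof eventually_elim
    case (elim h)
    have "(\<lambda>x. ((a + b * (t + h)) * u (t + h) x - (a + b * t) * u t x) / h - ((a + b * t) * g x + b * u t x)) =
      (\<lambda>x. (a + b * (t + h)) * ((u (t + h) x - u t x) / h - g x) + (b * h) * g x)"
      using elim by (auto simp: field_simps)
    moreover have "sq (\<lambda>x. (u (t + h) x - u t x) / h - g x)" using L elim by auto
    ultimately show ?case
      using l2norm_triangle[of "\<lambda>x. (a + b * (t + h)) * ((u (t + h) x - u t x) / h - g x)" "\<lambda>x. (b * h) * g x"] L(2)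
      by (simp add: l2norm_cmult)
  qed
qed

lemma rderiv_const: "rderiv (\<lambda>s. f) t (\<lambda>x. 0)"
  by (simp add: rderiv_def)

lemma ip_rderiv:
  assumes u: "rderiv u t g" and v: "rderiv v t k"
    and L: "\<And>s. s \<ge> t \<Longrightarrow> u s \<in> L2" "\<And>s. s \<ge> t \<Longrightarrow> v s \<in> L2" "g \<in> L2" "k \<in> L2"
  shows "((\<lambda>s. ip (u s) (v s)) has_real_derivative (ip g (v t) + ip (u t) k)) (at_right t)"
proof -
  let ?d = "\<lambda>h x. (u (t + h) x - u t x) / h" and ?e = "\<lambda>h x. (v (t + h) x - v t x) / h"
  have ev: "\<forall>\<^sub>F h in at_right 0. sq (?d h) \<and> sq (?e h)"
    using eventually_at_right_pos by eventually_elim (use L in auto)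
  \<comment> \<open>The difference quotient of the product is written with base point
    \<open>t\<close> in both factors; the correction \<open>h * ip (?d h) (?e h)\<close> vanishes in
    the limit because both quotients converge.\<close>
  have "((\<lambda>h. ip (?d h) (v t) + h * ip (?d h) (?e h) + ip (u t) (?e h)) \<longlongrightarrow> ip g (v t) + 0 * ip g k + ip (u t) k) (at_right 0)"
    using L ev u v unfolding rderiv_def
    by (intro tendsto_intros ip_tendsto) (auto elim: eventually_mono)
  then have "((\<lambda>h. ip (?d h) (v t) + h * ip (?d h) (?e h) + ip (u t) (?e h)) \<longlongrightarrow> ip g (v t) + ip (u t) k) (at_right 0)"
    by simp
  then have "((\<lambda>h. (ip (u (t + h)) (v (t + h)) - ip (u t) (v t)) / h) \<longlongrightarrow> ip g (v t) + ip (u t) k) (at_right 0)"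
  proof (rule Lim_transform_eventually)
    show "\<forall>\<^sub>F h in at_right 0. ip (?d h) (v t) + h * ip (?d h) (?e h) + ip (u t) (?e h) =
       (ip (u (t + h)) (v (t + h)) - ip (u t) (v t)) / h"
      using eventually_at_right_pos
    proof eventually_elim
      case (elim h)
      have L': "sq (u (t + h))" "sq (u t)" "sq (v (t + h))" "sq (v t)" using L elim by auto
      have "ip (?d h) (v t) = ip (\<lambda>x. u (t + h) x - u t x) (v t) / h"
        "ip (u t) (?e h) = ip (u t) (\<lambda>x. v (t + h) x - v t x) / h"
        "h * ip (?d h) (?e h) = ip (\<lambda>x. u (t + h) x - u t x) (\<lambda>x. v (t + h) x - v t x) / h"
        using elim by (simp_all add: ip_divide_left ip_divide_right)
      then show ?case using L' elim by (simp add: ip_diff_left ip_diff_right field_simps)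
    qed
  qed
  then have "((\<lambda>y. (ip (u y) (v y) - ip (u t) (v t)) / (y - t)) \<longlongrightarrow> ip g (v t) + ip (u t) k) (at_right t)"
    by (subst filterlim_at_right_to_0) (simp add: add.commute)
  then show ?thesis by (simp add: has_field_derivative_iff)
qed

lemma l2cont_ip:
  assumes u: "l2cont u a b" and v: "l2cont v a b" shows "continuous_on {a..b} (\<lambda>s. ip (u s) (v s))"
  unfolding continuous_on_def
proof
  fix t assume t: "t \<in> {a..b}"
  show "((\<lambda>s. ip (u s) (v s)) \<longlongrightarrow> ip (u t) (v t)) (at t within {a..b})"
  proof (cases "at t within {a..b} = bot")
    case False
    show ?thesis using t u v False
      by (intro ip_tendsto) (auto simp: l2cont_def eventually_at_filter intro!: always_eventually)
  qed simp
qed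

lemma l2cont_const: "f \<in> L2 \<Longrightarrow> l2cont (\<lambda>s. f) a b"
  by (simp add: l2cont_def)

lemma l2cont_diff:
  assumes u: "l2cont u a b" and v: "l2cont v a b" shows "l2cont (\<lambda>s x. u s x - v s x) a b"
  unfolding l2cont_def
proof (intro ballI conjI)
  fix t assume t: "t \<in> {a..b}"
  then show "(\<lambda>x. u t x - v t x) \<in> L2" using u v by (auto simp: l2cont_def)
  show "((\<lambda>s. l2norm (\<lambda>x. u s x - v s x - (u t x - v t x))) \<longlongrightarrow> 0) (at t within {a..b})"
  proof (rule tendsto_0_le[OF _ , of _ _ _ 1])
    show "((\<lambda>s. l2dist (u s) (u t) + l2dist (v s) (v t)) \<longlongrightarrow> 0) (at t within {a..b})"
      using u v t tendsto_add[of "\<lambda>s. l2dist (u s) (u t)" 0 "at t within {a..b}" "\<lambda>s. l2dist (v s) (v t)" 0]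
      by (auto simp: l2cont_def)
    show "\<forall>\<^sub>F s in at t within {a..b}. norm (l2norm (\<lambda>x. u s x - v s x - (u t x - v t x)))
        \<le> norm (l2dist (u s) (u t) + l2dist (v s) (v t)) * 1"
      unfolding eventually_at_filter
    proof (intro always_eventually allI impI)
      fix s assume s: "s \<in> {a..b}"
      have "l2norm (\<lambda>x. (u s x - u t x) - (v s x - v t x)) \<le> l2dist (u s) (u t) + l2dist (v s) (v t)"
        using u v s t by (intro l2norm_triangle_diff sq_diff L2_sq) (auto simp: l2cont_def)
      then show "norm (l2norm (\<lambda>x. u s x - v s x - (u t x - v t x)))
        \<le> norm (l2dist (u s) (u t) + l2dist (v s) (v t)) * 1" by (simp add: algebra_simps)
    qed
  qed
qed

lemma l2cont_affine_mult:
  assumes u: "l2cont u a b" shows "l2cont (\<lambda>s x. (p + q * s) * u s x) a b"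
  unfolding l2cont_def
proof (intro ballI conjI)
  fix t assume t: "t \<in> {a..b}"
  then have Lt: "u t \<in> L2" using u by (auto simp: l2cont_def)
  then show "(\<lambda>x. (p + q * t) * u t x) \<in> L2" by auto
  show "((\<lambda>s. l2norm (\<lambda>x. (p + q * s) * u s x - (p + q * t) * u t x)) \<longlongrightarrow> 0) (at t within {a..b})"
  proof (rule tendsto_0_le[OF _ , of _ _ _ 1])
    have "((\<lambda>s. \<bar>p + q * s\<bar> * l2dist (u s) (u t) + \<bar>q * (s - t)\<bar> * l2norm (u t)) \<longlongrightarrow>
      \<bar>p + q * t\<bar> * 0 + \<bar>q * (t - t)\<bar> * l2norm (u t)) (at t within {a..b})"
      using u t by (intro tendsto_intros) (auto simp: l2cont_def)
    then show "((\<lambda>s. \<bar>p + q * s\<bar> * l2dist (u s) (u t) + \<bar>q * (s - t)\<bar> * l2norm (u t)) \<longlongrightarrow> 0) (at t within {a..b})"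
      by simp
    show "\<forall>\<^sub>F s in at t within {a..b}. norm (l2norm (\<lambda>x. (p + q * s) * u s x - (p + q * t) * u t x))
        \<le> norm (\<bar>p + q * s\<bar> * l2dist (u s) (u t) + \<bar>q * (s - t)\<bar> * l2norm (u t)) * 1"
      unfolding eventually_at_filter
    proof (intro always_eventually allI impI)
      fix s assume s: "s \<in> {a..b}"
      have "l2norm (\<lambda>x. (p + q * s) * (u s x - u t x) + (q * (s - t)) * u t x) \<le>
          l2norm (\<lambda>x. (p + q * s) * (u s x - u t x)) + l2norm (\<lambda>x. (q * (s - t)) * u t x)"
        using u s t by (intro l2norm_triangle sq_cmult sq_diff L2_sq) (auto simp: l2cont_def)
      moreover have "(\<lambda>x. (p + q * s) * (u s x - u t x) + (q * (s - t)) * u t x) =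
          (\<lambda>x. (p + q * s) * u s x - (p + q * t) * u t x)" by (auto simp: algebra_simps)
      ultimately show "norm (l2norm (\<lambda>x. (p + q * s) * u s x - (p + q * t) * u t x))
        \<le> norm (\<bar>p + q * s\<bar> * l2dist (u s) (u t) + \<bar>q * (s - t)\<bar> * l2norm (u t)) * 1"
        by (simp add: l2norm_cmult)
    qed
  qed
qed

section \<open>Semigroups and evolution families\<close>

lemma opnorm_uniform:
  assumes "bounded_op P" "opnorm P \<le> B" "f \<in> L2" shows "l2norm (P f) \<le> B * l2norm f"
  using opnorm_bound[OF assms(1,3)] mult_right_mono[OF assms(2) l2norm_nonneg[of f]] by linarith

context
  fixes S :: "real \<Rightarrow> ('d::finite) op" and G D
  assumes gen: "generates S G D"
begin

lemma sg_bounded_op: "0 \<le> \<tau> \<Longrightarrow> bounded_op (S \<tau>)"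
  and sg_zero: "f \<in> L2 \<Longrightarrow> l2eq (S 0 f) f"
  and sg_add: "0 \<le> \<tau> \<Longrightarrow> 0 \<le> \<sigma> \<Longrightarrow> f \<in> L2 \<Longrightarrow> l2eq (S (\<tau> + \<sigma>) f) (S \<tau> (S \<sigma> f))"
  and sg_cont0: "f \<in> L2 \<Longrightarrow> ((\<lambda>\<tau>. l2dist (S \<tau> f) f) \<longlongrightarrow> 0) (at_right 0)"
  and sg_dom: "f \<in> D \<Longrightarrow> f \<in> L2"
  and sg_dom_iff: "f \<in> L2 \<Longrightarrow> f \<in> D \<longleftrightarrow>
        (\<exists>g\<in>L2. ((\<lambda>\<tau>. l2norm (\<lambda>x. (S \<tau> f x - f x) / \<tau> - g x)) \<longlongrightarrow> 0) (at_right 0))"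
  and sg_gen: "f \<in> D \<Longrightarrow> G f \<in> L2"
    "f \<in> D \<Longrightarrow> ((\<lambda>\<tau>. l2norm (\<lambda>x. (S \<tau> f x - f x) / \<tau> - G f x)) \<longlongrightarrow> 0) (at_right 0)"
  using gen unfolding generates_def by blast+

lemma sg_L2: "0 \<le> \<tau> \<Longrightarrow> f \<in> L2 \<Longrightarrow> S \<tau> f \<in> L2"
  using sg_bounded_op bounded_op_L2 by blast

text \<open>Otherwise there are times tending to 0 with unbounded operator norms, although strong
  continuity at 0 keeps each orbit bounded along them; this contradicts uniform boundedness.\<close>

lemma sg_locally_bounded: "\<exists>d>0. \<exists>M\<ge>1. \<forall>\<tau>\<in>{0..d}. \<forall>f\<in>L2. l2norm (S \<tau> f) \<le> M * l2norm f"
proof (rule ccontr)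
  assume neg: "\<not> ?thesis"
  have "\<exists>\<tau>\<in>{0..1 / real (Suc n)}. \<exists>f\<in>L2. real (Suc n) * l2norm f < l2norm (S \<tau> f)" for n
  proof -
    have "1 / real (Suc n) > 0" "real (Suc n) \<ge> 1" by auto
    with neg show ?thesis by (meson linorder_not_le)
  qed
  then obtain \<tau> where \<tau>: "\<And>n. \<tau> n \<in> {0..1 / real (Suc n)}"
    and big: "\<And>n. \<exists>f\<in>L2. real (Suc n) * l2norm f < l2norm (S (\<tau> n) f)" by metis
  have bop: "bounded_op (S (\<tau> n))" for n using \<tau>[of n] by (intro sg_bounded_op) auto
  have "\<exists>B. \<forall>n. opnorm (S (\<tau> n)) \<le> B"
  proof (rule uniform_boundedness)
    show "bounded_op (S (\<tau> n))" for n by (rule bop)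
    fix f :: "'d fn" assume f: "f \<in> L2"
    have "\<forall>\<^sub>F h in at_right 0. l2dist (S h f) f < 1"
      using sg_cont0[OF f] by (intro order_tendstoD(2)[where y = 0]) auto
    then obtain d where d: "d > 0" "\<And>h. 0 < h \<Longrightarrow> h < d \<Longrightarrow> l2dist (S h f) f < 1"
      unfolding eventually_at_right_field by auto
    obtain N where N: "1 / real (Suc N) < d" using nat_approx_posE[OF d(1)] by auto
    \<comment> \<open>The finitely many early times are covered by this sum; the later ones lie in
      the range where \<open>S h f\<close> is within 1 of \<open>f\<close>, with time 0 treated
      separately since the right limit does not see it.\<close>
    let ?B = "\<Sum>n<N. l2norm (S (\<tau> n) f)"
    have B0: "0 \<le> ?B" by (intro sum_nonneg) auto
    have "l2norm (S (\<tau> n) f) \<le> ?B + (l2norm f + 1)" for n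
    proof (cases "n < N")
      case True
      then have "l2norm (S (\<tau> n) f) \<le> ?B" by (intro member_le_sum) auto
      then show ?thesis using l2norm_nonneg[of f] by linarith
    next
      case False
      have L: "S (\<tau> n) f \<in> L2" by (rule bounded_op_L2[OF bop f])
      have "1 / real (Suc n) \<le> 1 / real (Suc N)" using False by (simp add: divide_simps)
      then have lt: "\<tau> n < d" "0 \<le> \<tau> n" using \<tau>[of n] N by auto
      have "l2dist (S (\<tau> n) f) f \<le> 1"
      proof (cases "\<tau> n = 0")
        case True
        then show ?thesis using sg_zero[OF f] by (simp add: l2eq_def)
      next
        case False
        with lt d(2)[of "\<tau> n"] show ?thesis by simp
      qed
      moreover have "\<bar>l2norm (S (\<tau> n) f) - l2norm f\<bar> \<le> l2dist (S (\<tau> n) f) f"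
        using L f by (intro l2norm_diff_ge) auto
      ultimately show ?thesis using B0 by linarith
    qed
    then show "\<exists>B. \<forall>n. l2norm (S (\<tau> n) f) \<le> B" by blast
  qed
  then obtain B where B: "\<And>n. opnorm (S (\<tau> n)) \<le> B" by blast
  obtain n :: nat where n: "B < real n" using reals_Archimedean2 by blast
  obtain f where f: "f \<in> L2" "real (Suc n) * l2norm f < l2norm (S (\<tau> n) f)" using big by blast
  have "l2norm (S (\<tau> n) f) \<le> B * l2norm f" using opnorm_uniform[OF bop B f(1)] .
  also have "\<dots> \<le> real (Suc n) * l2norm f" using n by (intro mult_right_mono) auto
  finally show False using f(2) by linarith
qed

text \<open>One \<open>n\<close> brings \<open>\<tau> / real n\<close> into the short interval for
  all \<open>\<tau>\<close> at once, and the semigroup law raises the local bound to the power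
  \<open>n\<close>.\<close>

lemma sg_bounded_on: "\<exists>M. \<forall>\<tau>\<in>{0..b}. \<forall>f\<in>L2. l2norm (S \<tau> f) \<le> M * l2norm f"
proof -
  obtain d M where d: "d > 0" and M: "M \<ge> 1"
    and le: "\<And>\<tau> f. \<tau> \<in> {0..d} \<Longrightarrow> f \<in> L2 \<Longrightarrow> l2norm (S \<tau> f) \<le> M * l2norm f"
    using sg_locally_bounded by blast
  have it: "l2norm (S (real k * \<sigma>) f) \<le> M ^ k * l2norm f" if "\<sigma> \<in> {0..d}" "f \<in> L2" for k \<sigma> f
  proof (induction k)
    case 0
    have "l2norm (S 0 f) = l2norm f"
      using sg_L2[of 0 f] that(2) by (intro l2eq_norm sg_zero L2_sq) auto
    then show ?case by simp
  next
    case (Suc k)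
    have p: "0 \<le> real k * \<sigma>" "0 \<le> \<sigma>" using that(1) by auto
    have "real (Suc k) * \<sigma> = \<sigma> + real k * \<sigma>" by (simp add: algebra_simps)
    then have "l2norm (S (real (Suc k) * \<sigma>) f) = l2norm (S \<sigma> (S (real k * \<sigma>) f))"
      using sg_add[OF p(2,1) that(2)] p that(2) by (simp, intro l2eq_norm L2_sq sg_L2) auto
    also have "\<dots> \<le> M * l2norm (S (real k * \<sigma>) f)" using that p by (intro le sg_L2)
    also have "\<dots> \<le> M * (M ^ k * l2norm f)" using Suc M by (intro mult_left_mono) auto
    finally show ?case by (simp add: mult.assoc)
  qed
  obtain n :: nat where n: "max 1 (b / d) < real n" using reals_Archimedean2 by blast
  then have n0: "real n > 0" "b < real n * d" using d by (auto simp: divide_simps)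
  have "l2norm (S \<tau> f) \<le> M ^ n * l2norm f" if \<tau>: "\<tau> \<in> {0..b}" and f: "f \<in> L2" for \<tau> f
  proof -
    have "\<tau> / real n \<in> {0..d}" using \<tau> n0 by (auto simp: divide_simps mult.commute)
    from it[OF this f, of n] show ?thesis using n0 by simp
  qed
  then show ?thesis by blast
qed

text \<open>An increment between two times is the operator at the earlier time applied to an
  increment at 0. For left limits the earlier time varies, which is why a bound over the whole
  interval is required.\<close>

lemma sg_l2cont: assumes f: "f \<in> L2" shows "l2cont (\<lambda>\<tau>. S \<tau> f) 0 b"
  unfolding l2cont_def
proof (intro ballI conjI)
  fix t assume t: "t \<in> {0..b}"
  then show "S t f \<in> L2" using f by (intro sg_L2) auto
  obtain M0 where M0: "\<forall>\<tau>\<in>{0..b}. \<forall>f\<in>L2. l2norm (S \<tau> f) \<le> M0 * l2norm f" using sg_bounded_on by blast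
  define M where "M = max 1 M0"
  have M: "M \<ge> 1" "\<And>\<tau> f. \<tau> \<in> {0..b} \<Longrightarrow> f \<in> L2 \<Longrightarrow> l2norm (S \<tau> f) \<le> M * l2norm f"
  proof -
    show "M \<ge> 1" by (simp add: M_def)
    fix \<tau> f assume "\<tau> \<in> {0..b}" "(f :: 'd fn) \<in> L2"
    then have "l2norm (S \<tau> f) \<le> M0 * l2norm f" using M0 by blast
    also have "\<dots> \<le> M * l2norm f" by (intro mult_right_mono) (auto simp: M_def)
    finally show "l2norm (S \<tau> f) \<le> M * l2norm f" .
  qed
  have inc: "l2dist (S (r + h) f) (S r f) \<le> M * l2dist (S h f) f"
    if "r \<in> {0..b}" "0 \<le> h" for r h
  proof -
    have r: "0 \<le> r" using that by auto
    have L: "S h f \<in> L2" "S r f \<in> L2" "S (r + h) f \<in> L2" "S r (S h f) \<in> L2"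
      using r that f by (auto intro!: sg_L2)
    have "l2eq (\<lambda>x. S (r + h) f x - S r f x) (\<lambda>x. S r (S h f) x - S r f x)"
      using sg_add[OF r that(2) f] L by (intro l2eq_diff) auto
    then have "l2dist (S (r + h) f) (S r f) = l2dist (S r (S h f)) (S r f)"
      using L by (intro l2eq_norm) auto
    also have "\<dots> = l2norm (S r (\<lambda>x. S h f x - f x))"
      using bounded_op_norm_diff[OF sg_bounded_op[OF r] L(1) f] .
    also have "\<dots> \<le> M * l2dist (S h f) f" using that(1) L f by (intro M(2)) auto
    finally show ?thesis .
  qed
  show "((\<lambda>s. l2dist (S s f) (S t f)) \<longlongrightarrow> 0) (at t within {0..b})"
  proof (rule tendstoI)
    fix e :: real assume e: "e > 0"
    have "\<forall>\<^sub>F h in at_right 0. l2dist (S h f) f < e / M"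
      using sg_cont0[OF f] e M(1) by (intro order_tendstoD(2)[where y = 0]) auto
    then obtain d where d: "d > 0" "\<And>h. 0 < h \<Longrightarrow> h < d \<Longrightarrow> l2dist (S h f) f < e / M"
      unfolding eventually_at_right_field by auto
    have "l2dist (S s f) (S t f) < e" if s: "s \<in> {0..b}" "s \<noteq> t" "dist s t < d" for s
    proof -
      have "l2dist (S s f) (S t f) \<le> M * l2norm (\<lambda>x. S \<bar>s - t\<bar> f x - f x)"
      proof (cases "t \<le> s")
        case True
        then show ?thesis using inc[of t "s - t"] t by simp
      next
        case False
        then show ?thesis using inc[of s "t - s"] s by (simp add: l2norm_diff_commute[of "S t f"])
      qed
      also have "\<dots> < M * (e / M)"
        using d(2)[of "\<bar>s - t\<bar>"] s M(1) by (intro mult_strict_left_mono) (auto simp: dist_real_def)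
      finally show ?thesis using M(1) by simp
    qed
    then show "\<forall>\<^sub>F s in at t within {0..b}. dist (l2dist (S s f) (S t f)) 0 < e"
      unfolding eventually_at using d(1) by (auto intro!: exI[of _ d])
  qed
qed

text \<open>The bounded operator \<open>S t\<close> commutes with difference quotients at 0, up to
  null sets, and so maps the derivative of the orbit of \<open>f\<close> to that of the orbit of
  \<open>S t f\<close>. Membership in \<open>D\<close> then follows from the characterisation of the
  domain in \<open>generates\<close>.\<close>

lemma sg_invariant: assumes f: "f \<in> D" and t: "0 \<le> t" shows "S t f \<in> D"
proof -
  have fL: "f \<in> L2" and GL: "G f \<in> L2" using f by (auto intro: sg_dom sg_gen)
  define P where "P = S t"
  have P: "bounded_op P" using t by (simp add: P_def sg_bounded_op)
  have PL: "g \<in> L2 \<Longrightarrow> P g \<in> L2" for g using bounded_op_L2[OF P] .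
  have eq: "l2norm (\<lambda>x. (S h (P f) x - P f x) / h - P (G f) x) =
      l2norm (P (\<lambda>x. (S h f x - f x) / h - G f x))" if h: "0 < h" for h
  proof -
    have hL: "S h f \<in> L2" "S h (P f) \<in> L2" "S (t + h) f \<in> L2"
      using h t by (intro sg_L2 PL fL; simp)+
    have "l2eq (S (t + h) f) (P (S h f))" "l2eq (S (h + t) f) (S h (P f))"
      using sg_add[of t h f] sg_add[of h t f] t h fL by (simp_all add: P_def)
    then have 1: "l2eq (S h (P f)) (P (S h f))"
      unfolding add.commute[of h]
      by (blast intro: l2eq_trans[OF l2eq_sym _ L2_sq L2_sq L2_sq, OF _ _ hL(2,3) PL[OF hL(1)]])
    have uL: "(\<lambda>x. S h f x - f x) \<in> L2" using hL fL by auto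
    let ?v = "\<lambda>x. -1 * G f x"
    have vL: "?v \<in> L2" using GL by (rule L2_cmult)
    have "l2eq (P (\<lambda>x. (1 / h) * (S h f x - f x) + ?v x)) (\<lambda>x. (1 / h) * P (\<lambda>x. S h f x - f x) x + P ?v x)"
      by (rule bounded_op_lin[OF P uL vL])
    moreover have "l2eq (\<lambda>x. (1 / h) * P (\<lambda>x. S h f x - f x) x + P ?v x)
        (\<lambda>x. (1 / h) * (P (S h f) x - P f x) + -1 * P (G f) x)"
      by (intro l2eq_add l2eq_cmult bounded_op_diff[OF P] bounded_op_cmult[OF P] sq_cmult sq_diff L2_sq PL hL fL GL uL vL)
    moreover have "l2eq (\<lambda>x. (1 / h) * (P (S h f) x - P f x) + -1 * P (G f) x)
        (\<lambda>x. (1 / h) * (S h (P f) x - P f x) + -1 * P (G f) x)"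
      by (intro l2eq_add l2eq_cmult l2eq_diff l2eq_refl l2eq_sym[OF 1] sq_cmult sq_diff L2_sq PL hL fL GL)
    ultimately have "l2norm (P (\<lambda>x. (1 / h) * (S h f x - f x) + ?v x)) =
        l2norm (\<lambda>x. (1 / h) * (S h (P f) x - P f x) + -1 * P (G f) x)"
      by (simp only: l2eq_norm[OF _ L2_sq L2_sq] PL hL fL GL uL vL L2_cmult L2_add L2_diff)
    then show ?thesis by simp
  qed
  have "((\<lambda>h. l2norm (\<lambda>x. (S h (P f) x - P f x) / h - P (G f) x)) \<longlongrightarrow> 0) (at_right 0)"
  proof (rule tendsto_0_le[OF sg_gen(2)[OF f], of _ "opnorm P"])
    show "\<forall>\<^sub>F h in at_right 0. norm (l2norm (\<lambda>x. (S h (P f) x - P f x) / h - P (G f) x))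
      \<le> norm (l2norm (\<lambda>x. (S h f x - f x) / h - G f x)) * opnorm P"
      using eventually_at_right_pos
    proof eventually_elim
      case (elim h)
      have "S h f \<in> L2" using elim fL by (intro sg_L2) auto
      then have "l2norm (P (\<lambda>x. (S h f x - f x) / h - G f x)) \<le> opnorm P * l2norm (\<lambda>x. (S h f x - f x) / h - G f x)"
        using fL GL by (intro opnorm_bound[OF P]) auto
      then show ?case unfolding eq[OF elim] by (simp add: mult.commute)
    qed
  qed
  then show ?thesis using sg_dom_iff[OF PL[OF fL]] PL[OF GL] by (auto simp: P_def)
qed

lemma sg_rderiv: assumes f: "f \<in> D" and t: "0 \<le> t" shows "rderiv (\<lambda>s. S s f) t (G (S t f))"
  unfolding rderiv_def
proof (rule Lim_transform_eventually[OF sg_gen(2)[OF sg_invariant[OF f t]]])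
  have fL: "f \<in> L2" using f by (rule sg_dom)
  have GL: "G (S t f) \<in> L2" using sg_gen(1)[OF sg_invariant[OF f t]] .
  show "\<forall>\<^sub>F h in at_right 0. l2norm (\<lambda>x. (S h (S t f) x - S t f x) / h - G (S t f) x) =
      l2norm (\<lambda>x. (S (t + h) f x - S t f x) / h - G (S t f) x)"
    using eventually_at_right_pos
  proof eventually_elim
    case (elim h)
    have L: "S t f \<in> L2" "S h (S t f) \<in> L2" "S (t + h) f \<in> L2" using t elim fL by (auto intro!: sg_L2)
    have "l2eq (S h (S t f)) (S (t + h) f)"
      using l2eq_sym[OF sg_add[OF less_imp_le[OF elim] t fL]] unfolding add.commute[of h] .
    then have "l2eq (\<lambda>x. (1 / h) * (S h (S t f) x - S t f x) - G (S t f) x) (\<lambda>x. (1 / h) * (S (t + h) f x - S t f x) - G (S t f) x)"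
      using L GL by (intro l2eq_diff l2eq_cmult l2eq_refl sq_cmult sq_diff L2_sq)
    then have "l2norm (\<lambda>x. (1 / h) * (S h (S t f) x - S t f x) - G (S t f) x) = l2norm (\<lambda>x. (1 / h) * (S (t + h) f x - S t f x) - G (S t f) x)"
      using L GL by (intro l2eq_norm sq_cmult sq_diff L2_sq)
    then show ?case by simp
  qed
qed

end

section \<open>Evolution families\<close>

context
  fixes U :: "real \<Rightarrow> real \<Rightarrow> ('d::finite) op" and A
  assumes evo: "evolution_family U A" and A: "\<And>t f. t \<ge> 0 \<Longrightarrow> f \<in> H2 \<Longrightarrow> A t f \<in> L2"
begin

lemma evo_bounded_op: "0 \<le> s \<Longrightarrow> s \<le> t \<Longrightarrow> bounded_op (U t s)"
  using evo[unfolded evolution_family_def, THEN conjunct1] by blast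

lemma evo_zero: "0 \<le> s \<Longrightarrow> f \<in> L2 \<Longrightarrow> l2eq (U s s f) f"
  using evo[unfolded evolution_family_def, THEN conjunct2, THEN conjunct1] by blast

lemma evo_cont0: "0 \<le> s \<Longrightarrow> f \<in> L2 \<Longrightarrow> ((\<lambda>t. l2dist (U t s f) f) \<longlongrightarrow> 0) (at_right s)"
  using evo[unfolded evolution_family_def, THEN conjunct2, THEN conjunct2, THEN conjunct2, THEN conjunct1] by blast

lemma evo_H2: "0 \<le> s \<Longrightarrow> s < t \<Longrightarrow> f \<in> L2 \<Longrightarrow> U t s f \<in> H2"
  using evo[unfolded evolution_family_def, THEN conjunct2, THEN conjunct2, THEN conjunct2, THEN conjunct2] by blast

lemma evo_deriv: "0 \<le> s \<Longrightarrow> s < t \<Longrightarrow> f \<in> L2 \<Longrightarrow>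
    ((\<lambda>h. l2norm (\<lambda>x. (U (t + h) s f x - U t s f x) / h - A t (U t s f) x)) \<longlongrightarrow> 0) (at 0)"
  using evo[unfolded evolution_family_def, THEN conjunct2, THEN conjunct2, THEN conjunct2, THEN conjunct2] by blast

lemma evo_L2: "0 \<le> s \<Longrightarrow> s \<le> t \<Longrightarrow> f \<in> L2 \<Longrightarrow> U t s f \<in> L2"
  by (rule bounded_op_L2[OF evo_bounded_op])

lemma evo_rderiv: "0 \<le> s \<Longrightarrow> s < t \<Longrightarrow> f \<in> L2 \<Longrightarrow> rderiv (\<lambda>t. U t s f) t (A t (U t s f))"
  unfolding rderiv_def by (rule filterlim_mono[OF evo_deriv order_refl]) (auto simp: at_le)

text \<open>At the initial time only the right limit is given, which is all that the interval sees;
  at later times two-sided differentiability implies continuity.\<close>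

lemma evo_l2cont: assumes s: "0 \<le> s" and f: "f \<in> L2" shows "l2cont (\<lambda>t. U t s f) s b"
  unfolding l2cont_def
proof (intro ballI conjI)
  fix t assume t: "t \<in> {s..b}"
  then show "U t s f \<in> L2" using s f by (intro evo_L2) auto
  show "((\<lambda>r. l2dist (U r s f) (U t s f)) \<longlongrightarrow> 0) (at t within {s..b})"
  proof (cases "t = s")
    case True
    have L: "r \<ge> s \<Longrightarrow> U r s f \<in> L2" for r using s f by (intro evo_L2)
    have "((\<lambda>r. l2dist (U r s f) (U s s f)) \<longlongrightarrow> 0) (at_right s)"
    proof (rule Lim_transform_eventually[OF evo_cont0[OF s f]])
      show "\<forall>\<^sub>F r in at_right s. l2dist (U r s f) f = l2dist (U r s f) (U s s f)"
        using eventually_at_right_less[of s]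
      proof eventually_elim
        case (elim r)
        have "l2eq (\<lambda>x. U r s f x - f x) (\<lambda>x. U r s f x - U s s f x)"
          using L[of r] L[of s] elim f by (intro l2eq_diff l2eq_refl l2eq_sym[OF evo_zero[OF s f]]) auto
        then show ?case using L[of r] L[of s] elim f by (intro l2eq_norm) auto
      qed
    qed
    moreover have "at s within {s..b} \<le> at_right s"
    proof -
      have "at s within {s..b} = at s within ({s..b} - {s})" by (simp add: at_within_def)
      also have "\<dots> \<le> at_right s" by (rule at_le) auto
      finally show ?thesis .
    qed
    ultimately show ?thesis unfolding True by (rule tendsto_mono[rotated])
  next
    case False
    with t have st: "s < t" by auto
    let ?q = "\<lambda>h x. (U (t + h) s f x - U t s f x) / h - A t (U t s f) x"
    have AL: "A t (U t s f) \<in> L2" using evo_H2[OF s st f] s st by (intro A) auto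
    have "((\<lambda>h. \<bar>h\<bar> * (l2norm (?q h) + l2norm (A t (U t s f)))) \<longlongrightarrow> \<bar>0\<bar> * (0 + l2norm (A t (U t s f)))) (at 0)"
      by (intro tendsto_intros evo_deriv[OF s st f])
    then have lim: "((\<lambda>h. \<bar>h\<bar> * (l2norm (?q h) + l2norm (A t (U t s f)))) \<longlongrightarrow> 0) (at 0)" by simp
    have "((\<lambda>h. l2dist (U (t + h) s f) (U t s f)) \<longlongrightarrow> 0) (at 0)"
    proof (rule tendsto_0_le[OF lim, of _ 1])
      have "\<forall>\<^sub>F h in at (0::real). h \<in> {s - t<..}"
        using st by (intro eventually_at_in_open') auto
      moreover have "\<forall>\<^sub>F h in at (0::real). h \<noteq> 0" by (simp add: eventually_at_filter)
      ultimately show "\<forall>\<^sub>F h in at 0. norm (l2dist (U (t + h) s f) (U t s f)) \<le>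
          norm (\<bar>h\<bar> * (l2norm (?q h) + l2norm (A t (U t s f)))) * 1"
      proof eventually_elim
        case (elim h)
        have L: "U (t + h) s f \<in> L2" "U t s f \<in> L2" using elim s st f by (auto intro!: evo_L2)
        have "l2dist (U (t + h) s f) (U t s f) = l2norm (\<lambda>x. h * (?q h x + A t (U t s f) x))"
          using elim by simp
        also have "\<dots> = \<bar>h\<bar> * l2norm (\<lambda>x. ?q h x + A t (U t s f) x)" by (rule l2norm_cmult)
        also have "\<dots> \<le> \<bar>h\<bar> * (l2norm (?q h) + l2norm (A t (U t s f)))"
          using L AL by (intro mult_left_mono l2norm_triangle) auto
        finally show ?case by (simp add: abs_mult)
      qed
    qed
    then have "((\<lambda>r. l2dist (U r s f) (U t s f)) \<longlongrightarrow> 0) (at t)"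
      by (rule LIM_offset_zero_cancel)
    then show ?thesis by (rule tendsto_within_subset) simp
  qed
qed

end

section \<open>Energy estimates\<close>

lemma young: "0 < e \<Longrightarrow> x * y \<le> e / 2 * x^2 + y^2 / (2 * e)" for e x y :: real
proof -
  assume e: "0 < e"
  have "0 \<le> (e * x - y)^2 / (2 * e)" using e by simp
  also have "\<dots> = e / 2 * x^2 + y^2 / (2 * e) - x * y"
    using e by (simp add: power2_diff field_simps power2_eq_square)
  finally show ?thesis by simp
qed

lemma l2eq_ip: assumes "l2eq f f'" "sq f" "sq f'" "sq g" shows "ip f g = ip f' g"
proof -
  have "\<bar>ip (\<lambda>x. f x - f' x) g\<bar> \<le> l2dist f f' * l2norm g"
    using assms by (intro ip_Cauchy_Schwarz) auto
  then show ?thesis using assms by (simp add: l2eq_def ip_diff_left)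
qed

lemma bounded_op_mollify:
  assumes P: "bounded_op P" and f: "f \<in> L2"
  shows "(\<lambda>n. l2dist (P (mollify n f)) (P f)) \<longlonglongrightarrow> 0"
proof (rule tendsto_0_le[OF mollify_tendsto[OF L2_sq[OF f]], of _ "opnorm P"], intro always_eventually allI)
  fix n
  have m: "mollify n f \<in> L2" using mollify_H2[OF f] by (simp add: H2_def)
  then have "l2norm (P (\<lambda>x. mollify n f x - f x)) \<le> opnorm P * l2dist (mollify n f) f"
    using f by (intro opnorm_bound[OF P]) auto
  then show "norm (l2dist (P (mollify n f)) (P f)) \<le> norm (l2dist (mollify n f) f) * opnorm P"
    unfolding bounded_op_norm_diff[OF P m f] by (simp add: mult.commute)
qed

lemma energy_growth:
  assumes ab: "a \<le> b" and u: "l2cont u a b" "\<And>s. a \<le> s \<Longrightarrow> u s \<in> L2"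
    and der: "\<And>s. a < s \<Longrightarrow> s < b \<Longrightarrow> \<exists>g\<in>L2. rderiv u s g \<and> ip g (u s) \<le> K * (l2norm (u s))^2 + M"
    and K: "0 \<le> K" and M: "0 \<le> M"
  shows "(l2norm (u b))^2 \<le> exp (2 * K * (b - a)) * ((l2norm (u a))^2 + 2 * M * (b - a))"
  unfolding l2norm_sq
proof (rule gronwall_right[OF ab l2cont_ip[OF u(1) u(1)]])
  fix s assume s: "a < s" "s < b"
  then obtain g where g: "g \<in> L2" "rderiv u s g" "ip g (u s) \<le> K * (l2norm (u s))^2 + M" using der by blast
  have "((\<lambda>s. ip (u s) (u s)) has_real_derivative (ip g (u s) + ip (u s) g)) (at_right s)"
    using g u(2) s by (intro ip_rderiv) auto
  moreover have "ip g (u s) + ip (u s) g \<le> 2 * K * ip (u s) (u s) + 2 * M"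
    using g(3) ip_commute[of "u s" g] by (simp add: l2norm_sq)
  ultimately show "\<exists>D. ((\<lambda>s. ip (u s) (u s)) has_real_derivative D) (at_right s) \<and> D \<le> 2 * K * ip (u s) (u s) + 2 * M"
    by blast
qed (use K M in auto)

text \<open>A mean value inequality in squared form, with a loss of \<open>exp 1\<close>: squared
  norms can be differentiated without dividing by the norm of \<open>u\<close>.\<close>

lemma linear_growth:
  assumes d: "0 < d" and u: "l2cont u 0 d" "\<And>s. 0 \<le> s \<Longrightarrow> u s \<in> L2" and u0: "l2norm (u 0) = 0"
    and der: "\<And>s. 0 < s \<Longrightarrow> s < d \<Longrightarrow> \<exists>g\<in>L2. rderiv u s g \<and> l2norm g \<le> X"
  shows "(l2norm (u d))^2 \<le> exp 1 * X^2 * d^2"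
proof -
  \<comment> \<open>Young's inequality with parameter \<open>d\<close> gives the growth rate
    \<open>1 / (2 * d)\<close>, so the Gronwall exponent over the interval is exactly 1.\<close>
  have "(l2norm (u d))^2 \<le> exp (2 * (1 / (2 * d)) * (d - 0)) * ((l2norm (u 0))^2 + 2 * (d / 2 * X^2) * (d - 0))"
  proof (rule energy_growth[OF _ u])
    fix s assume s: "0 < s" "s < d"
    then obtain g where g: "g \<in> L2" "rderiv u s g" "l2norm g \<le> X" using der by blast
    have "ip g (u s) \<le> l2norm g * l2norm (u s)" using g u(2)[of s] s by (intro ip_le) auto
    also have "\<dots> \<le> d / 2 * (l2norm g)^2 + (l2norm (u s))^2 / (2 * d)" using d by (rule young)
    also have "\<dots> \<le> d / 2 * X^2 + (l2norm (u s))^2 / (2 * d)"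
      using g(3) d by (intro add_right_mono mult_left_mono power_mono) auto
    finally show "\<exists>g\<in>L2. rderiv u s g \<and> ip g (u s) \<le> 1 / (2 * d) * (l2norm (u s))^2 + d / 2 * X^2"
      using g by (auto simp: add.commute)
  qed (use d in auto)
  also have "2 * (1 / (2 * d)) * (d - 0) = 1" using d by simp
  finally show ?thesis using u0 by (simp add: power2_eq_square mult_ac)
qed

text \<open>The bounds are parameters common to all times, so that the constants built from them
  depend neither on the time at which coefficients are frozen nor on the number of steps.\<close>

locale advection_coeffs =
  fixes \<kappa> \<beta> :: real and b :: "real \<Rightarrow> real^'d::finite \<Rightarrow> real^'d" and c :: "real \<Rightarrow> real^'d \<Rightarrow> real"
    and Bb Bc Bg H :: real
  assumes kappa: "0 < \<kappa>" and beta: "0 < \<beta>" and nonneg: "0 \<le> Bb" "0 \<le> Bc" "0 \<le> Bg" "0 \<le> H"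
    and b: "\<And>t i. 0 \<le> t \<Longrightarrow> periodic_fn (\<lambda>x. b t x $ i)" "\<And>t i. 0 \<le> t \<Longrightarrow> smooth_fn (\<lambda>x. b t x $ i)"
    and c: "\<And>t. 0 \<le> t \<Longrightarrow> periodic_fn (c t)" "\<And>t. 0 \<le> t \<Longrightarrow> smooth_fn (c t)"
    and b_le: "\<And>t x i. 0 \<le> t \<Longrightarrow> \<bar>b t x $ i\<bar> \<le> Bb"
    and c_le: "\<And>t x. 0 \<le> t \<Longrightarrow> \<bar>c t x\<bar> \<le> Bc"
    and dc_le: "\<And>t x i. 0 \<le> t \<Longrightarrow> \<bar>pd i (c t) x\<bar> \<le> Bg"
    and hoelder: "\<And>t s x. 0 \<le> t \<Longrightarrow> 0 \<le> s \<Longrightarrow>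
      norm (b t x - b s x) + \<bar>c t x - c s x\<bar> \<le> H * \<bar>t - s\<bar> powr \<beta>"
begin

text \<open>\<open>Lop\<close> applied to given representatives of the derivatives; this makes
  differences of values of \<open>Lop\<close> again expressions of the same form.\<close>

definition Lform :: "real \<Rightarrow> ('d \<Rightarrow> 'd fn) \<Rightarrow> ('d \<Rightarrow> 'd fn) \<Rightarrow> 'd fn" where
  "Lform t D E = (\<lambda>x. \<kappa> * (\<Sum>i\<in>UNIV. E i x) + (\<Sum>i\<in>UNIV. b t x $ i * D i x))"

definition grad_sq :: "('d \<Rightarrow> 'd fn) \<Rightarrow> real" where
  "grad_sq D = (\<Sum>i\<in>UNIV. (l2norm (D i))^2)"

text \<open>In each coordinate direction Young's inequality spends \<open>\<kappa> / 2\<close> of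
  the dissipation on the drift and leaves \<open>Bb^2 / (2 * \<kappa>)\<close>.\<close>

definition KL :: real where "KL = real CARD('d) * Bb^2 / (2 * \<kappa>)"

lemma KL_nonneg: "0 \<le> KL"
  using kappa by (simp add: KL_def)

lemma grad_sq_nonneg: "0 \<le> grad_sq D"
  by (simp add: grad_sq_def sum_nonneg)

lemma Lop_Lform: "Lop \<kappa> b t f = Lform t (\<lambda>i. wd [i] f) (\<lambda>i. wd [i, i] f)"
  by (simp add: Lop_def Lform_def)

lemma bmult:
  assumes "0 \<le> t" "sq f"
  shows "sq (\<lambda>x. b t x $ i * f x)" "l2norm (\<lambda>x. b t x $ i * f x) \<le> Bb * l2norm f"
  using sq_mult_bounded[OF continuous_measurable_mcell[OF smooth_continuous[OF b(2)[OF assms(1)]]] _ assms(2), of i Bb]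
    b_le[OF assms(1)] by auto

lemma cmult:
  assumes "0 \<le> t" "sq f"
  shows "sq (\<lambda>x. c t x * f x)" "l2norm (\<lambda>x. c t x * f x) \<le> Bc * l2norm f"
  using sq_mult_bounded[OF continuous_measurable_mcell[OF smooth_continuous[OF c(2)[OF assms(1)]]] _ assms(2), of Bc]
    c_le[OF assms(1)] by auto

lemma dcmult:
  assumes "0 \<le> t" "sq f"
  shows "sq (\<lambda>x. pd i (c t) x * f x)" "l2norm (\<lambda>x. pd i (c t) x * f x) \<le> Bg * l2norm f"
  using sq_mult_bounded[OF continuous_measurable_mcell[OF smooth_continuous[OF smooth_pd[OF c(2)[OF assms(1)]]]] _ assms(2), of i Bg]
    dc_le[OF assms(1)] by auto

lemma cmult_L2: "0 \<le> t \<Longrightarrow> f \<in> L2 \<Longrightarrow> (\<lambda>x. c t x * f x) \<in> L2"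
  by (rule L2_I[OF periodic_mult[OF c(1) L2_periodic] cmult(1)[OF _ L2_sq]])

lemma Lform_L2:
  assumes "0 \<le> t" "has_grad2 f D E" shows "Lform t D E \<in> L2"
proof -
  have "D i \<in> L2" "E i \<in> L2" for i
    using assms(2) has_grad2_L2 has_grad_L2(2) by blast+
  then have "(\<lambda>x. b t x $ i * D i x) \<in> L2" "E i \<in> L2" for i
    using L2_I[OF periodic_mult[OF b(1)[OF assms(1)] L2_periodic] bmult(1)[OF assms(1) L2_sq]] by blast+
  then show ?thesis unfolding Lform_def by (intro L2_add L2_cmult L2_sum)
qed

lemma Lop_L2: "0 \<le> t \<Longrightarrow> f \<in> H2 \<Longrightarrow> Lop \<kappa> b t f \<in> L2"
  unfolding Lop_Lform by (rule Lform_L2[OF _ H2_has_grad2])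

lemma Aop_L2: "0 \<le> t \<Longrightarrow> f \<in> H2 \<Longrightarrow> Aop \<kappa> b c t f \<in> L2"
  unfolding Aop_def Cop_def by (intro L2_add Lop_L2 cmult_L2) (auto simp: H2_def)

text \<open>The second derivatives are integrated by parts, so only first derivatives remain. A
  general \<open>g\<close> serves both the energy estimate, with \<open>g = f\<close>, and the dual
  estimate \<open>Lform_weak\<close>.\<close>

lemma ip_Lform_le:
  assumes t: "0 \<le> t" and f: "has_grad2 f D E" and g: "has_grad g G"
  shows "ip (Lform t D E) g \<le> - \<kappa> * (\<Sum>i\<in>UNIV. ip (D i) (G i)) + (\<Sum>i\<in>UNIV. Bb * l2norm (D i) * l2norm g)"
proof -
  have s: "sq (D i)" "sq (E i)" "sq g" for i
    using f g has_grad2_L2 has_grad_L2 by (blast intro: L2_sq)+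
  have "ip (Lform t D E) g = \<kappa> * (\<Sum>i\<in>UNIV. ip (E i) g) + (\<Sum>i\<in>UNIV. ip (\<lambda>x. b t x $ i * D i x) g)"
    unfolding Lform_def using s bmult(1)[OF t] by (simp add: ip_add_left ip_cmult_left ip_sum_left)
  also have "(\<Sum>i\<in>UNIV. ip (E i) g) = (\<Sum>i\<in>UNIV. - ip (D i) (G i))"
    using f g s(3) by (intro sum.cong refl weak_integration_by_parts[where w = f])
      (auto simp: has_grad2_def has_grad_def)
  also have "(\<Sum>i\<in>UNIV. ip (\<lambda>x. b t x $ i * D i x) g) \<le> (\<Sum>i\<in>UNIV. Bb * l2norm (D i) * l2norm g)"
  proof (rule sum_mono)
    fix i
    have "ip (\<lambda>x. b t x $ i * D i x) g \<le> l2norm (\<lambda>x. b t x $ i * D i x) * l2norm g"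
      using s bmult(1)[OF t] by (intro ip_le) auto
    also have "\<dots> \<le> Bb * l2norm (D i) * l2norm g"
      using bmult(2)[OF t s(1)] by (intro mult_right_mono) auto
    finally show "ip (\<lambda>x. b t x $ i * D i x) g \<le> Bb * l2norm (D i) * l2norm g" .
  qed
  finally show ?thesis by (simp add: sum_negf)
qed

lemma Lform_energy:
  assumes t: "0 \<le> t" and f: "has_grad2 f D E"
  shows "ip (Lform t D E) f \<le> - (\<kappa> / 2) * grad_sq D + KL * (l2norm f)^2"
proof -
  have "ip (Lform t D E) f \<le> - \<kappa> * (\<Sum>i\<in>UNIV. ip (D i) (D i)) + (\<Sum>i\<in>UNIV. Bb * l2norm (D i) * l2norm f)"
    by (rule ip_Lform_le[OF t f has_grad2_L2(1)[OF f]])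
  \<comment> \<open>Half of the dissipation absorbs the drift; the other half is kept for later
    use.\<close>
  also have "(\<Sum>i\<in>UNIV. Bb * l2norm (D i) * l2norm f) \<le>
      (\<Sum>i\<in>UNIV. \<kappa> / 2 * (l2norm (D i))^2 + (Bb * l2norm f)^2 / (2 * \<kappa>))"
    using young[OF kappa, of "l2norm (D i)" "Bb * l2norm f" for i] by (intro sum_mono) (simp add: mult_ac)
  also have "\<dots> = \<kappa> / 2 * grad_sq D + KL * (l2norm f)^2"
    by (simp add: grad_sq_def sum.distrib sum_distrib_left KL_def power_mult_distrib)
  also have "(\<Sum>i\<in>UNIV. ip (D i) (D i)) = grad_sq D" by (simp add: grad_sq_def l2norm_sq)
  finally show ?thesis by simp
qed

lemma Cop_energy:
  assumes "0 \<le> t" "sq f" shows "ip (\<lambda>x. c t x * f x) f \<le> Bc * (l2norm f)^2"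
proof -
  have "ip (\<lambda>x. c t x * f x) f \<le> l2norm (\<lambda>x. c t x * f x) * l2norm f"
    using cmult(1)[OF assms] assms by (intro ip_le)
  also have "\<dots> \<le> Bc * l2norm f * l2norm f" using cmult(2)[OF assms] by (intro mult_right_mono) auto
  finally show ?thesis by (simp add: power2_eq_square mult.assoc)
qed

lemma SL_bound_H2:
  assumes t: "0 \<le> t" and S: "generates S (Lop \<kappa> b t) H2" and f: "f \<in> H2" and s: "0 \<le> s"
  shows "(l2norm (S s f))^2 \<le> exp (2 * KL * s) * (l2norm f)^2"
proof -
  have fL: "f \<in> L2" using f by (simp add: H2_def)
  have "(l2norm (S s f))^2 \<le> exp (2 * KL * (s - 0)) * ((l2norm (S 0 f))^2 + 2 * 0 * (s - 0))"
  proof (rule energy_growth[OF s sg_l2cont[OF S fL] sg_L2[OF S _ fL]])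
    fix r assume r: "0 < r" "r < s"
    have h: "S r f \<in> H2" using r by (intro sg_invariant[OF S f]) auto
    have "0 \<le> \<kappa> / 2 * grad_sq (\<lambda>i. wd [i] (S r f))"
      using kappa by (intro mult_nonneg_nonneg grad_sq_nonneg) auto
    then have "ip (Lop \<kappa> b t (S r f)) (S r f) \<le> KL * (l2norm (S r f))^2 + 0"
      using Lform_energy[OF t H2_has_grad2[OF h]] unfolding Lop_Lform by linarith
    then show "\<exists>g\<in>L2. rderiv (\<lambda>s. S s f) r g \<and> ip g (S r f) \<le> KL * (l2norm (S r f))^2 + 0"
      using sg_rderiv[OF S f, of r] r Lop_L2[OF t h] by (intro bexI[of _ "Lop \<kappa> b t (S r f)"]) auto
  qed (auto simp: KL_nonneg)
  also have "l2norm (S 0 f) = l2norm f"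
    using sg_zero[OF S fL] sg_L2[OF S _ fL, of 0] fL by (intro l2eq_norm) auto
  finally show ?thesis by simp
qed

text \<open>Orbits are known to be differentiable only for data in the domain, so the bound for
  general data is a limit over mollifications.\<close>

lemma SL_bound:
  assumes t: "0 \<le> t" and S: "generates S (Lop \<kappa> b t) H2" and f: "f \<in> L2" and s: "0 \<le> s"
  shows "(l2norm (S s f))^2 \<le> exp (2 * KL * s) * (l2norm f)^2"
proof -
  have fs: "sq f" using f by auto
  have P: "bounded_op (S s)" using sg_bounded_op[OF S s] .
  have m: "mollify n f \<in> H2" "mollify n f \<in> L2" for n using mollify_H2[OF f] by (auto simp: H2_def)
  note 1 = bounded_op_mollify[OF P f]
  have "(\<lambda>n. (l2norm (S s (mollify n f)))^2) \<longlonglongrightarrow> (l2norm (S s f))^2"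
    using bounded_op_L2[OF P] m f by (intro tendsto_power l2norm_tendsto 1) auto
  moreover have "(\<lambda>n. exp (2 * KL * s) * (l2norm (mollify n f))^2) \<longlonglongrightarrow> exp (2 * KL * s) * (l2norm f)^2"
    using m fs by (intro tendsto_intros l2norm_tendsto mollify_tendsto) auto
  ultimately show ?thesis
    by (rule LIMSEQ_le) (use SL_bound_H2[OF t S m(1) s] in blast)
qed

end

section \<open>Freezing the coefficients\<close>

lemma bounded_op_id: "bounded_op id"
  by (auto simp: bounded_op_def intro!: exI[of _ 1])

lemma bounded_op_comp:
  assumes P: "bounded_op P" and Q: "bounded_op Q" shows "bounded_op (P \<circ> Q)"
  unfolding bounded_op_def comp_def
proof (intro conjI ballI allI impI)
  note PL = bounded_op_L2[OF P] and QL = bounded_op_L2[OF Q]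
  show "P (Q f) \<in> L2" if "f \<in> L2" for f using that by (rule PL[OF QL])
  show "l2eq (P (Q f)) (P (Q g))" if "f \<in> L2" "g \<in> L2" "l2eq f g" for f g
    using bounded_op_l2eq[OF P QL QL bounded_op_l2eq[OF Q]] that by blast
  show "l2eq (P (Q (\<lambda>x. a * f x + g x))) (\<lambda>x. a * P (Q f) x + P (Q g) x)" if f: "f \<in> L2" and g: "g \<in> L2" for f g a
  proof -
    have L: "(\<lambda>x. a * f x + g x) \<in> L2" "(\<lambda>x. a * Q f x + Q g x) \<in> L2" using f g QL by auto
    have 1: "l2eq (P (Q (\<lambda>x. a * f x + g x))) (P (\<lambda>x. a * Q f x + Q g x))"
      by (rule bounded_op_l2eq[OF P QL[OF L(1)] L(2) bounded_op_lin[OF Q f g]])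
    have 2: "l2eq (P (\<lambda>x. a * Q f x + Q g x)) (\<lambda>x. a * P (Q f) x + P (Q g) x)"
      by (rule bounded_op_lin[OF P QL[OF f] QL[OF g]])
    show ?thesis
      by (rule l2eq_trans[OF 1 2])
        (intro L2_sq PL QL L L2_add L2_cmult f g)+
  qed
  show "\<exists>B. \<forall>f\<in>L2. l2norm (P (Q f)) \<le> B * l2norm f"
  proof (intro exI ballI)
    fix f :: "'a fn" assume f: "f \<in> L2"
    have "l2norm (P (Q f)) \<le> opnorm P * l2norm (Q f)" by (rule opnorm_bound[OF P QL[OF f]])
    also have "\<dots> \<le> opnorm P * (opnorm Q * l2norm f)"
      by (rule mult_left_mono[OF opnorm_bound[OF Q f] opnorm_nonneg[OF P]])
    finally show "l2norm (P (Q f)) \<le> (opnorm P * opnorm Q) * l2norm f" by (simp add: mult.assoc)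
  qed
qed

lemma bounded_op_opprod: "(\<And>k. bounded_op (Q k)) \<Longrightarrow> bounded_op (opprod Q n)"
  by (induction n) (auto intro: bounded_op_id bounded_op_comp)

text \<open>Mollifications lie in \<open>H2\<close> and converge to \<open>f\<close>, so both error
  bounds need testing only on data with differentiable orbits.\<close>

lemma opnorm_opdiff_le:
  assumes P: "bounded_op P" and Q: "bounded_op Q" and C: "0 \<le> C"
    and le: "\<And>f. f \<in> H2 \<Longrightarrow> l2dist (P f) (Q f) \<le> C * l2norm f"
  shows "opnorm (opdiff P Q) \<le> C"
proof (rule opnorm_le)
  fix f :: "'a fn" assume f: "f \<in> L2" and f1: "l2norm f \<le> 1"
  have m: "mollify n f \<in> H2" "mollify n f \<in> L2" for n using mollify_H2[OF f] by (auto simp: H2_def)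
  note PL = bounded_op_L2[OF P] and QL = bounded_op_L2[OF Q]
  have 1: "l2dist (P f) (Q f) \<le> l2dist (P (mollify n f)) (P f) +
      C * l2norm (mollify n f) + l2dist (Q (mollify n f)) (Q f)" for n
  proof -
    have s: "sq (P f)" "sq (Q f)" "sq (P (mollify n f))" "sq (Q (mollify n f))"
      using PL QL f m by blast+
    show ?thesis
      using l2norm_triangle3[OF s(1,3,2)] l2norm_triangle3[OF s(3,4,2)] le[OF m(1)[of n]]
      by (simp add: l2norm_diff_commute[of "P f"])
  qed
  have "(\<lambda>n. l2dist (P (mollify n f)) (P f) + C * l2norm (mollify n f) +
      l2dist (Q (mollify n f)) (Q f)) \<longlonglongrightarrow> 0 + C * l2norm f + 0"
    using m f by (intro tendsto_add tendsto_mult tendsto_const bounded_op_mollify[OF P f] bounded_op_mollify[OF Q f]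
        l2norm_tendsto mollify_tendsto) auto
  then have "l2dist (P f) (Q f) \<le> 0 + C * l2norm f + 0"
    by (rule LIMSEQ_le_const) (use 1 in blast)
  also have "\<dots> \<le> C" using f1 C by (simp add: mult_left_le)
  finally show "l2norm (opdiff P Q f) \<le> C" by (simp add: opdiff_def)
qed

lemma rderiv_shift: "rderiv (\<lambda>s. u (t0 + s)) s g \<longleftrightarrow> rderiv u (t0 + s) g"
  by (simp add: rderiv_def add.assoc)

lemma l2cont_shift:
  assumes u: "l2cont u a b" and t0: "a \<le> t0" "t0 + d \<le> b" shows "l2cont (\<lambda>s. u (t0 + s)) 0 d"
  unfolding l2cont_def
proof (intro ballI conjI)
  fix s assume s: "s \<in> {0..d}"
  then have t: "t0 + s \<in> {a..b}" using t0 by auto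
  then show "u (t0 + s) \<in> L2" using u by (auto simp: l2cont_def)
  have "((\<lambda>r. l2dist (u r) (u (t0 + s))) \<longlongrightarrow> 0) (at (t0 + s) within {a..b})"
    using u t by (auto simp: l2cont_def)
  moreover have "filterlim (\<lambda>r. t0 + r) (at (t0 + s) within {a..b}) (at s within {0..d})"
    unfolding filterlim_at
  proof
    show "\<forall>\<^sub>F r in at s within {0..d}. t0 + r \<in> {a..b} \<and> t0 + r \<noteq> t0 + s"
      using t0 by (auto simp: eventually_at_filter intro!: always_eventually)
    show "((\<lambda>r. t0 + r) \<longlongrightarrow> t0 + s) (at s within {0..d})" by (intro tendsto_intros)
  qed
  ultimately show "((\<lambda>r. l2dist (u (t0 + r)) (u (t0 + s))) \<longlongrightarrow> 0) (at s within {0..d})"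
    by (rule filterlim_compose)
qed

context advection_coeffs
begin

lemma coeff_drift:
  assumes "0 \<le> t" "0 \<le> r" "\<bar>t - r\<bar> \<le> d"
  shows "\<bar>b t x $ i - b r x $ i\<bar> \<le> H * d powr \<beta>" "\<bar>c t x - c r x\<bar> \<le> H * d powr \<beta>"
proof -
  have "H * \<bar>t - r\<bar> powr \<beta> \<le> H * d powr \<beta>"
    using assms nonneg beta by (intro mult_left_mono powr_mono2) auto
  then have *: "norm (b t x - b r x) + \<bar>c t x - c r x\<bar> \<le> H * d powr \<beta>"
    using hoelder[OF assms(1,2), of x] by linarith
  have "\<bar>b t x $ i - b r x $ i\<bar> \<le> norm (b t x - b r x)"
    using component_le_norm_cart[of "b t x - b r x" i] by simp
  then show "\<bar>b t x $ i - b r x $ i\<bar> \<le> H * d powr \<beta>" using * by linarith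
  show "\<bar>c t x - c r x\<bar> \<le> H * d powr \<beta>" using * norm_ge_zero[of "b t x - b r x"] by linarith
qed

text \<open>It dominates the growth rates of both parts of the energy in \<open>frozen_step\<close>;
  these rates are the two nontrivial bounds in \<open>KA_ge\<close>, the first for the error and the
  second for the weighted solution.\<close>

definition KA :: real where "KA = KL + Bc + real CARD('d) / 2 + 1 / 2 + \<kappa> / 2"

lemma KA_ge: "0 \<le> KA" "KL + Bc + real CARD('d) / 2 + 1 / 2 \<le> KA" "KL + Bc + \<kappa> / 2 \<le> KA"
  using kappa nonneg KL_nonneg by (auto simp: KA_def)

lemma Aop_diff_energy:
  assumes t: "0 \<le> t" and r: "0 \<le> r" and d: "\<bar>t - r\<bar> \<le> d"
    and w: "w \<in> H2" and v: "v \<in> H2" and \<eta>: "\<eta> = H * d powr \<beta>"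
  shows "ip (\<lambda>x. Aop \<kappa> b c t w x - Aop \<kappa> b c r v x) (\<lambda>x. w x - v x) \<le>
    (KL + Bc + real CARD('d) / 2 + 1 / 2) * (l2dist w v)^2
    + \<eta>^2 / 2 * grad_sq (\<lambda>i. wd [i] w) + \<eta>^2 / 2 * (l2norm w)^2"
proof -
  define e where "e = (\<lambda>x. w x - v x)"
  define D where "D = (\<lambda>i x. wd [i] w x - wd [i] v x)"
  define E where "E = (\<lambda>i x. wd [i, i] w x - wd [i, i] v x)"
  have he: "has_grad2 e D E" unfolding e_def D_def E_def by (intro has_grad2_diff H2_has_grad2 w v)
  have se: "sq e" using has_grad_L2(1)[OF has_grad2_L2(1)[OF he]] by auto
  have sw: "sq w" "sq (wd [i] w)" for i
    using has_grad_L2[OF has_grad2_L2(1)[OF H2_has_grad2[OF w]]] by auto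
  have sL: "sq (Lform r D E)" using Lform_L2[OF r he] by auto
  define B where "B = (\<lambda>i x. (b t x $ i - b r x $ i) * wd [i] w x)"
  define F where "F = (\<lambda>x. (c t x - c r x) * w x)"
  have mb: "(\<lambda>x. b t x $ i - b r x $ i) \<in> borel_measurable mcell" for i
    by (intro continuous_measurable_mcell continuous_on_diff smooth_continuous b t r)
  have mc: "(\<lambda>x. c t x - c r x) \<in> borel_measurable mcell"
    by (intro continuous_measurable_mcell continuous_on_diff smooth_continuous c t r)
  have B: "sq (B i)" "l2norm (B i) \<le> \<eta> * l2norm (wd [i] w)" for i
    unfolding B_def \<eta> by (rule sq_mult_bounded[OF mb _ sw(2)]; use coeff_drift[OF t r d] in blast)+
  have F: "sq F" "l2norm F \<le> \<eta> * l2norm w"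
    unfolding F_def \<eta> by (rule sq_mult_bounded[OF mc _ sw(1)]; use coeff_drift[OF t r d] in blast)+
  \<comment> \<open>\<open>B i\<close> and \<open>F\<close> carry the change of drift and potential.
    Each costs half of the squared norm of \<open>e\<close> by Young's inequality, whence the
    summands \<open>real CARD('d) / 2\<close> and \<open>1 / 2\<close>.\<close>
  have "(\<lambda>x. Aop \<kappa> b c t w x - Aop \<kappa> b c r v x) =
      (\<lambda>x. Lform r D E x + c r x * e x + (\<Sum>i\<in>UNIV. B i x) + F x)"
    by (auto simp: Aop_def Cop_def Lop_def Lform_def D_def E_def B_def F_def e_def
        left_diff_distrib right_diff_distrib sum_subtractf)
  then have "ip (\<lambda>x. Aop \<kappa> b c t w x - Aop \<kappa> b c r v x) e =
      ip (Lform r D E) e + ip (\<lambda>x. c r x * e x) e + (\<Sum>i\<in>UNIV. ip (B i) e) + ip F e"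
    using sL B F se cmult(1)[OF r se] by (simp add: ip_add_left ip_sum_left)
  moreover have "ip (Lform r D E) e \<le> KL * (l2norm e)^2"
  proof -
    have "0 \<le> \<kappa> / 2 * grad_sq D" using kappa by (intro mult_nonneg_nonneg grad_sq_nonneg) auto
    then show ?thesis using Lform_energy[OF r he] by linarith
  qed
  moreover have "ip (\<lambda>x. c r x * e x) e \<le> Bc * (l2norm e)^2" by (rule Cop_energy[OF r se])
  moreover have y: "ip f e \<le> \<eta>^2 / 2 * (l2norm g)^2 + 1 / 2 * (l2norm e)^2"
    if "sq f" "l2norm f \<le> \<eta> * l2norm g" for f g
  proof -
    have "ip f e \<le> l2norm f * l2norm e" using that se by (intro ip_le)
    also have "\<dots> \<le> (\<eta> * l2norm g) * l2norm e" using that by (intro mult_right_mono) auto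
    also have "\<dots> \<le> 1 / 2 * (\<eta> * l2norm g)^2 + (l2norm e)^2 / (2 * 1)" by (rule young) simp
    finally show ?thesis by (simp add: power_mult_distrib)
  qed
  have "(\<Sum>i\<in>UNIV. ip (B i) e) \<le> \<eta>^2 / 2 * grad_sq (\<lambda>i. wd [i] w) + real CARD('d) / 2 * (l2norm e)^2"
  proof -
    have "(\<Sum>i\<in>UNIV. ip (B i) e) \<le> (\<Sum>i\<in>UNIV. \<eta>^2 / 2 * (l2norm (wd [i] w))^2 + 1 / 2 * (l2norm e)^2)"
      by (intro sum_mono y B)
    then show ?thesis by (simp add: grad_sq_def sum.distrib sum_distrib_left)
  qed
  moreover have "ip F e \<le> \<eta>^2 / 2 * (l2norm w)^2 + 1 / 2 * (l2norm e)^2" using y F by blast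
  ultimately show ?thesis unfolding e_def[symmetric] by (simp add: distrib_right)
qed

lemma Aop_energy:
  assumes t: "0 \<le> t" and w: "w \<in> H2"
  shows "ip (Aop \<kappa> b c t w) w \<le> - (\<kappa> / 2) * grad_sq (\<lambda>i. wd [i] w) + (KL + Bc) * (l2norm w)^2"
proof -
  have sw: "sq w" using w by (auto simp: H2_def)
  have "ip (Aop \<kappa> b c t w) w = ip (Lop \<kappa> b t w) w + ip (\<lambda>x. c t x * w x) w"
    unfolding Aop_def Cop_def using Lop_L2[OF t w] cmult(1)[OF t sw] sw by (intro ip_add_left) auto
  then show ?thesis
    using Lform_energy[OF t H2_has_grad2[OF w]] Cop_energy[OF t sw]
    unfolding Lop_Lform by (simp add: distrib_right)
qed

text \<open>The weight \<open>lam\<close> lets the dissipation of the exact solution \<open>w\<close> absorb the gradient term that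
  freezing the coefficients produces in the equation for the error.\<close>

lemma frozen_step:
  assumes evo: "evolution_family U (Aop \<kappa> b c)" and S: "generates S (Aop \<kappa> b c r) H2"
    and r: "0 \<le> r" and d: "0 < d" and f: "f \<in> L2" and v: "v \<in> H2"
    and \<eta>: "\<eta> = H * d powr \<beta>" and lam: "lam = \<eta>^2 / \<kappa>"
  shows "(l2dist (U (r + d) 0 f) (S d v))^2 + lam * (l2norm (U (r + d) 0 f))^2 \<le>
    exp (2 * KA * d) * ((l2dist (U r 0 f) v)^2 + lam * (l2norm (U r 0 f))^2)"
proof -
  have AL: "Aop \<kappa> b c t g \<in> L2" if "t \<ge> 0" "g \<in> H2" for t g using that by (rule Aop_L2)
  have vL: "v \<in> L2" using v by (simp add: H2_def)
  have lam0: "0 \<le> lam" using kappa by (simp add: lam)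
  define w where "w s = U (r + s) 0 f" for s
  define e where "e s = (\<lambda>x. w s x - S s v x)" for s
  define \<Phi> where "\<Phi> s = ip (e s) (e s) + lam * ip (w s) (w s)" for s
  have wL: "w s \<in> L2" if "0 \<le> s" for s
    unfolding w_def using that r f by (intro evo_L2[OF evo AL]) auto
  have SL: "S s v \<in> L2" if "0 \<le> s" for s by (rule sg_L2[OF S that vL])
  have eL: "e s \<in> L2" if "0 \<le> s" for s unfolding e_def using that wL SL by auto
  have cw: "l2cont w 0 d" unfolding w_def
    by (rule l2cont_shift[OF evo_l2cont[OF evo AL order_refl f, of "r + d"] r order_refl])
  have ce: "l2cont e 0 d" unfolding e_def by (rule l2cont_diff[OF cw sg_l2cont[OF S vL]])
  have "\<Phi> d \<le> exp (2 * KA * (d - 0)) * (\<Phi> 0 + 0 * (d - 0))"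
  proof (rule gronwall_right)
    show "continuous_on {0..d} \<Phi>"
      unfolding \<Phi>_def by (intro continuous_intros l2cont_ip cw ce)
    fix s assume s: "0 < s" "s < d"
    let ?X = "Aop \<kappa> b c (r + s) (w s)" and ?Y = "Aop \<kappa> b c r (S s v)"
    have hw: "w s \<in> H2" unfolding w_def using s r f by (intro evo_H2[OF evo AL]) auto
    have hv: "S s v \<in> H2" using s by (intro sg_invariant[OF S v]) auto
    have XL: "?X \<in> L2" "?Y \<in> L2" using AL hw hv r s by auto
    have "rderiv (\<lambda>t. U t 0 f) (r + s) ?X"
      unfolding w_def using s r f by (intro evo_rderiv[OF evo AL]) auto
    then have dw: "rderiv w s ?X"
      using rderiv_shift[of "\<lambda>t. U t 0 f" r s ?X] by (simp add: w_def[abs_def])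
    have de: "rderiv e s (\<lambda>x. ?X x - ?Y x)" unfolding e_def
      using s wL SL XL by (intro rderiv_diff[OF dw sg_rderiv[OF S v]]) auto
    have D: "(\<Phi> has_real_derivative ((ip (\<lambda>x. ?X x - ?Y x) (e s) + ip (e s) (\<lambda>x. ?X x - ?Y x)) +
        lam * (ip ?X (w s) + ip (w s) ?X))) (at_right s)"
      unfolding \<Phi>_def using s eL wL XL
      by (intro DERIV_add DERIV_cmult ip_rderiv de dw) auto
    let ?n = "(l2norm (e s))^2" and ?m = "(l2norm (w s))^2" and ?g = "grad_sq (\<lambda>i. wd [i] (w s))"
    have 1: "ip (\<lambda>x. ?X x - ?Y x) (e s) \<le> (KL + Bc + real CARD('d) / 2 + 1 / 2) * ?n + \<eta>^2 / 2 * ?g + \<eta>^2 / 2 * ?m"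
      unfolding e_def using s r by (intro Aop_diff_energy[OF _ _ _ hw hv \<eta>]) auto
    have "lam * ip ?X (w s) \<le> lam * (- (\<kappa> / 2) * ?g + (KL + Bc) * ?m)"
      using s r lam0 by (intro mult_left_mono Aop_energy hw) auto
    \<comment> \<open>The choice of \<open>lam\<close> turns the dissipation rate
      \<open>\<kappa> / 2\<close> into \<open>\<eta>^2 / 2\<close>, exactly the coefficient of the
      gradient term in fact 1.\<close>
    also have "\<dots> = - (\<eta>^2 / 2) * ?g + (KL + Bc) * (lam * ?m)"
      using kappa by (simp add: lam field_simps)
    finally have 2: "lam * ip ?X (w s) \<le> - (\<eta>^2 / 2) * ?g + (KL + Bc) * (lam * ?m)" .
    have 3: "\<eta>^2 / 2 * ?m = \<kappa> / 2 * (lam * ?m)" using kappa by (simp add: lam)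
    have 4: "(KL + Bc + real CARD('d) / 2 + 1 / 2) * ?n \<le> KA * ?n"
      "(KL + Bc + \<kappa> / 2) * (lam * ?m) \<le> KA * (lam * ?m)"
      using KA_ge lam0 by (auto intro!: mult_right_mono)
    have "ip (\<lambda>x. ?X x - ?Y x) (e s) + lam * ip ?X (w s) \<le> KA * ?n + KA * (lam * ?m)"
      using 1 2 3 4 unfolding distrib_right by linarith
    then have "(ip (\<lambda>x. ?X x - ?Y x) (e s) + ip (e s) (\<lambda>x. ?X x - ?Y x)) + lam * (ip ?X (w s) + ip (w s) ?X)
       \<le> 2 * KA * \<Phi> s + 0"
      by (simp add: \<Phi>_def l2norm_sq ip_commute[of "e s" "\<lambda>x. ?X x - ?Y x"] ip_commute[of "w s" ?X] distrib_left)
    with D show "\<exists>D. (\<Phi> has_real_derivative D) (at_right s) \<and> D \<le> 2 * KA * \<Phi> s + 0" by blast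
  qed (use d KA_ge in auto)
  moreover have "l2norm (e 0) = l2dist (w 0) v"
    unfolding e_def using wL[of 0] SL[of 0] vL sg_zero[OF S vL]
    by (intro l2eq_norm l2eq_diff l2eq_refl) auto
  ultimately show ?thesis by (simp add: \<Phi>_def l2norm_sq[symmetric] w_def e_def)
qed

text \<open>At time 0 the error vanishes and the weighted energy is
  \<open>lam * (l2norm f)^2\<close>. The one-step factors multiply to an exponential of the total
  time, and the root of \<open>lam\<close> is \<open>\<eta> / sqrt \<kappa>\<close>.\<close>

lemma frozen_product_H2:
  assumes evo: "evolution_family U (Aop \<kappa> b c)" and S: "\<And>t. 0 \<le> t \<Longrightarrow> generates (S t) (Aop \<kappa> b c t) H2"
    and d: "0 < d" and f: "f \<in> H2" and \<eta>: "\<eta> = H * d powr \<beta>"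
  defines "v \<equiv> \<lambda>n. opprod (\<lambda>k. S (real k * d) d) n f"
  shows "l2dist (U (real n * d) 0 f) (v n) \<le> exp (KA * (real n * d)) * (\<eta> / sqrt \<kappa>) * l2norm f"
proof -
  define lam where "lam = \<eta>^2 / \<kappa>"
  have lam0: "0 \<le> lam" using kappa by (simp add: lam_def)
  have \<eta>0: "0 \<le> \<eta>" using nonneg by (simp add: \<eta>)
  have fL: "f \<in> L2" using f by (simp add: H2_def)
  have "v n \<in> H2 \<and> (l2dist (U (real n * d) 0 f) (v n))^2 + lam * (l2norm (U (real n * d) 0 f))^2
      \<le> exp (2 * KA * (real n * d)) * (lam * (l2norm f)^2)"
  proof (induction n)
    case 0
    have "U 0 0 f \<in> L2" by (rule evo_L2[OF evo Aop_L2 _ _ fL]) auto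
    then have "l2norm (U 0 0 f) = l2norm f"
      using evo_zero[OF evo Aop_L2 order_refl fL] fL by (intro l2eq_norm) auto
    moreover have "l2dist (U 0 0 f) f = 0"
      using evo_zero[OF evo Aop_L2 order_refl fL] by (simp add: l2eq_def)
    ultimately show ?case using f by (simp add: v_def)
  next
    case (Suc n)
    have p: "0 \<le> real n * d" using d by simp
    have vS: "v (Suc n) = S (real n * d) d (v n)" by (simp add: v_def)
    have nS: "real (Suc n) * d = real n * d + d" by (simp add: algebra_simps)
    have "v (Suc n) \<in> H2" unfolding vS using Suc d by (intro sg_invariant[OF S[OF p]]) auto
    moreover have "(l2dist (U (real (Suc n) * d) 0 f) (v (Suc n)))^2 + lam * (l2norm (U (real (Suc n) * d) 0 f))^2
      \<le> exp (2 * KA * d) * ((l2dist (U (real n * d) 0 f) (v n))^2 + lam * (l2norm (U (real n * d) 0 f))^2)"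
      unfolding vS nS using Suc by (intro frozen_step[OF evo S[OF p] p d fL _ \<eta> lam_def]) auto
    moreover have "\<dots> \<le> exp (2 * KA * d) * (exp (2 * KA * (real n * d)) * (lam * (l2norm f)^2))"
      using Suc by (intro mult_left_mono) auto
    moreover have "\<dots> = exp (2 * KA * (real (Suc n) * d)) * (lam * (l2norm f)^2)"
      unfolding nS distrib_left exp_add by simp
    ultimately show ?case by linarith
  qed
  moreover have "0 \<le> lam * (l2norm (U (real n * d) 0 f))^2" using lam0 by simp
  ultimately have "(l2dist (U (real n * d) 0 f) (v n))^2 \<le> exp (2 * KA * (real n * d)) * (lam * (l2norm f)^2)"
    by linarith
  also have "\<dots> = (exp (KA * (real n * d)) * (\<eta> / sqrt \<kappa>) * l2norm f)^2"
    using kappa by (simp add: power_mult_distrib power_divide lam_def exp_double[symmetric] mult.assoc)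
  finally show ?thesis by (rule power2_le_imp_le) (use \<eta>0 kappa in simp)
qed

section \<open>Increments of the advection-diffusion semigroup in the dual of H1\<close>

definition CW :: real where "CW = \<kappa> + real CARD('d) * Bb^2 / \<kappa>"

text \<open>The 1/2 comes from the initial value of the auxiliary energy in
  \<open>semigroup_weak_increment\<close>, the rest from its zero-order term, bounded by
  \<open>SL_bound\<close> and integrated over time at most \<open>T\<close>.\<close>

definition CT :: "real \<Rightarrow> real" where "CT T = 1 / 2 + T * (KL * exp (2 * KL * T))"

lemma CW_pos: "0 < CW"
  unfolding CW_def using kappa by (intro add_pos_nonneg) auto

lemma CT_nonneg: "0 \<le> T \<Longrightarrow> 0 \<le> CT T"
  using KL_nonneg by (simp add: CT_def)

text \<open>Against an H1 function the operator costs only one derivative of \<open>f\<close>. The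
  free weight \<open>lam\<close> balances the dissipation spent on it against the H1 norm of
  \<open>g\<close>.\<close>

lemma Lform_weak:
  assumes t: "0 \<le> t" and f: "has_grad2 f D E" and g: "has_grad g G" and lam: "0 < lam"
  shows "ip (Lform t D E) g \<le> lam * \<kappa> / 2 * grad_sq D + CW / lam * ((l2norm g)^2 + grad_sq G)"
proof -
  have sD: "sq (D i)" and sG: "sq (G i)" for i
    using has_grad_L2(2)[OF has_grad2_L2(1)[OF f]] has_grad_L2(2)[OF g] by auto
  \<comment> \<open>Young's inequality with this parameter is used for diffusion and for drift, each
    taking half of the allowed \<open>lam * \<kappa> / 2\<close>.\<close>
  have e: "0 < lam * \<kappa> / 2" using lam kappa by simp
  have "ip (Lform t D E) g \<le> - \<kappa> * (\<Sum>i\<in>UNIV. ip (D i) (G i)) + (\<Sum>i\<in>UNIV. Bb * l2norm (D i) * l2norm g)"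
    by (rule ip_Lform_le[OF t f g])
  also have "\<dots> = (\<Sum>i\<in>UNIV. \<kappa> * (- ip (D i) (G i)) + Bb * l2norm (D i) * l2norm g)"
    by (simp add: sum_subtractf sum_negf sum_distrib_left)
  also have "\<dots> \<le> (\<Sum>i\<in>UNIV. lam * \<kappa> / 2 * (l2norm (D i))^2 + \<kappa> / lam * (l2norm (G i))^2 + Bb^2 / (\<kappa> * lam) * (l2norm g)^2)"
  proof (rule sum_mono)
    fix i
    have "\<kappa> * (- ip (D i) (G i)) \<le> \<kappa> * (l2norm (D i) * l2norm (G i))"
      using ip_Cauchy_Schwarz[OF sD sG, of i i] kappa by (intro mult_left_mono) auto
    also have "\<dots> = l2norm (D i) * (\<kappa> * l2norm (G i))" by simp
    also have "\<dots> \<le> lam * \<kappa> / 2 / 2 * (l2norm (D i))^2 + (\<kappa> * l2norm (G i))^2 / (2 * (lam * \<kappa> / 2))"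
      by (rule young[OF e])
    also have "(\<kappa> * l2norm (G i))^2 / (2 * (lam * \<kappa> / 2)) = \<kappa> / lam * (l2norm (G i))^2"
      using kappa lam by (simp add: power2_eq_square field_simps)
    finally have 1: "\<kappa> * (- ip (D i) (G i)) \<le> lam * \<kappa> / 2 / 2 * (l2norm (D i))^2 + \<kappa> / lam * (l2norm (G i))^2" .
    have "Bb * l2norm (D i) * l2norm g = l2norm (D i) * (Bb * l2norm g)" by simp
    also have "\<dots> \<le> lam * \<kappa> / 2 / 2 * (l2norm (D i))^2 + (Bb * l2norm g)^2 / (2 * (lam * \<kappa> / 2))"
      by (rule young[OF e])
    also have "(Bb * l2norm g)^2 / (2 * (lam * \<kappa> / 2)) = Bb^2 / (\<kappa> * lam) * (l2norm g)^2"
      using kappa lam by (simp add: power_mult_distrib field_simps)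
    finally have 2: "Bb * l2norm (D i) * l2norm g \<le> lam * \<kappa> / 2 / 2 * (l2norm (D i))^2 + Bb^2 / (\<kappa> * lam) * (l2norm g)^2" .
    show "\<kappa> * (- ip (D i) (G i)) + Bb * l2norm (D i) * l2norm g \<le>
      lam * \<kappa> / 2 * (l2norm (D i))^2 + \<kappa> / lam * (l2norm (G i))^2 + Bb^2 / (\<kappa> * lam) * (l2norm g)^2"
      using 1 2 by linarith
  qed
  also have "\<dots> = lam * \<kappa> / 2 * grad_sq D + \<kappa> / lam * grad_sq G + real CARD('d) * Bb^2 / \<kappa> / lam * (l2norm g)^2"
    by (simp add: grad_sq_def sum.distrib sum_distrib_left)
  \<comment> \<open>\<open>CW\<close> is the sum of the diffusion coefficient
    \<open>\<kappa>\<close> and the drift coefficient, so one constant multiplies the full H1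
    norm.\<close>
  also have "\<dots> \<le> lam * \<kappa> / 2 * grad_sq D + CW / lam * grad_sq G + CW / lam * (l2norm g)^2"
    using kappa lam
    by (intro add_mono order_refl mult_right_mono divide_right_mono grad_sq_nonneg) (auto simp: CW_def)
  finally show ?thesis by (simp add: distrib_left)
qed

text \<open>The semigroup moves an \<open>L2\<close> function by \<open>O(sqrt s)\<close> in the dual of \<open>H1\<close>; this is the quadratic
  (Young) form of that statement, obtained from the growth of
  \<open>ip (S s z) g + lam/2 * (l2norm (S s z))^2\<close>, whose dissipation controls the pairing of the generator with \<open>g\<close>.\<close>

lemma semigroup_weak_increment:
  assumes t: "0 \<le> t" and S: "generates S (Lop \<kappa> b t) H2" and z: "z \<in> H2" and g: "has_grad g G"
    and s: "0 \<le> s" "s \<le> T" and lam: "0 < lam"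
  shows "ip (\<lambda>x. S s z x - z x) g \<le> s * (CW / lam) * ((l2norm g)^2 + grad_sq G) + lam * CT T * (l2norm z)^2"
proof -
  have zL: "z \<in> L2" using z by (simp add: H2_def)
  have gL: "g \<in> L2" using g by (rule has_grad_L2)
  define w where "w \<sigma> = S \<sigma> z" for \<sigma>
  have wL: "w \<sigma> \<in> L2" if "0 \<le> \<sigma>" for \<sigma> unfolding w_def by (rule sg_L2[OF S that zL])
  define R where "R = CW / lam * ((l2norm g)^2 + grad_sq G) + lam * (KL * (exp (2 * KL * T) * (l2norm z)^2))"
  define \<phi> where "\<phi> \<sigma> = ip (w \<sigma>) g + lam / 2 * ip (w \<sigma>) (w \<sigma>)" for \<sigma>
  have cw: "l2cont w 0 s" unfolding w_def by (rule sg_l2cont[OF S zL])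
  have "\<phi> s \<le> exp (0 * (s - 0)) * (\<phi> 0 + R * (s - 0))"
  proof (rule gronwall_right)
    show "continuous_on {0..s} \<phi>" unfolding \<phi>_def
      by (intro continuous_intros l2cont_ip cw l2cont_const gL)
    show "0 \<le> R" unfolding R_def using lam CW_pos KL_nonneg grad_sq_nonneg by simp
    fix r assume r: "0 < r" "r < s"
    let ?X = "Lop \<kappa> b t (w r)"
    have hw: "w r \<in> H2" unfolding w_def using r by (intro sg_invariant[OF S z]) auto
    have XL: "?X \<in> L2" by (rule Lop_L2[OF t hw])
    have dw: "rderiv w r ?X" using sg_rderiv[OF S z, of r] r by (simp add: w_def[abs_def])
    have "(\<phi> has_real_derivative ((ip ?X g + ip (w r) (\<lambda>x. 0)) + lam / 2 * (ip ?X (w r) + ip (w r) ?X))) (at_right r)"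
      unfolding \<phi>_def using r wL gL XL by (intro DERIV_add DERIV_cmult ip_rderiv dw rderiv_const) auto
    moreover have "(ip ?X g + ip (w r) (\<lambda>x. 0)) + lam / 2 * (ip ?X (w r) + ip (w r) ?X) \<le> R"
    proof -
      let ?n = "grad_sq (\<lambda>i. wd [i] (w r))"
      have 1: "ip ?X g \<le> lam * \<kappa> / 2 * ?n + CW / lam * ((l2norm g)^2 + grad_sq G)"
        unfolding Lop_Lform by (rule Lform_weak[OF t H2_has_grad2[OF hw] g lam])
      have "lam * ip ?X (w r) \<le> lam * (- (\<kappa> / 2) * ?n + KL * (l2norm (w r))^2)"
        unfolding Lop_Lform using lam by (intro mult_left_mono Lform_energy[OF t H2_has_grad2[OF hw]]) auto
      moreover have "(l2norm (w r))^2 \<le> exp (2 * KL * T) * (l2norm z)^2"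
      proof -
        have "(l2norm (w r))^2 \<le> exp (2 * KL * r) * (l2norm z)^2"
          unfolding w_def using r by (intro SL_bound[OF t S zL]) auto
        also have "\<dots> \<le> exp (2 * KL * T) * (l2norm z)^2"
          using r s KL_nonneg by (intro mult_right_mono) (auto intro!: mult_left_mono)
        finally show ?thesis .
      qed
      then have "lam * (KL * (l2norm (w r))^2) \<le> lam * (KL * (exp (2 * KL * T) * (l2norm z)^2))"
        using lam KL_nonneg by (intro mult_left_mono) auto
      moreover have "lam * (- (\<kappa> / 2) * ?n + KL * (l2norm (w r))^2) = - (lam * \<kappa> / 2 * ?n) + lam * (KL * (l2norm (w r))^2)"
        by (simp add: algebra_simps)
      ultimately have 2: "lam * ip ?X (w r) \<le> - (lam * \<kappa> / 2 * ?n) + lam * (KL * (exp (2 * KL * T) * (l2norm z)^2))"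
        by linarith
      have 3: "ip (w r) (\<lambda>x. 0) = 0" by (simp add: ip_def)
      have 4: "lam / 2 * (ip ?X (w r) + ip (w r) ?X) = lam * ip ?X (w r)"
        by (simp add: ip_commute[of "w r" ?X])
      show ?thesis unfolding R_def 3 4 using 1 2 by linarith
    qed
    ultimately show "\<exists>D. (\<phi> has_real_derivative D) (at_right r) \<and> D \<le> 0 * \<phi> r + R" by auto
  qed (use s in auto)
  moreover have "\<phi> 0 = ip z g + lam / 2 * (l2norm z)^2"
  proof -
    have e: "l2eq (w 0) z" unfolding w_def by (rule sg_zero[OF S zL])
    have "ip (w 0) g = ip z g" using e wL zL gL by (intro l2eq_ip) auto
    moreover have "l2norm (w 0) = l2norm z" using e wL zL by (intro l2eq_norm) auto
    ultimately show ?thesis by (simp add: \<phi>_def l2norm_sq[symmetric])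
  qed
  moreover have "ip (w s) g \<le> \<phi> s" using lam ip_nonneg[of "w s"] by (simp add: \<phi>_def)
  moreover have "ip (\<lambda>x. S s z x - z x) g = ip (w s) g - ip z g"
    unfolding w_def using sg_L2[OF S s(1) zL] zL gL by (intro ip_diff_left) auto
  ultimately have "ip (\<lambda>x. S s z x - z x) g \<le> lam / 2 * (l2norm z)^2 + R * s" by simp
  also have "R * s = s * (CW / lam) * ((l2norm g)^2 + grad_sq G) + s * (lam * (KL * (exp (2 * KL * T) * (l2norm z)^2)))"
    by (simp add: R_def algebra_simps)
  also have "s * (lam * (KL * (exp (2 * KL * T) * (l2norm z)^2))) \<le> T * (lam * (KL * (exp (2 * KL * T) * (l2norm z)^2)))"
    using s lam KL_nonneg by (intro mult_right_mono) auto
  finally show ?thesis by (simp add: CT_def algebra_simps)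
qed

text \<open>The squared norm of multiplication by \<open>c\<close> on H1. The summand 1 keeps it
  positive when \<open>c\<close> vanishes, since \<open>split_energy\<close> divides by it.\<close>

definition CH :: real where "CH = 3 * Bc^2 + 2 * real CARD('d) * Bg^2 + 1"

lemma CH_pos: "0 < CH"
  unfolding CH_def by (intro add_nonneg_pos) auto

lemma has_grad_cmult:
  assumes t: "0 \<le> t" and f: "has_grad f D"
  shows "has_grad (\<lambda>x. c t x * f x) (\<lambda>i x. c t x * D i x + pd i (c t) x * f x)"
    "(l2norm (\<lambda>x. c t x * f x))^2 + grad_sq (\<lambda>i x. c t x * D i x + pd i (c t) x * f x)
      \<le> CH * ((l2norm f)^2 + grad_sq D)"
proof -
  have fL: "f \<in> L2" and DL: "D i \<in> L2" for i using f has_grad_L2 by blast+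
  show "has_grad (\<lambda>x. c t x * f x) (\<lambda>i x. c t x * D i x + pd i (c t) x * f x)"
    unfolding has_grad_def
    using f fL by (auto simp: has_grad_def intro!: cmult_L2[OF t] is_weak_deriv_smooth_mult[OF c(2,1)[OF t]])
  have 1: "(l2norm (\<lambda>x. c t x * f x))^2 \<le> Bc^2 * (l2norm f)^2"
    using power_mono[OF cmult(2)[OF t L2_sq[OF fL]], of 2] by (simp add: power_mult_distrib)
  have 2: "(l2norm (\<lambda>x. c t x * D i x + pd i (c t) x * f x))^2 \<le> 2 * Bc^2 * (l2norm (D i))^2 + 2 * Bg^2 * (l2norm f)^2" for i
  proof -
    have "l2norm (\<lambda>x. c t x * D i x + pd i (c t) x * f x) \<le> l2norm (\<lambda>x. c t x * D i x) + l2norm (\<lambda>x. pd i (c t) x * f x)"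
      by (intro l2norm_triangle cmult dcmult t L2_sq fL DL)
    also have "\<dots> \<le> Bc * l2norm (D i) + Bg * l2norm f"
      by (intro add_mono cmult dcmult t L2_sq fL DL)
    finally have "(l2norm (\<lambda>x. c t x * D i x + pd i (c t) x * f x))^2 \<le> (Bc * l2norm (D i) + Bg * l2norm f)^2"
      by (intro power_mono) auto
    also have "\<dots> \<le> 2 * (Bc * l2norm (D i))^2 + 2 * (Bg * l2norm f)^2"
      using sum_squares_bound[of "Bc * l2norm (D i)" "Bg * l2norm f"] by (simp add: power2_sum)
    finally show ?thesis by (simp add: power_mult_distrib)
  qed
  have "grad_sq (\<lambda>i x. c t x * D i x + pd i (c t) x * f x) \<le>
      (\<Sum>i\<in>UNIV. 2 * Bc^2 * (l2norm (D i))^2 + 2 * Bg^2 * (l2norm f)^2)"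
    unfolding grad_sq_def by (intro sum_mono 2)
  also have "\<dots> = 2 * Bc^2 * grad_sq D + 2 * real CARD('d) * Bg^2 * (l2norm f)^2"
    by (simp add: grad_sq_def sum.distrib sum_distrib_left)
  finally have "(l2norm (\<lambda>x. c t x * f x))^2 + grad_sq (\<lambda>i x. c t x * D i x + pd i (c t) x * f x) \<le>
      (Bc^2 + 2 * real CARD('d) * Bg^2) * (l2norm f)^2 + 2 * Bc^2 * grad_sq D"
    using 1 by (simp add: distrib_right)
  also have "\<dots> \<le> CH * (l2norm f)^2 + CH * grad_sq D"
    by (intro add_mono mult_right_mono grad_sq_nonneg) (auto simp: CH_def add_nonneg_nonneg)
  finally show "(l2norm (\<lambda>x. c t x * f x))^2 + grad_sq (\<lambda>i x. c t x * D i x + pd i (c t) x * f x)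
      \<le> CH * ((l2norm f)^2 + grad_sq D)" by (simp add: distrib_left)
qed

end

section \<open>Operator splitting\<close>

lemma H2_diff: assumes "f \<in> H2" "g \<in> H2" shows "(\<lambda>x. f x - g x) \<in> H2"
proof -
  have s: "sq f" "sq g" using assms by (auto simp: H2_def)
  show ?thesis unfolding H2_def mem_Collect_eq
  proof (intro conjI allI impI)
    show "(\<lambda>x. f x - g x) \<in> L2" using assms by (auto simp: H2_def)
    fix \<alpha> :: "'a list" assume "length \<alpha> \<le> 2"
    then obtain f' g' where "is_weak_deriv \<alpha> f f'" "is_weak_deriv \<alpha> g g'"
      using assms unfolding H2_def by blast
    then show "\<exists>h. is_weak_deriv \<alpha> (\<lambda>x. f x - g x) h" using is_weak_deriv_diff s by blast
  qed
qed

lemma has_grad_scale: "has_grad f D \<Longrightarrow> has_grad (\<lambda>x. a * f x) (\<lambda>i x. a * D i x)"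
  by (auto simp: has_grad_def intro: is_weak_deriv_cmult)

context advection_coeffs
begin

lemma grad_sq_scale: "grad_sq (\<lambda>i x. a * D i x) = a^2 * grad_sq D"
  by (simp add: grad_sq_def l2norm_cmult power_mult_distrib sum_distrib_left)

text \<open>The operator itself contributes \<open>KL + Bc\<close>, the two increment terms of
  \<open>split_energy\<close> contribute \<open>\<kappa> / 8\<close> each, and the two remaining
  Young terms 1/2 each.\<close>

definition KS :: real where "KS = KL + Bc + \<kappa> / 4 + 1"

lemma KS_nonneg: "0 \<le> KS"
  using kappa nonneg KL_nonneg by (simp add: KS_def)

text \<open>Here \<open>z\<close>, \<open>p\<close>, \<open>q\<close> stand for the norms of \<open>z\<close>, of \<open>p = exp (d C) z - z\<close> and of \<open>C z - p / d\<close>.\<close>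

definition defect :: "real \<Rightarrow> real \<Rightarrow> real \<Rightarrow> real \<Rightarrow> real \<Rightarrow> real" where
  "defect T d z p q = 8 * CW * CH * d / \<kappa> * CT T * z^2 + 8 * CW / (\<kappa> * d) * CT T * p^2
     + 1 / 2 * (Bc^2 * (exp (2 * KL * T) * p^2)) + 1 / 2 * q^2"

lemma defect_nonneg: "0 \<le> T \<Longrightarrow> 0 < d \<Longrightarrow> 0 \<le> defect T d z p q"
  unfolding defect_def using kappa CW_pos CH_pos CT_nonneg[of T]
  by (intro add_nonneg_nonneg mult_nonneg_nonneg divide_nonneg_nonneg) auto

lemma ip_young: "sq f \<Longrightarrow> sq g \<Longrightarrow> ip f g \<le> 1 / 2 * (l2norm f)^2 + 1 / 2 * (l2norm g)^2"
  using ip_le[of f g] young[of 1 "l2norm f" "l2norm g"] by simp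

text \<open>The residual contains two semigroup increments, small only in the dual of H1, and two
  terms small in L2. Each increment spends \<open>\<kappa> / 8\<close> of the gradient of
  \<open>e\<close>, together less than the available \<open>\<kappa> / 2\<close>.\<close>

lemma split_energy:
  assumes t: "0 \<le> t" and SL: "generates S (Lop \<kappa> b t) H2"
    and u: "u \<in> H2" and z: "z \<in> H2" and p: "p \<in> H2" and d: "0 < d" "d \<le> T" and s: "0 < s" "s < d"
    and \<tau>: "\<tau> = s / d"
  defines "e \<equiv> \<lambda>x. u x - S s z x - \<tau> * S s p x"
  shows "ip (\<lambda>x. Aop \<kappa> b c t u x - Lop \<kappa> b t (S s z) x - (\<tau> * Lop \<kappa> b t (S s p) x + 1 / d * S s p x)) e
    \<le> KS * (l2norm e)^2 + defect T d (l2norm z) (l2norm p) (l2norm (\<lambda>x. c t x * z x - 1 / d * p x))"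
proof -
  define z1 where "z1 = S s z"
  define z2 where "z2 = S s p"
  define q where "q = (\<lambda>x. c t x * z x - 1 / d * p x)"
  have \<tau>01: "0 \<le> \<tau>" "\<tau> \<le> 1" using s by (auto simp: \<tau>)
  have h: "z1 \<in> H2" "z2 \<in> H2" unfolding z1_def z2_def using s by (auto intro!: sg_invariant[OF SL] z p)
  have H2L: "\<And>f. f \<in> H2 \<Longrightarrow> f \<in> L2" by (simp add: H2_def)
  have sqs: "sq u" "sq z" "sq p" "sq z1" "sq z2" using H2L u z p h by blast+
  define D where "D = (\<lambda>i x. wd [i] u x - wd [i] z1 x - \<tau> * wd [i] z2 x)"
  define E where "E = (\<lambda>i x. wd [i, i] u x - wd [i, i] z1 x - \<tau> * wd [i, i] z2 x)"
  have he: "has_grad2 e D E" unfolding e_def D_def E_def z1_def[symmetric] z2_def[symmetric]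
    by (intro has_grad2_diff has_grad2_cmult H2_has_grad2 u h)
  have hg: "has_grad e D" by (rule has_grad2_L2(1)[OF he])
  have eL: "e \<in> L2" by (rule has_grad_L2(1)[OF hg])
  have se: "sq e" using eL by (rule L2_sq)
  have sL: "sq (Lform t D E)" using Lform_L2[OF t he] by auto
  have sc: "sq (\<lambda>x. c t x * e x)" "sq (\<lambda>x. c t x * (z1 x - z x))" "sq (\<lambda>x. c t x * z2 x)" "sq q"
    unfolding q_def using sqs se by (simp_all add: cmult(1)[OF t])
  let ?n = "(l2norm e)^2" and ?g = "grad_sq D"
  have g0: "0 \<le> ?g" by (rule grad_sq_nonneg)
  \<comment> \<open>Expand \<open>u\<close> as \<open>e + z1 + \<tau> * z2\<close> in the potential
    term, then compare \<open>z1\<close> with \<open>z\<close> and \<open>z2\<close> with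
    \<open>p\<close>; what is left over is \<open>q\<close>.\<close>
  have "(\<lambda>x. Aop \<kappa> b c t u x - Lop \<kappa> b t z1 x - (\<tau> * Lop \<kappa> b t z2 x + 1 / d * z2 x)) =
     (\<lambda>x. Lform t D E x + c t x * e x + c t x * (z1 x - z x) + \<tau> * (c t x * z2 x) + q x + (- (1 / d)) * (z2 x - p x))"
  proof
    fix x
    have "Aop \<kappa> b c t u x - Lop \<kappa> b t z1 x - \<tau> * Lop \<kappa> b t z2 x = Lform t D E x + c t x * u x"
      by (simp add: Aop_def Cop_def Lop_def Lform_def D_def E_def right_diff_distrib sum_subtractf
          sum_distrib_left distrib_left mult.left_commute)
    then show "Aop \<kappa> b c t u x - Lop \<kappa> b t z1 x - (\<tau> * Lop \<kappa> b t z2 x + 1 / d * z2 x) =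
      Lform t D E x + c t x * e x + c t x * (z1 x - z x) + \<tau> * (c t x * z2 x) + q x + (- (1 / d)) * (z2 x - p x)"
      by (simp add: e_def q_def z1_def[symmetric] z2_def[symmetric] algebra_simps)
  qed
  then have "ip (\<lambda>x. Aop \<kappa> b c t u x - Lop \<kappa> b t z1 x - (\<tau> * Lop \<kappa> b t z2 x + 1 / d * z2 x)) e =
      ip (Lform t D E) e + ip (\<lambda>x. c t x * e x) e + ip (\<lambda>x. c t x * (z1 x - z x)) e
      + \<tau> * ip (\<lambda>x. c t x * z2 x) e + ip q e + ip (\<lambda>x. (- (1 / d)) * (z2 x - p x)) e"
    using sL sc se sqs by (simp only: ip_add_left ip_cmult_left sq_add sq_cmult sq_diff)
  moreover have "ip (Lform t D E) e \<le> - (\<kappa> / 2) * ?g + KL * ?n" by (rule Lform_energy[OF t he])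
  moreover have "ip (\<lambda>x. c t x * e x) e \<le> Bc * ?n" by (rule Cop_energy[OF t se])
  moreover have "ip (\<lambda>x. c t x * (z1 x - z x)) e \<le> \<kappa> / 8 * (?n + ?g) + 8 * CW * CH * d / \<kappa> * CT T * (l2norm z)^2"
  proof -
    \<comment> \<open>Chosen so that the H1 norm of \<open>e\<close> gets the coefficient
      \<open>\<tau> * \<kappa> / 8\<close>; the price \<open>l * CT T * (l2norm z)^2\<close> is of
      order \<open>d\<close>.\<close>
    define l where "l = 8 * CW * CH * d / \<kappa>"
    have l: "0 < l" unfolding l_def using CW_pos CH_pos d kappa by simp
    \<comment> \<open>The potential moves to the test function, so that the bare increment is paired
      with the H1 function \<open>c * e\<close>.\<close>
    have "ip (\<lambda>x. c t x * (z1 x - z x)) e = ip (\<lambda>x. z1 x - z x) (\<lambda>x. c t x * e x)"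
      by (simp add: ip_def mult_ac)
    also have "\<dots> \<le> s * (CW / l) * ((l2norm (\<lambda>x. c t x * e x))^2 + grad_sq (\<lambda>i x. c t x * D i x + pd i (c t) x * e x))
        + l * CT T * (l2norm z)^2"
      unfolding z1_def using s d by (intro semigroup_weak_increment[OF t SL z has_grad_cmult(1)[OF t hg] _ _ l]) auto
    also have "s * (CW / l) * ((l2norm (\<lambda>x. c t x * e x))^2 + grad_sq (\<lambda>i x. c t x * D i x + pd i (c t) x * e x))
        \<le> s * (CW / l) * (CH * (?n + ?g))"
      using s CW_pos l by (intro mult_left_mono has_grad_cmult(2)[OF t hg]) auto
    also have "s * (CW / l) * (CH * (?n + ?g)) = \<tau> * (\<kappa> / 8 * (?n + ?g))"
      using CW_pos CH_pos d kappa by (simp add: l_def \<tau> field_simps)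
    also have "\<dots> \<le> 1 * (\<kappa> / 8 * (?n + ?g))"
      using \<tau>01 kappa g0 by (intro mult_right_mono) auto
    finally show ?thesis by (simp add: l_def)
  qed
  moreover have "\<tau> * ip (\<lambda>x. c t x * z2 x) e \<le> 1 / 2 * (Bc^2 * (exp (2 * KL * T) * (l2norm p)^2)) + 1 / 2 * ?n"
  proof -
    have "(l2norm z2)^2 \<le> exp (2 * KL * s) * (l2norm p)^2"
      unfolding z2_def using s by (intro SL_bound[OF t SL H2L[OF p]]) auto
    also have "\<dots> \<le> exp (2 * KL * T) * (l2norm p)^2"
      using s d KL_nonneg by (intro mult_right_mono) (auto intro!: mult_left_mono)
    finally have "Bc^2 * (l2norm z2)^2 \<le> Bc^2 * (exp (2 * KL * T) * (l2norm p)^2)" by (intro mult_left_mono) auto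
    moreover have "(l2norm (\<lambda>x. c t x * z2 x))^2 \<le> Bc^2 * (l2norm z2)^2"
      using power_mono[OF cmult(2)[OF t sqs(5)], of 2] by (simp add: power_mult_distrib)
    ultimately have 1: "ip (\<lambda>x. c t x * z2 x) e \<le> 1 / 2 * (Bc^2 * (exp (2 * KL * T) * (l2norm p)^2)) + 1 / 2 * ?n"
      using ip_young[OF sc(3) se] by linarith
    have "\<tau> * ip (\<lambda>x. c t x * z2 x) e \<le> \<tau> * (1 / 2 * (Bc^2 * (exp (2 * KL * T) * (l2norm p)^2)) + 1 / 2 * ?n)"
      by (rule mult_left_mono[OF 1 \<tau>01(1)])
    also have "\<dots> \<le> 1 * (1 / 2 * (Bc^2 * (exp (2 * KL * T) * (l2norm p)^2)) + 1 / 2 * ?n)"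
      using \<tau>01 by (intro mult_right_mono) auto
    finally show ?thesis by simp
  qed
  moreover have "ip q e \<le> 1 / 2 * (l2norm q)^2 + 1 / 2 * ?n" by (rule ip_young[OF sc(4) se])
  moreover have "ip (\<lambda>x. (- (1 / d)) * (z2 x - p x)) e \<le> \<kappa> / 8 * (?n + ?g) + 8 * CW / (\<kappa> * d) * CT T * (l2norm p)^2"
  proof -
    \<comment> \<open>The test function is \<open>- e / d\<close>, so the weight must be of order
      \<open>1 / d\<close> to leave \<open>\<tau> * \<kappa> / 8\<close>. This is affordable because
      \<open>l2norm p\<close> will be of order \<open>d\<close>.\<close>
    define l where "l = 8 * CW / (\<kappa> * d)"
    have l: "0 < l" unfolding l_def using CW_pos d kappa by simp
    have "ip (\<lambda>x. (- (1 / d)) * (z2 x - p x)) e = ip (\<lambda>x. z2 x - p x) (\<lambda>x. (- (1 / d)) * e x)"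
      unfolding ip_cmult_left ip_cmult_right ..
    also have "\<dots> \<le> s * (CW / l) * ((l2norm (\<lambda>x. (- (1 / d)) * e x))^2 + grad_sq (\<lambda>i x. (- (1 / d)) * D i x)) + l * CT T * (l2norm p)^2"
      unfolding z2_def using s d by (intro semigroup_weak_increment[OF t SL p has_grad_scale[OF hg] _ _ l]) auto
    also have "s * (CW / l) * ((l2norm (\<lambda>x. (- (1 / d)) * e x))^2 + grad_sq (\<lambda>i x. (- (1 / d)) * D i x)) = \<tau> * (\<kappa> / 8 * (?n + ?g))"
      unfolding grad_sq_scale l2norm_cmult using CW_pos d kappa by (simp add: l_def \<tau> field_simps power2_eq_square)
    also have "\<dots> \<le> 1 * (\<kappa> / 8 * (?n + ?g))"
      using \<tau>01 kappa g0 by (intro mult_right_mono) auto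
    finally show ?thesis by (simp add: l_def)
  qed
  moreover have "0 \<le> \<kappa> / 4 * ?g" using kappa g0 by simp
  ultimately show ?thesis
    unfolding z1_def[symmetric] z2_def[symmetric] q_def[symmetric] defect_def KS_def distrib_right distrib_left
    by linarith
qed

text \<open>The interpolant is \<open>z\<close> at time 0 and \<open>SL d y\<close> at time
  \<open>d\<close>, so the growth of its distance to the orbit of \<open>u\<close> bounds the error
  of the step. No relation between \<open>y\<close> and \<open>z\<close> is imposed; it enters only
  through the defect.\<close>

lemma split_step_H2:
  assumes t: "0 \<le> t" and SA: "generates SA (Aop \<kappa> b c t) H2" and SL: "generates SL (Lop \<kappa> b t) H2"
    and u: "u \<in> H2" and z: "z \<in> H2" and y: "y \<in> H2" and d: "0 < d" "d \<le> T"
  defines "p \<equiv> \<lambda>x. y x - z x"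
  shows "(l2dist (SA d u) (SL d y))^2 \<le> exp (2 * KS * d) * ((l2dist u z)^2
     + 2 * defect T d (l2norm z) (l2norm p) (l2norm (\<lambda>x. c t x * z x - 1 / d * p x)) * d)"
proof -
  have p: "p \<in> H2" unfolding p_def by (rule H2_diff[OF y z])
  have L: "u \<in> L2" "z \<in> L2" "y \<in> L2" "p \<in> L2" using u z y p by (auto simp: H2_def)
  define R where "R = defect T d (l2norm z) (l2norm p) (l2norm (\<lambda>x. c t x * z x - 1 / d * p x))"
  have R: "0 \<le> R" unfolding R_def using d by (intro defect_nonneg) auto
  define e where "e s = (\<lambda>x. (SA s u x - SL s z x) - (0 + 1 / d * s) * SL s p x)" for s
  have SLL: "SL s f \<in> L2" if "0 \<le> s" "f \<in> L2" for s f by (rule sg_L2[OF SL that])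
  have SAL: "SA s f \<in> L2" if "0 \<le> s" "f \<in> L2" for s f by (rule sg_L2[OF SA that])
  have "(l2norm (e d))^2 \<le> exp (2 * KS * (d - 0)) * ((l2norm (e 0))^2 + 2 * R * (d - 0))"
  proof (rule energy_growth)
    show "l2cont e 0 d" unfolding e_def
      by (intro l2cont_diff l2cont_affine_mult sg_l2cont[OF SA] sg_l2cont[OF SL] L)
    show eL: "e s \<in> L2" if "0 \<le> s" for s unfolding e_def
      using that by (intro L2_diff L2_cmult SLL SAL L)
    fix s assume s: "0 < s" "s < d"
    let ?X = "Aop \<kappa> b c t (SA s u)" and ?Z = "Lop \<kappa> b t (SL s z)" and ?P = "Lop \<kappa> b t (SL s p)"
    have h: "SA s u \<in> H2" "SL s z \<in> H2" "SL s p \<in> H2"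
      using s by (auto intro!: sg_invariant[OF SA] sg_invariant[OF SL] u z p)
    have XL: "?X \<in> L2" "?Z \<in> L2" "?P \<in> L2" by (intro Aop_L2 Lop_L2 t h)+
    let ?G = "\<lambda>x. ?X x - ?Z x - ((0 + 1 / d * s) * ?P x + 1 / d * SL s p x)"
    have 1: "rderiv (\<lambda>s x. SA s u x - SL s z x) s (\<lambda>x. ?X x - ?Z x)"
      using s by (intro rderiv_diff sg_rderiv[OF SA u] sg_rderiv[OF SL z] SAL SLL L XL) auto
    have 2: "rderiv (\<lambda>s x. (0 + 1 / d * s) * SL s p x) s (\<lambda>x. (0 + 1 / d * s) * ?P x + 1 / d * SL s p x)"
      using s by (intro rderiv_affine_mult sg_rderiv[OF SL p] SLL L XL) auto
    have "rderiv e s ?G" unfolding e_def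
      by (rule rderiv_diff[OF 1 2]; intro L2_diff L2_add L2_cmult SAL SLL L XL; use s in simp)
    moreover have "?G \<in> L2" using s by (intro L2_diff L2_add L2_cmult SLL L XL) auto
    moreover have "ip ?G (e s) \<le> KS * (l2norm (e s))^2 + R"
      using split_energy[OF t SL h(1) z p d s refl] by (simp add: e_def R_def)
    ultimately show "\<exists>g\<in>L2. rderiv e s g \<and> ip g (e s) \<le> KS * (l2norm (e s))^2 + R" by blast
  qed (use d R KS_nonneg in auto)
  moreover have "l2norm (e 0) = l2dist u z"
  proof -
    have "l2eq (\<lambda>x. SA 0 u x - SL 0 z x) (\<lambda>x. u x - z x)"
      by (intro l2eq_diff sg_zero[OF SA] sg_zero[OF SL] L2_sq SAL SLL L order_refl)
    then have "l2dist (SA 0 u) (SL 0 z) = l2dist u z"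
      by (rule l2eq_norm) (intro sq_diff L2_sq SAL SLL L order_refl)+
    then show ?thesis by (simp add: e_def)
  qed
  moreover have "l2norm (e d) = l2dist (SA d u) (SL d y)"
  proof -
    have d0: "0 \<le> d" using d by simp
    have "l2eq (SL d (\<lambda>x. y x - z x)) (\<lambda>x. SL d y x - SL d z x)"
      by (rule bounded_op_diff[OF sg_bounded_op[OF SL d0] L(3,2)])
    then have "l2eq (\<lambda>x. (SA d u x - SL d z x) - SL d p x) (\<lambda>x. (SA d u x - SL d z x) - (SL d y x - SL d z x))"
      unfolding p_def[symmetric] by (intro l2eq_diff l2eq_refl sq_diff L2_sq SAL SLL L d0)
    then have "l2norm (\<lambda>x. (SA d u x - SL d z x) - SL d p x) = l2norm (\<lambda>x. (SA d u x - SL d z x) - (SL d y x - SL d z x))"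
      by (rule l2eq_norm) (intro sq_diff L2_sq SAL SLL L d0)+
    then show ?thesis using d by (simp add: e_def)
  qed
  ultimately show ?thesis by (simp add: R_def)
qed

text \<open>\<open>u\<close>, \<open>z\<close> and \<open>y\<close> are mollified independently.
  This permits \<open>y = exp (d C) z\<close> later on, as every quantity in the inequality, the
  defect included, is continuous in L2.\<close>

lemma split_step_L2:
  assumes t: "0 \<le> t" and SA: "generates SA (Aop \<kappa> b c t) H2" and SL: "generates SL (Lop \<kappa> b t) H2"
    and u: "u \<in> L2" and z: "z \<in> L2" and y: "y \<in> L2" and d: "0 < d" "d \<le> T"
  defines "p \<equiv> \<lambda>x. y x - z x"
  shows "(l2dist (SA d u) (SL d y))^2 \<le> exp (2 * KS * d) * ((l2dist u z)^2
     + 2 * defect T d (l2norm z) (l2norm p) (l2norm (\<lambda>x. c t x * z x - 1 / d * p x)) * d)"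
proof -
  have d0: "0 \<le> d" using d by simp
  note PA = sg_bounded_op[OF SA d0] and PL = sg_bounded_op[OF SL d0]
  define m where "m = (\<lambda>n (f::'d fn). mollify n f)"
  have mH: "m n f \<in> H2" "m n f \<in> L2" if "f \<in> L2" for n f
    using mollify_H2[OF that] by (auto simp: m_def H2_def)
  have lim: "(\<lambda>n. l2dist (m n f) f) \<longlonglongrightarrow> 0" if "f \<in> L2" for f
    unfolding m_def by (rule mollify_tendsto[OF L2_sq[OF that]])
  have diff: "(\<lambda>n. l2dist (f n) (g n)) \<longlonglongrightarrow> l2dist f0 g0"
    if "\<And>n. f n \<in> L2" "\<And>n. g n \<in> L2" "f0 \<in> L2" "g0 \<in> L2"
      "(\<lambda>n. l2dist (f n) f0) \<longlonglongrightarrow> 0" "(\<lambda>n. l2dist (g n) g0) \<longlonglongrightarrow> 0"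
    for f g :: "nat \<Rightarrow> 'd fn" and f0 g0
  proof (rule l2norm_tendsto)
    show "(\<lambda>n. l2norm (\<lambda>x. f n x - g n x - (f0 x - g0 x))) \<longlonglongrightarrow> 0"
    proof (rule tendsto_0_le[OF tendsto_add_zero[OF that(5,6)], of _ 1], intro always_eventually allI)
      fix n
      have "l2norm (\<lambda>x. (f n x - f0 x) - (g n x - g0 x)) \<le> l2dist (f n) f0 + l2dist (g n) g0"
        using that by (intro l2norm_triangle_diff) auto
      then show "norm (l2norm (\<lambda>x. f n x - g n x - (f0 x - g0 x))) \<le> norm (l2dist (f n) f0 + l2dist (g n) g0) * 1"
        by (simp add: algebra_simps)
    qed
  qed (use that in auto)
  have lin: "(\<lambda>n. l2norm (\<lambda>x. (c t x + 1 / d) * m n z x - (c t x + 1 / d) * z x)) \<longlonglongrightarrow> 0"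
  proof (rule tendsto_0_le[OF lim[OF z], of _ "Bc + 1 / d"], intro always_eventually allI)
    fix n
    have s: "sq (\<lambda>x. m n z x - z x)" using mH[OF z] z by auto
    have "l2norm (\<lambda>x. c t x * (m n z x - z x) + 1 / d * (m n z x - z x)) \<le>
        l2norm (\<lambda>x. c t x * (m n z x - z x)) + l2norm (\<lambda>x. 1 / d * (m n z x - z x))"
      by (intro l2norm_triangle cmult(1)[OF t] sq_cmult s)
    also have "\<dots> \<le> Bc * l2dist (m n z) z + 1 / d * l2dist (m n z) z"
      unfolding l2norm_cmult using cmult(2)[OF t s] d by simp
    finally show "norm (l2norm (\<lambda>x. (c t x + 1 / d) * m n z x - (c t x + 1 / d) * z x)) \<le>
        norm (l2dist (m n z) z) * (Bc + 1 / d)"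
      by (simp add: algebra_simps)
  qed
  have cL: "(\<lambda>x. (c t x + 1 / d) * f x) \<in> L2" if "f \<in> L2" for f
  proof -
    have "(\<lambda>x. c t x * f x + 1 / d * f x) \<in> L2" by (intro L2_add cmult_L2 t L2_cmult that)
    then show ?thesis by (simp add: algebra_simps)
  qed
  have liny: "(\<lambda>n. l2norm (\<lambda>x. 1 / d * m n y x - 1 / d * y x)) \<longlonglongrightarrow> 0"
    using tendsto_mult_left[OF lim[OF y], of "1 / d"] d
    by (simp add: right_diff_distrib[symmetric] l2norm_cmult l2norm_divide diff_divide_distrib[symmetric] del: times_divide_eq_left)
  have q_eq: "(\<lambda>x. c t x * f x - 1 / d * (g x - f x)) = (\<lambda>x. (c t x + 1 / d) * f x - 1 / d * g x)" for f g :: "'d fn"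
    by (auto simp: algebra_simps)
  have l1: "(\<lambda>n. l2dist (SA d (m n u)) (SL d (m n y))) \<longlonglongrightarrow> l2dist (SA d u) (SL d y)"
    using bounded_op_mollify[OF PA u] bounded_op_mollify[OF PL y]
    by (intro diff bounded_op_L2[OF PA] bounded_op_L2[OF PL] mH u y) (auto simp: m_def)
  have l2: "(\<lambda>n. l2dist (m n u) (m n z)) \<longlonglongrightarrow> l2dist u z"
    by (intro diff mH lim u z)
  have l3: "(\<lambda>n. l2norm (m n z)) \<longlonglongrightarrow> l2norm z"
    using mH[OF z] z by (intro l2norm_tendsto lim) auto
  have l4: "(\<lambda>n. l2dist (m n y) (m n z)) \<longlonglongrightarrow> l2dist y z"
    by (intro diff mH lim y z)
  have l5: "(\<lambda>n. l2norm (\<lambda>x. c t x * m n z x - 1 / d * (m n y x - m n z x))) \<longlonglongrightarrow>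
      l2norm (\<lambda>x. c t x * z x - 1 / d * (y x - z x))"
    unfolding q_eq by (intro diff cL L2_cmult mH z y lin liny)
  have r: "(\<lambda>n. exp (2 * KS * d) * ((l2dist (m n u) (m n z))^2 + 2 * defect T d (l2norm (m n z))
      (l2dist (m n y) (m n z)) (l2norm (\<lambda>x. c t x * m n z x - 1 / d * (m n y x - m n z x))) * d))
    \<longlonglongrightarrow> exp (2 * KS * d) * ((l2dist u z)^2 + 2 * defect T d (l2norm z)
      (l2dist y z) (l2norm (\<lambda>x. c t x * z x - 1 / d * (y x - z x))) * d)"
    unfolding defect_def by (intro tendsto_intros l2 l3 l4 l5)
  show ?thesis unfolding p_def
    by (rule LIMSEQ_le[OF tendsto_power[OF l1] r]) (use split_step_H2[OF t SA SL mH(1)[OF u] mH(1)[OF z] mH(1)[OF y] d] in blast)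
qed

end

context advection_coeffs
begin

section \<open>The semigroup generated by multiplication by c\<close>

context
  fixes S :: "real \<Rightarrow> 'd op" and t :: real
  assumes t: "0 \<le> t" and SC: "generates S (Cop c t) L2"
begin

lemma SC_rderiv: "f \<in> L2 \<Longrightarrow> 0 \<le> s \<Longrightarrow> rderiv (\<lambda>s. S s f) s (\<lambda>x. c t x * S s f x)"
  using sg_rderiv[OF SC] by (simp add: Cop_def)

lemma SC_L2: "0 \<le> s \<Longrightarrow> f \<in> L2 \<Longrightarrow> S s f \<in> L2"
  by (rule sg_L2[OF SC])

text \<open>\<open>S\<close> is given only through its generator; its energy is estimated directly,
  without identifying it with multiplication by \<open>exp (s * c)\<close>.\<close>

lemma SC_bound:
  assumes f: "f \<in> L2" and s: "0 \<le> s" shows "l2norm (S s f) \<le> exp (Bc * s) * l2norm f"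
proof (rule power2_le_imp_le)
  have "(l2norm (S s f))^2 \<le> exp (2 * Bc * (s - 0)) * ((l2norm (S 0 f))^2 + 2 * 0 * (s - 0))"
  proof (rule energy_growth[OF s sg_l2cont[OF SC f] SC_L2[OF _ f]])
    fix r assume r: "0 < r" "r < s"
    then have "S r f \<in> L2" using f by (intro SC_L2) auto
    then show "\<exists>g\<in>L2. rderiv (\<lambda>s. S s f) r g \<and> ip g (S r f) \<le> Bc * (l2norm (S r f))^2 + 0"
      using SC_rderiv[OF f, of r] r Cop_energy[OF t, of "S r f"]
      by (intro bexI[of _ "\<lambda>x. c t x * S r f x"] cmult_L2 t) auto
  qed (use nonneg in auto)
  also have "l2norm (S 0 f) = l2norm f"
    using sg_zero[OF SC f] SC_L2[OF order_refl f] f by (intro l2eq_norm) auto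
  finally show "(l2norm (S s f))^2 \<le> (exp (Bc * s) * l2norm f)^2"
    by (simp add: power_mult_distrib exp_double[symmetric] mult.assoc)
qed simp

lemma SC_increment:
  assumes f: "f \<in> L2" and s: "0 \<le> s" "s \<le> d"
  shows "(l2dist (S s f) f)^2 \<le> exp 1 * (Bc * (exp (Bc * d) * l2norm f))^2 * s^2"
proof (cases "s = 0")
  case True
  then show ?thesis using sg_zero[OF SC f] by (simp add: l2eq_def)
next
  case False
  with s have s0: "0 < s" by simp
  show ?thesis
  proof (rule linear_growth[OF s0])
    show "l2cont (\<lambda>r x. S r f x - f x) 0 s" by (intro l2cont_diff sg_l2cont[OF SC] l2cont_const f)
    show "(\<lambda>x. S r f x - f x) \<in> L2" if "0 \<le> r" for r using SC_L2[OF that f] f by auto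
    show "l2dist (S 0 f) f = 0" using sg_zero[OF SC f] by (simp add: l2eq_def)
    fix r assume r: "0 < r" "r < s"
    have L: "S r f \<in> L2" using r by (intro SC_L2 f) auto
    have "rderiv (\<lambda>r x. S r f x - f x) r (\<lambda>x. c t x * S r f x - 0)"
      by (rule rderiv_diff[OF SC_rderiv[OF f] rderiv_const]; use r L f in \<open>simp add: SC_L2 cmult_L2[OF t]\<close>)
    moreover have "l2norm (\<lambda>x. c t x * S r f x) \<le> Bc * (exp (Bc * d) * l2norm f)"
    proof -
      have "l2norm (\<lambda>x. c t x * S r f x) \<le> Bc * l2norm (S r f)" using L by (intro cmult(2)[OF t]) auto
      also have "\<dots> \<le> Bc * (exp (Bc * r) * l2norm f)"
        using r nonneg by (intro mult_left_mono SC_bound f) auto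
      also have "\<dots> \<le> Bc * (exp (Bc * d) * l2norm f)"
        using r s nonneg by (intro mult_left_mono mult_right_mono) (auto intro!: mult_left_mono)
      finally show ?thesis .
    qed
    ultimately show "\<exists>g\<in>L2. rderiv (\<lambda>r x. S r f x - f x) r g \<and> l2norm g \<le> Bc * (exp (Bc * d) * l2norm f)"
      using cmult_L2[OF t L] by (intro bexI[of _ "\<lambda>x. c t x * S r f x"]) auto
  qed
qed

text \<open>A second-order Taylor estimate divided by \<open>d\<close>: the remainder starts at 0
  and its derivative \<open>c * (S r f - f)\<close> is already of order \<open>d\<close>.\<close>

lemma SC_remainder:
  assumes f: "f \<in> L2" and d: "0 < d"
  shows "(l2norm (\<lambda>x. c t x * f x - 1 / d * (S d f x - f x)))^2 \<le>
    exp 1 * (Bc^2 * (exp 1 * (Bc * (exp (Bc * d) * l2norm f))^2 * d^2))"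
proof -
  define Y where "Y = sqrt (exp 1 * (Bc * (exp (Bc * d) * l2norm f))^2 * d^2)"
  have Y2: "Y^2 = exp 1 * (Bc * (exp (Bc * d) * l2norm f))^2 * d^2" by (simp add: Y_def)
  have Y: "l2dist (S r f) f \<le> Y" if "0 \<le> r" "r \<le> d" for r
  proof (rule power2_le_imp_le)
    have "(l2dist (S r f) f)^2 \<le> exp 1 * (Bc * (exp (Bc * d) * l2norm f))^2 * r^2"
      by (rule SC_increment[OF f that])
    also have "\<dots> \<le> Y^2" unfolding Y2 using that by (intro mult_left_mono power_mono) auto
    finally show "(l2dist (S r f) f)^2 \<le> Y^2" .
  qed (simp add: Y_def)
  \<comment> \<open>The form \<open>0 + 1 * r\<close> matches \<open>rderiv_affine_mult\<close>; at
    \<open>r = d\<close> the quantity to be bounded is \<open>- u d / d\<close>.\<close>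
  define u where "u r = (\<lambda>x. (S r f x - f x) - (0 + 1 * r) * (c t x * f x))" for r
  have cf: "(\<lambda>x. c t x * f x) \<in> L2" by (rule cmult_L2[OF t f])
  have "(l2norm (u d))^2 \<le> exp 1 * (Bc * Y)^2 * d^2"
  proof (rule linear_growth[OF d])
    show "l2cont u 0 d" unfolding u_def
      by (intro l2cont_diff l2cont_affine_mult sg_l2cont[OF SC] l2cont_const f cf)
    show "u r \<in> L2" if "0 \<le> r" for r unfolding u_def by (intro L2_diff L2_cmult SC_L2 that f cf)
    show "l2norm (u 0) = 0" using sg_zero[OF SC f] by (simp add: u_def l2eq_def)
    fix r assume r: "0 < r" "r < d"
    have L: "S r f \<in> L2" using r by (intro SC_L2 f) auto
    have 1: "rderiv (\<lambda>r x. S r f x - f x) r (\<lambda>x. c t x * S r f x - 0)"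
      by (rule rderiv_diff[OF SC_rderiv[OF f] rderiv_const]; use r L f in \<open>simp add: SC_L2 cmult_L2[OF t]\<close>)
    have 2: "rderiv (\<lambda>r x. (0 + 1 * r) * (c t x * f x)) r (\<lambda>x. (0 + 1 * r) * 0 + 1 * (c t x * f x))"
      by (rule rderiv_affine_mult[OF rderiv_const]; use cf in simp)
    have "rderiv u r (\<lambda>x. (c t x * S r f x - 0) - ((0 + 1 * r) * 0 + 1 * (c t x * f x)))" unfolding u_def
      by (rule rderiv_diff[OF 1 2]; use r L f cf in \<open>simp add: SC_L2 cmult_L2[OF t]\<close>)
    then have "rderiv u r (\<lambda>x. c t x * (S r f x - f x))" by (simp add: right_diff_distrib)
    moreover have "l2norm (\<lambda>x. c t x * (S r f x - f x)) \<le> Bc * Y"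
    proof -
      have "l2norm (\<lambda>x. c t x * (S r f x - f x)) \<le> Bc * l2dist (S r f) f"
        using L f by (intro cmult(2)[OF t]) auto
      also have "\<dots> \<le> Bc * Y" using r nonneg by (intro mult_left_mono Y) auto
      finally show ?thesis .
    qed
    moreover have "(\<lambda>x. c t x * (S r f x - f x)) \<in> L2" by (intro cmult_L2[OF t] L2_diff L f)
    ultimately show "\<exists>g\<in>L2. rderiv u r g \<and> l2norm g \<le> Bc * Y" by blast
  qed
  moreover have "(\<lambda>x. c t x * f x - 1 / d * (S d f x - f x)) = (\<lambda>x. (- (1 / d)) * u d x)"
    using d by (auto simp: u_def field_simps)
  then have "(l2norm (\<lambda>x. c t x * f x - 1 / d * (S d f x - f x)))^2 = (l2norm (u d))^2 / d^2"
    using d by (simp only: l2norm_cmult) (simp add: power_divide)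
  ultimately have "(l2norm (\<lambda>x. c t x * f x - 1 / d * (S d f x - f x)))^2 \<le> exp 1 * (Bc * Y)^2"
    using d by (simp add: pos_divide_le_eq)
  then show ?thesis unfolding power_mult_distrib[of Bc Y] Y2 .
qed

end

section \<open>Error of one splitting step and of the product\<close>

definition CP :: "real \<Rightarrow> real" where "CP T = exp 1 * (Bc * exp (Bc * T))^2"

text \<open>The four summands correspond to those of \<open>defect\<close>, after inserting the
  bounds for \<open>p\<close> and \<open>q\<close> in terms of \<open>CP\<close> and replacing
  surplus factors \<open>d\<close> by \<open>T\<close>.\<close>

definition CR :: "real \<Rightarrow> real" where
  "CR T = 8 * CW * CH / \<kappa> * CT T + 8 * CW / \<kappa> * CT T * CP T
     + 1 / 2 * (Bc^2 * (exp (2 * KL * T) * (CP T * T))) + 1 / 2 * (exp 1 * Bc^2 * (CP T * T))"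

lemma CR_nonneg: "0 \<le> T \<Longrightarrow> 0 \<le> CR T"
  unfolding CR_def CP_def using kappa CW_pos CH_pos CT_nonneg[of T]
  by (intro add_nonneg_nonneg mult_nonneg_nonneg divide_nonneg_nonneg) auto

text \<open>All four terms are of order \<open>d\<close>: the first through its weight, the second
  as \<open>d^2 / d\<close>, the last two as \<open>d^2\<close>, which is at most
  \<open>T * d\<close>.\<close>

lemma defect_le:
  assumes d: "0 < d" "d \<le> T" and p: "p^2 \<le> CP T * d^2 * z^2" and q: "q^2 \<le> exp 1 * (Bc^2 * (CP T * d^2 * z^2))"
  shows "defect T d z p q \<le> CR T * (d * z^2)"
proof -
  have CP0: "0 \<le> CP T" by (simp add: CP_def)
  have 1: "CP T * d^2 * z^2 \<le> CP T * T * (d * z^2)"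
  proof -
    have "CP T * d^2 * z^2 = d * (CP T * (d * z^2))" by (simp add: power2_eq_square)
    also have "\<dots> \<le> T * (CP T * (d * z^2))" using d CP0 by (intro mult_right_mono) auto
    finally show ?thesis by (simp add: mult_ac)
  qed
  have "8 * CW * CH * d / \<kappa> * CT T * z^2 = 8 * CW * CH / \<kappa> * CT T * (d * z^2)" by simp
  moreover have "8 * CW / (\<kappa> * d) * CT T * p^2 \<le> 8 * CW / \<kappa> * CT T * CP T * (d * z^2)"
  proof -
    have "8 * CW / (\<kappa> * d) * CT T * p^2 \<le> 8 * CW / (\<kappa> * d) * CT T * (CP T * d^2 * z^2)"
      using d kappa CW_pos CT_nonneg[of T] by (intro mult_left_mono p) auto
    also have "\<dots> = 8 * CW / \<kappa> * CT T * CP T * (d * z^2)" using d by (simp add: power2_eq_square)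
    finally show ?thesis .
  qed
  moreover have "1 / 2 * (Bc^2 * (exp (2 * KL * T) * p^2)) \<le> 1 / 2 * (Bc^2 * (exp (2 * KL * T) * (CP T * T * (d * z^2))))"
    using p 1 by (intro mult_left_mono) auto
  moreover have "1 / 2 * q^2 \<le> 1 / 2 * (exp 1 * (Bc^2 * (CP T * T * (d * z^2))))"
  proof -
    have "exp 1 * (Bc^2 * (CP T * d^2 * z^2)) \<le> exp 1 * (Bc^2 * (CP T * T * (d * z^2)))"
      using 1 by (intro mult_left_mono) auto
    then show ?thesis using q by linarith
  qed
  ultimately have "defect T d z p q \<le> 8 * CW * CH / \<kappa> * CT T * (d * z^2) + 8 * CW / \<kappa> * CT T * CP T * (d * z^2)
    + 1 / 2 * (Bc^2 * (exp (2 * KL * T) * (CP T * T * (d * z^2)))) + 1 / 2 * (exp 1 * (Bc^2 * (CP T * T * (d * z^2))))"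
    unfolding defect_def by linarith
  also have "\<dots> = CR T * (d * z^2)" by (simp add: CR_def algebra_simps)
  finally show ?thesis .
qed

lemma split_step:
  assumes t: "0 \<le> t" and SA: "generates SA (Aop \<kappa> b c t) H2" and SL: "generates SL (Lop \<kappa> b t) H2"
    and SC: "generates SC (Cop c t) L2" and u: "u \<in> L2" and z: "z \<in> L2" and d: "0 < d" "d \<le> T"
  shows "(l2dist (SA d u) (SL d (SC d z)))^2 \<le>
      exp (2 * KS * d) * ((l2dist u z)^2 + 2 * CR T * d^2 * (l2norm z)^2)"
    and "(l2norm (SL d (SC d z)))^2 \<le> exp (2 * KS * d) * (l2norm z)^2"
proof -
  have d0: "0 \<le> d" using d by simp
  have y: "SC d z \<in> L2" by (rule sg_L2[OF SC d0 z])
  let ?p = "l2dist (SC d z) z" and ?q = "l2norm (\<lambda>x. c t x * z x - 1 / d * (SC d z x - z x))"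
  have X: "(Bc * (exp (Bc * d) * l2norm z))^2 \<le> (Bc * exp (Bc * T))^2 * (l2norm z)^2"
  proof -
    have "Bc * (exp (Bc * d) * l2norm z) \<le> Bc * (exp (Bc * T) * l2norm z)"
      using d nonneg by (intro mult_left_mono mult_right_mono) (auto intro!: mult_left_mono)
    then have "(Bc * (exp (Bc * d) * l2norm z))^2 \<le> (Bc * (exp (Bc * T) * l2norm z))^2"
      using nonneg by (intro power_mono) auto
    then show ?thesis by (simp add: power_mult_distrib mult.assoc)
  qed
  then have X': "exp 1 * (Bc * (exp (Bc * d) * l2norm z))^2 * d^2 \<le> CP T * d^2 * (l2norm z)^2"
    using mult_left_mono[OF X, of "exp 1 * d^2"] by (simp add: CP_def mult_ac)
  have p: "?p^2 \<le> CP T * d^2 * (l2norm z)^2"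
    using SC_increment[OF t SC z d0 order_refl] X' by linarith
  have q: "?q^2 \<le> exp 1 * (Bc^2 * (CP T * d^2 * (l2norm z)^2))"
  proof -
    have "exp 1 * (Bc^2 * (exp 1 * (Bc * (exp (Bc * d) * l2norm z))^2 * d^2)) \<le>
        exp 1 * (Bc^2 * (CP T * d^2 * (l2norm z)^2))"
      using X' by (intro mult_left_mono) auto
    then show ?thesis using SC_remainder[OF t SC z d(1)] by linarith
  qed
  have "(l2dist (SA d u) (SL d (SC d z)))^2 \<le> exp (2 * KS * d) * ((l2dist u z)^2
     + 2 * defect T d (l2norm z) ?p ?q * d)"
    by (rule split_step_L2[OF t SA SL u z y d])
  also have "\<dots> \<le> exp (2 * KS * d) * ((l2dist u z)^2 + 2 * (CR T * (d * (l2norm z)^2)) * d)"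
    using d defect_le[OF d p q] by (intro mult_left_mono add_left_mono mult_right_mono) auto
  also have "2 * (CR T * (d * (l2norm z)^2)) * d = 2 * CR T * d^2 * (l2norm z)^2"
    by (simp add: power2_eq_square)
  finally show "(l2dist (SA d u) (SL d (SC d z)))^2 \<le>
      exp (2 * KS * d) * ((l2dist u z)^2 + 2 * CR T * d^2 * (l2norm z)^2)" .
  have "(l2norm (SL d (SC d z)))^2 \<le> exp (2 * KL * d) * (l2norm (SC d z))^2"
    by (rule SL_bound[OF t SL y d0])
  also have "\<dots> \<le> exp (2 * KL * d) * (exp (Bc * d) * l2norm z)^2"
    by (intro mult_left_mono power_mono SC_bound[OF t SC z d0]) auto
  also have "\<dots> = (exp (2 * KL * d) * exp (2 * (Bc * d))) * (l2norm z)^2"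
    unfolding power_mult_distrib exp_double mult.assoc ..
  also have "exp (2 * KL * d) * exp (2 * (Bc * d)) = exp (2 * (KL + Bc) * d)"
    by (simp add: exp_add[symmetric] algebra_simps)
  also have "exp (2 * (KL + Bc) * d) * (l2norm z)^2 \<le> exp (2 * KS * d) * (l2norm z)^2"
    using d kappa by (intro mult_right_mono) (auto simp: KS_def intro!: mult_right_mono)
  finally show "(l2norm (SL d (SC d z)))^2 \<le> exp (2 * KS * d) * (l2norm z)^2" .
qed

text \<open>The source of order \<open>d\<close> acts for time \<open>d\<close>, so each step adds
  order \<open>d^2\<close> to the squared distance; after \<open>n\<close> steps this is
  \<open>n * d^2\<close>, and the root gives the factor \<open>sqrt (n * d * d)\<close>.\<close>

lemma split_product:
  assumes SA: "\<And>t. 0 \<le> t \<Longrightarrow> generates (SA t) (Aop \<kappa> b c t) H2"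
    and SL: "\<And>t. 0 \<le> t \<Longrightarrow> generates (SL t) (Lop \<kappa> b t) H2"
    and SC: "\<And>t. 0 \<le> t \<Longrightarrow> generates (SC t) (Cop c t) L2"
    and f: "f \<in> L2" and d: "0 < d" "d \<le> T"
  defines "v \<equiv> \<lambda>n. opprod (\<lambda>k. SA (real k * d) d) n f"
    and "w \<equiv> \<lambda>n. opprod (\<lambda>k. SL (real k * d) d \<circ> SC (real k * d) d) n f"
  shows "l2dist (v n) (w n) \<le> exp (KS * (real n * d)) * sqrt (2 * CR T * (real n * d) * d) * l2norm f"
proof -
  have CR: "0 \<le> CR T" using d by (intro CR_nonneg) auto
  have d0: "0 \<le> d" using d by simp
  define E where "E n = exp (2 * KS * (real n * d))" for n
  have ES: "exp (2 * KS * d) * E n = E (Suc n)" for n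
    by (simp add: E_def exp_add[symmetric] algebra_simps)
  \<comment> \<open>The bound on \<open>w n\<close> belongs to the induction because the
    contribution of the next step is proportional to its squared norm.\<close>
  have "v n \<in> L2 \<and> w n \<in> L2 \<and> (l2norm (w n))^2 \<le> E n * (l2norm f)^2 \<and>
    (l2dist (v n) (w n))^2 \<le> E n * (real n * (2 * CR T * d^2) * (l2norm f)^2)"
  proof (induction n)
    case 0
    then show ?case using f by (simp add: v_def w_def E_def)
  next
    case (Suc n)
    then have IH: "v n \<in> L2" "w n \<in> L2" "(l2norm (w n))^2 \<le> E n * (l2norm f)^2"
      "(l2dist (v n) (w n))^2 \<le> E n * (real n * (2 * CR T * d^2) * (l2norm f)^2)" by auto
    define t where "t = real n * d"
    have t: "0 \<le> t" using d by (simp add: t_def)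
    have vS: "v (Suc n) = SA t d (v n)" and wS: "w (Suc n) = SL t d (SC t d (w n))"
      by (simp_all add: v_def w_def t_def)
    have L: "v (Suc n) \<in> L2" "w (Suc n) \<in> L2" unfolding vS wS
      by (intro sg_L2[OF SA[OF t]] sg_L2[OF SL[OF t]] sg_L2[OF SC[OF t]] d0 IH)+
    note st = split_step[OF t SA[OF t] SL[OF t] SC[OF t] IH(1,2) d]
    have "(l2norm (w (Suc n)))^2 \<le> exp (2 * KS * d) * (l2norm (w n))^2" unfolding wS by (rule st(2))
    also have "\<dots> \<le> exp (2 * KS * d) * (E n * (l2norm f)^2)" by (intro mult_left_mono IH) auto
    also have "\<dots> = E (Suc n) * (l2norm f)^2" by (simp only: ES flip: mult.assoc)
    finally have 1: "(l2norm (w (Suc n)))^2 \<le> E (Suc n) * (l2norm f)^2" .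
    have "(l2dist (v (Suc n)) (w (Suc n)))^2 \<le>
        exp (2 * KS * d) * ((l2dist (v n) (w n))^2 + 2 * CR T * d^2 * (l2norm (w n))^2)"
      unfolding vS wS by (rule st(1))
    also have "\<dots> \<le> exp (2 * KS * d) * (E n * (real n * (2 * CR T * d^2) * (l2norm f)^2) + 2 * CR T * d^2 * (E n * (l2norm f)^2))"
      using CR by (intro mult_left_mono add_mono IH) auto
    also have "\<dots> = (exp (2 * KS * d) * E n) * (real (Suc n) * (2 * CR T * d^2) * (l2norm f)^2)"
      by (simp add: algebra_simps)
    also have "\<dots> = E (Suc n) * (real (Suc n) * (2 * CR T * d^2) * (l2norm f)^2)" by (simp only: ES)
    finally show ?case using 1 L by blast
  qed
  then have "(l2dist (v n) (w n))^2 \<le> E n * (real n * (2 * CR T * d^2) * (l2norm f)^2)" by blast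
  also have "\<dots> = (exp (KS * (real n * d)) * sqrt (2 * CR T * (real n * d) * d) * l2norm f)^2"
  proof -
    have "E n = (exp (KS * (real n * d)))^2" unfolding E_def mult.assoc exp_double ..
    moreover have "(sqrt (2 * CR T * (real n * d) * d))^2 = real n * (2 * CR T * d^2)"
      using CR d by (subst real_sqrt_pow2) (auto simp: power2_eq_square)
    ultimately show ?thesis by (simp only: power_mult_distrib mult.assoc)
  qed
  finally show ?thesis by (rule power2_le_imp_le) (use CR d in simp)
qed

end

section \<open>Assembly of the two operator norm bounds\<close>

theorem mainTheorem4:
  fixes \<kappa> \<beta> :: real
    and b :: "real \<Rightarrow> real^'d::finite \<Rightarrow> real^'d"
    and c :: "real \<Rightarrow> real^'d \<Rightarrow> real"
    and U :: "real \<Rightarrow> real \<Rightarrow> 'd op"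
    and SA SL SC :: "real \<Rightarrow> real \<Rightarrow> 'd op"
  assumes "\<kappa> > 0" and "1/2 < \<beta>" and "\<beta> \<le> 1"
    and "coeff_assms \<beta> b c TYPE('d)"
    and "evolution_family U (Aop \<kappa> b c)"
    and "\<forall>t\<ge>0. generates (SA t) (Aop \<kappa> b c t) H2"
    and "\<forall>t\<ge>0. generates (SL t) (Lop \<kappa> b t) H2"
    and "\<forall>t\<ge>0. generates (SC t) (Cop c t) L2"
  shows "\<forall>T>0. \<exists>C1 C2. \<forall>M::nat. M \<ge> 1 \<longrightarrow>
     (let dt = T / real M in
        opnorm (opdiff (U T 0) (opprod (\<lambda>k. SA (real k * dt) dt) M))
          \<le> C1 * dt powr (\<beta> - 1/2)
      \<and> opnorm (opdiff (opprod (\<lambda>k. SA (real k * dt) dt) M)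
                        (opprod (\<lambda>k. SL (real k * dt) dt \<circ> SC (real k * dt) dt) M))
          \<le> C2 * dt powr (1/2))"
proof (intro allI impI)
  fix T :: real assume T: "T > 0"
  note coeff = assms(4)[unfolded coeff_assms_def]
  have bB: "\<exists>B. \<forall>t\<ge>0. \<forall>x. \<bar>dlist is (\<lambda>y. b t y $ j) x\<bar> \<le> B" for "is" j
    using coeff[THEN conjunct2, THEN conjunct2, THEN conjunct1] by (elim allE)
  have cB: "\<exists>B. \<forall>t\<ge>0. \<forall>x. \<bar>dlist is (c t) x\<bar> \<le> B" for "is"
    using coeff[THEN conjunct2, THEN conjunct2, THEN conjunct2, THEN conjunct1] by (elim allE)
  have "\<forall>j. \<exists>B. \<forall>t\<ge>0. \<forall>x. \<bar>b t x $ j\<bar> \<le> B" using bB[of "[]"] by simp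
  from choice[OF this] obtain B1 where B1: "\<And>t x j. 0 \<le> t \<Longrightarrow> \<bar>b t x $ j\<bar> \<le> B1 j"
    by auto
  obtain B2 where B2: "\<And>t x. 0 \<le> t \<Longrightarrow> \<bar>c t x\<bar> \<le> B2"
    using cB[of "[]"] by auto
  have "\<forall>i. \<exists>B. \<forall>t\<ge>0. \<forall>x. \<bar>pd i (c t) x\<bar> \<le> B" using cB[of "[i]" for i] by simp
  from choice[OF this] obtain B3 where B3: "\<And>t x i. 0 \<le> t \<Longrightarrow> \<bar>pd i (c t) x\<bar> \<le> B3 i"
    by auto
  obtain C where C: "\<And>t s x. 0 \<le> t \<Longrightarrow> 0 \<le> s \<Longrightarrow> norm (b t x - b s x) + \<bar>c t x - c s x\<bar> \<le> C * \<bar>t - s\<bar> powr \<beta>"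
    using coeff[THEN conjunct2, THEN conjunct2, THEN conjunct2, THEN conjunct2] by auto
  \<comment> \<open>Summing absolute values over the finitely many directions turns bounds for the
    single components into one nonnegative bound.\<close>
  have sum_ge: "B j \<le> (\<Sum>i\<in>UNIV. \<bar>B i\<bar>)" for B :: "'d \<Rightarrow> real" and j
    using member_le_sum[of j UNIV "\<lambda>i. \<bar>B i\<bar>"] by force
  interpret advection_coeffs \<kappa> \<beta> b c "\<Sum>i\<in>UNIV. \<bar>B1 i\<bar>" "\<bar>B2\<bar>" "\<Sum>i\<in>UNIV. \<bar>B3 i\<bar>" "\<bar>C\<bar>"
  proof
    show "\<bar>b t x $ i\<bar> \<le> (\<Sum>i\<in>UNIV. \<bar>B1 i\<bar>)" if "0 \<le> t" for t x i using B1[OF that, of x i] sum_ge[of B1 i] by linarith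
    show "\<bar>c t x\<bar> \<le> \<bar>B2\<bar>" if "0 \<le> t" for t x using B2[OF that, of x] by linarith
    show "\<bar>pd i (c t) x\<bar> \<le> (\<Sum>i\<in>UNIV. \<bar>B3 i\<bar>)" if "0 \<le> t" for t x i using B3[OF that, of i x] sum_ge[of B3 i] by linarith
    show "norm (b t x - b s x) + \<bar>c t x - c s x\<bar> \<le> \<bar>C\<bar> * \<bar>t - s\<bar> powr \<beta>" if "0 \<le> t" "0 \<le> s" for t s x
    proof -
      have "C * \<bar>t - s\<bar> powr \<beta> \<le> \<bar>C\<bar> * \<bar>t - s\<bar> powr \<beta>" by (intro mult_right_mono) auto
      then show ?thesis using C[OF that, of x] by linarith
    qed
  qed (use assms(1,2) coeff in \<open>auto intro: sum_nonneg\<close>)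
  have SA: "generates (SA t) (Aop \<kappa> b c t) H2" and SL: "generates (SL t) (Lop \<kappa> b t) H2"
    and SC: "generates (SC t) (Cop c t) L2" if "0 \<le> t" for t using assms(6-8) that by auto
  \<comment> \<open>The estimate has order \<open>d powr \<beta>\<close>; the factor
    \<open>T powr (1/2)\<close> converts it to the exponent \<open>\<beta> - 1/2\<close> through
    \<open>d \<le> T\<close>.\<close>
  let ?C1 = "exp (KA * T) * (\<bar>C\<bar> / sqrt \<kappa>) * T powr (1/2)"
  let ?C2 = "exp (KS * T) * sqrt (2 * CR T * T)"
  show "\<exists>C1 C2. \<forall>M::nat. M \<ge> 1 \<longrightarrow>
     (let dt = T / real M in
        opnorm (opdiff (U T 0) (opprod (\<lambda>k. SA (real k * dt) dt) M))
          \<le> C1 * dt powr (\<beta> - 1/2)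
      \<and> opnorm (opdiff (opprod (\<lambda>k. SA (real k * dt) dt) M)
                        (opprod (\<lambda>k. SL (real k * dt) dt \<circ> SC (real k * dt) dt) M))
          \<le> C2 * dt powr (1/2))"
    unfolding Let_def
  proof (rule exI[of _ ?C1], rule exI[of _ ?C2], intro allI impI conjI)
    fix M :: nat assume M: "M \<ge> 1"
    define d where "d = T / real M"
    have d: "0 < d" "d \<le> T" and Md: "real M * d = T" using M T by (auto simp: d_def divide_simps)
    have P: "bounded_op (opprod (\<lambda>k. SA (real k * d) d) M)"
      using d by (intro bounded_op_opprod sg_bounded_op[OF SA]) auto
    have Q: "bounded_op (opprod (\<lambda>k. SL (real k * d) d \<circ> SC (real k * d) d) M)"
      using d by (intro bounded_op_opprod bounded_op_comp sg_bounded_op[OF SL] sg_bounded_op[OF SC]) auto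
    have UT: "bounded_op (U T 0)" using evo_bounded_op[OF assms(5) Aop_L2, of 0 T] T by simp
    have "opnorm (opdiff (U T 0) (opprod (\<lambda>k. SA (real k * d) d) M)) \<le> exp (KA * T) * (\<bar>C\<bar> * d powr \<beta> / sqrt \<kappa>)"
    proof (rule opnorm_opdiff_le[OF UT P])
      show "0 \<le> exp (KA * T) * (\<bar>C\<bar> * d powr \<beta> / sqrt \<kappa>)" using kappa by simp
      fix f :: "'d fn" assume f: "f \<in> H2"
      show "l2dist (U T 0 f) (opprod (\<lambda>k. SA (real k * d) d) M f) \<le> exp (KA * T) * (\<bar>C\<bar> * d powr \<beta> / sqrt \<kappa>) * l2norm f"
        using frozen_product_H2[OF assms(5) SA d(1) f refl, of M] unfolding Md .
    qed
    also have "\<dots> \<le> ?C1 * d powr (\<beta> - 1/2)"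
    proof -
      have "d powr \<beta> = d powr (1/2) * d powr (\<beta> - 1/2)" by (simp flip: powr_add)
      also have "\<dots> \<le> T powr (1/2) * d powr (\<beta> - 1/2)" using d by (intro mult_right_mono powr_mono2) auto
      finally have "exp (KA * T) * (\<bar>C\<bar> / sqrt \<kappa>) * d powr \<beta> \<le> exp (KA * T) * (\<bar>C\<bar> / sqrt \<kappa>) * (T powr (1/2) * d powr (\<beta> - 1/2))"
        using kappa by (intro mult_left_mono) auto
      then show ?thesis by (simp add: mult.assoc)
    qed
    finally show "opnorm (opdiff (U T 0) (opprod (\<lambda>k. SA (real k * (T / real M)) (T / real M)) M)) \<le> ?C1 * (T / real M) powr (\<beta> - 1/2)"
      unfolding d_def .
    have "opnorm (opdiff (opprod (\<lambda>k. SA (real k * d) d) M) (opprod (\<lambda>k. SL (real k * d) d \<circ> SC (real k * d) d) M))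
        \<le> exp (KS * T) * sqrt (2 * CR T * T * d)"
    proof (rule opnorm_opdiff_le[OF P Q])
      show "0 \<le> exp (KS * T) * sqrt (2 * CR T * T * d)" using CR_nonneg[of T] T d by simp
      fix f :: "'d fn" assume "f \<in> H2"
      then have f: "f \<in> L2" by (simp add: H2_def)
      show "l2dist (opprod (\<lambda>k. SA (real k * d) d) M f) (opprod (\<lambda>k. SL (real k * d) d \<circ> SC (real k * d) d) M f)
        \<le> exp (KS * T) * sqrt (2 * CR T * T * d) * l2norm f"
        using split_product[OF SA SL SC f d, of M] unfolding Md .
    qed
    also have "\<dots> = ?C2 * d powr (1/2)" using d by (simp add: real_sqrt_mult powr_half_sqrt)
    finally show "opnorm (opdiff (opprod (\<lambda>k. SA (real k * (T / real M)) (T / real M)) M)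
        (opprod (\<lambda>k. SL (real k * (T / real M)) (T / real M) \<circ> SC (real k * (T / real M)) (T / real M)) M))
        \<le> ?C2 * (T / real M) powr (1/2)" unfolding d_def by simp
  qed
qed

end
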